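(* Let $0<\kappa_1<\kappa_2$, let $\rho_0\in L^\infty(\mathbb{R};\mathbb{R}_{\ge 0})$, and let $V\in W^{2,\infty}_{\mathrm{loc}}(\mathbb{R})$ be a nonincreasing function such that at least one of the following two conditions is satisfied: (A) there is $\delta>0$ with $V'(\xi)=-\delta$ for all $\xi\in[\operatorname{ess\,inf}\rho_0,\operatorname{ess\,sup}\rho_0]$; (B) $0\le V'(\xi)+V''(\xi)\,\xi\le\kappa_1$ and $V'(\xi)\le-\kappa_2$ (with $\kappa_2-\kappa_1>0$) for all $\xi\in[\operatorname{ess\,inf}\rho_0,\operatorname{ess\,sup}\rho_0]$. Let $\varepsilon>0$ and let $\rho_\varepsilon$ be the weak solution of the nonlocal Cauchy problem $$\partial_t\rho_\varepsilon+\partial_x\big(V(W_\varepsilon)\rho_\varepsilon\big)=0,\qquad \rho_\varepsilon(0,x)=\rho_0(x),\qquad W_\varepsilon(t,x)=\frac1\varepsilon\int_x^\infty \exp\Big(\frac{x-y}{\varepsilon}\Big)\rho_\varepsilon(t,y)\,\mathrm{d}y .$$ Then $$\frac{W_\varepsilon(t,x)-W_\varepsilon(t,y)}{x-y}\ge-\frac{1}{\kappa t}\qquad\text{for all } t>0 \text{ and all } x,y\in\mathbb{R} \text{ with } x\ne y,$$ where $\kappa:=\delta$ in case (A) holds, or $\kappa:=\kappa_2-\kappa_1$ in case (B) holds.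
   Context: For $V\in W^{2,\infty}_{\mathrm{loc}}(\mathbb{R})$ nonincreasing, $\rho_0\in L^\infty(\mathbb{R};\mathbb{R}_{\ge0})$, $\varepsilon>0$ and $T>0$, a weak solution of the nonlocal Cauchy problem on $(0,T)\times\mathbb{R}$ is a function $\rho_\varepsilon\in C([0,T];L^1_{\mathrm{loc}}(\mathbb{R}))\cap L^\infty((0,T);L^\infty(\mathbb{R}))$ such that, with $W_\varepsilon$ given by the exponential integral of $\rho_\varepsilon$, $\int_0^T\!\int_{\mathbb{R}}\big(\rho_\varepsilon\,\partial_t\varphi+V(W_\varepsilon)\rho_\varepsilon\,\partial_x\varphi\big)\,\mathrm{d}x\,\mathrm{d}t+\int_{\mathbb{R}}\rho_0\,\varphi(0,\cdot)\,\mathrm{d}x=0$ for all $\varphi\in C_c^\infty([0,T)\times\mathbb{R})$. It is known that such a solution exists and is unique for every $T>0$ (so it is defined for all $t>0$), that $\operatorname{ess\,inf}\rho_0\le\rho_\varepsilon\le\operatorname{ess\,sup}\rho_0$ a.e. (and the same bounds hold for $W_\varepsilon$), and that $W_\varepsilon\in W^{1,\infty}([0,T]\times\mathbb{R})$. *)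

theory Defs
  imports "HOL-Analysis.Analysis" "HOL-Probability.Essential_Supremum"
begin

section \<open>Smooth and compactly supported functions\<close>

text \<open>Frechet differentiability at every stage makes all the derivatives involved continuous.\<close>

primrec Ck :: "nat \<Rightarrow> ('a::euclidean_space \<Rightarrow> real) \<Rightarrow> bool" where
  "Ck 0 f \<longleftrightarrow> continuous_on UNIV f"
| "Ck (Suc k) f \<longleftrightarrow>
     (\<exists>f'. (\<forall>x. (f has_derivative f' x) (at x)) \<and> (\<forall>v. Ck k (\<lambda>x. f' x v)))"

definition smooth :: "('a::euclidean_space \<Rightarrow> real) \<Rightarrow> bool" where
  "smooth f \<longleftrightarrow> (\<forall>k. Ck k f)"

definition support :: "('a::euclidean_space \<Rightarrow> real) \<Rightarrow> 'a set" where
  "support f = closure {x. f x \<noteq> 0}"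

text \<open>\<open>Cc_infinity U\<close> is the space \<open>C_c^\<infinity>(U)\<close> for open \<open>U\<close>.\<close>

definition Cc_infinity :: "'a::euclidean_space set \<Rightarrow> ('a \<Rightarrow> real) set" where
  "Cc_infinity U = {f. smooth f \<and> compact (support f) \<and> support f \<subseteq> U}"

section \<open>Lebesgue and Sobolev spaces on the real line\<close>

definition Linf :: "(real \<Rightarrow> real) set" where
  "Linf = {f. f \<in> borel_measurable lebesgue \<and> (\<exists>C. AE x in lebesgue. \<bar>f x\<bar> \<le> C)}"

definition Linf_loc :: "(real \<Rightarrow> real) set" where
  "Linf_loc = {f. f \<in> borel_measurable lebesgue \<and>
     (\<forall>K. compact K \<longrightarrow> (\<exists>C. AE x in lebesgue. x \<in> K \<longrightarrow> \<bar>f x\<bar> \<le> C))}"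

definition L1_loc :: "(real \<Rightarrow> real) set" where
  "L1_loc = {f. \<forall>K. compact K \<longrightarrow> set_integrable lebesgue K f}"

definition weak_deriv :: "(real \<Rightarrow> real) \<Rightarrow> (real \<Rightarrow> real) \<Rightarrow> bool" where
  "weak_deriv f g \<longleftrightarrow> (\<forall>\<phi> \<in> Cc_infinity UNIV.
     (LINT x|lebesgue. f x * deriv \<phi> x) = - (LINT x|lebesgue. g x * \<phi> x))"

text \<open>\<open>W2inf_loc V V' V''\<close>: \<open>V\<close> belongs to \<open>W\<^bsup>2,\<infinity>\<^esup>\<close> locally, with weak derivatives \<open>V'\<close> and
  \<open>V''\<close>. As usual, \<open>V\<close> and \<open>V'\<close> denote the continuous representatives of their classes, so that
  their pointwise values are meaningful; \<open>V''\<close> is determined only almost everywhere.\<close>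

definition W2inf_loc :: "(real \<Rightarrow> real) \<Rightarrow> (real \<Rightarrow> real) \<Rightarrow> (real \<Rightarrow> real) \<Rightarrow> bool" where
  "W2inf_loc V V' V'' \<longleftrightarrow>
     V \<in> Linf_loc \<and> V' \<in> Linf_loc \<and> V'' \<in> Linf_loc \<and>
     weak_deriv V V' \<and> weak_deriv V' V'' \<and>
     continuous_on UNIV V \<and> continuous_on UNIV V'"

definition ess_sup :: "(real \<Rightarrow> real) \<Rightarrow> ereal" where
  "ess_sup f = esssup lebesgue (\<lambda>x. ereal (f x))"

definition ess_inf :: "(real \<Rightarrow> real) \<Rightarrow> ereal" where
  "ess_inf f = - ess_sup (\<lambda>x. - f x)"

definition ess_range_interval :: "(real \<Rightarrow> real) \<Rightarrow> real set" where
  "ess_range_interval f = {\<xi>. ess_inf f \<le> ereal \<xi> \<and> ereal \<xi> \<le> ess_sup f}"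

section \<open>The nonlocal Cauchy problem\<close>

definition W :: "real \<Rightarrow> (real \<Rightarrow> real \<Rightarrow> real) \<Rightarrow> real \<Rightarrow> real \<Rightarrow> real" where
  "W \<epsilon> \<rho> t x = (1 / \<epsilon>) * (LINT y:{x<..}|lebesgue. exp ((x - y) / \<epsilon>) * \<rho> t y)"

text \<open>\<open>C([0,T]; L\<^sup>1\<^sub>loc)\<close>: for each time \<open>t\<close>, \<open>\<rho> t\<close> is any representative of the value at \<open>t\<close>.\<close>

definition C_L1_loc :: "real \<Rightarrow> (real \<Rightarrow> real \<Rightarrow> real) set" where
  "C_L1_loc T = {\<rho>. (\<forall>t\<in>{0..T}. \<rho> t \<in> L1_loc) \<and>
     (\<forall>K. compact K \<longrightarrow> (\<forall>s\<in>{0..T}.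
        ((\<lambda>t. LINT x:K|lebesgue. \<bar>\<rho> t x - \<rho> s x\<bar>) \<longlongrightarrow> 0) (at s within {0..T})))}"

text \<open>The boundedness condition of \<open>L\<^sup>\<infinity>((0,T); L\<^sup>\<infinity>)\<close>. It is only used for elements of
  \<open>C_L1_loc T\<close>, for which measurability in time is automatic.\<close>

definition Linf_Linf :: "real \<Rightarrow> (real \<Rightarrow> real \<Rightarrow> real) set" where
  "Linf_Linf T = {\<rho>. \<exists>C. AE t in lebesgue. t \<in> {0<..<T} \<longrightarrow>
     \<rho> t \<in> borel_measurable lebesgue \<and> (AE x in lebesgue. \<bar>\<rho> t x\<bar> \<le> C)}"

text \<open>Test functions in \<open>C_c^\<infinity>([0,T) \<times> \<real>)\<close> are the restrictions to \<open>t \<ge> 0\<close> of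
  functions in \<open>C_c^\<infinity>((-\<infinity>,T) \<times> \<real>)\<close>; they need not vanish at \<open>t = 0\<close>.\<close>

definition weak_solution ::
    "(real \<Rightarrow> real) \<Rightarrow> (real \<Rightarrow> real) \<Rightarrow> real \<Rightarrow> real \<Rightarrow> (real \<Rightarrow> real \<Rightarrow> real) \<Rightarrow> bool" where
  "weak_solution V \<rho>0 \<epsilon> T \<rho> \<longleftrightarrow>
     \<rho> \<in> C_L1_loc T \<inter> Linf_Linf T \<and>
     (\<forall>\<phi> \<in> Cc_infinity ({..<T} \<times> UNIV).
        (LINT t:{0<..<T}|lebesgue. (LINT x|lebesgue.
            \<rho> t x * deriv (\<lambda>s. \<phi> (s, x)) t
            + V (W \<epsilon> \<rho> t x) * \<rho> t x * deriv (\<lambda>y. \<phi> (t, y)) x))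
        + (LINT x|lebesgue. \<rho>0 x * \<phi> (0, x)) = 0)"

section \<open>The two structural conditions on the velocity\<close>

definition cond_A :: "(real \<Rightarrow> real) \<Rightarrow> (real \<Rightarrow> real) \<Rightarrow> real \<Rightarrow> bool" where
  "cond_A V' \<rho>0 \<delta> \<longleftrightarrow> \<delta> > 0 \<and> (\<forall>\<xi>\<in>ess_range_interval \<rho>0. V' \<xi> = - \<delta>)"

definition cond_B ::
    "(real \<Rightarrow> real) \<Rightarrow> (real \<Rightarrow> real) \<Rightarrow> (real \<Rightarrow> real) \<Rightarrow> real \<Rightarrow> real \<Rightarrow> bool" where
  "cond_B V' V'' \<rho>0 \<kappa>1 \<kappa>2 \<longleftrightarrow>
     (AE \<xi> in lebesgue. \<xi> \<in> ess_range_interval \<rho>0 \<longrightarrow>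
        0 \<le> V' \<xi> + V'' \<xi> * \<xi> \<and> V' \<xi> + V'' \<xi> * \<xi> \<le> \<kappa>1) \<and>
     (\<forall>\<xi>\<in>ess_range_interval \<rho>0. V' \<xi> \<le> - \<kappa>2)"

end

theory Submission
  imports Defs "HOL-Real_Asymp.Real_Asymp"
begin

text \<open>
  Write \<open>K g\<close> for the exponential average \<open>(1/\<epsilon>) \<integral>\<^sub>x\<^sup>\<infinity> e\<^bsup>(x-y)/\<epsilon>\<^esup> g(y) dy\<close>, so that \<open>W = K \<rho>\<close> and, formally,
  \<open>\<epsilon> W\<^sub>x = W - \<rho>\<close>. Eliminating \<open>\<rho>\<close> from the conservation law gives a closed transport equation

    \<open>W\<^sub>t + V(W) W\<^sub>x = (U(W) - K U(W)) / \<epsilon>\<close>  with  \<open>U'(\<xi>) = \<xi> V'(\<xi>)\<close>,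

  whose right-hand side is called the drift. Two facts about it carry the proof. Where \<open>W \<ge> 0\<close>, \<open>U\<close> is
  nonincreasing, so the drift pushes extreme values of \<open>W\<close> inwards: \<open>W\<close> stays between the essential
  infimum and supremum of \<open>\<rho>0\<close>, where the structural conditions hold. And if \<open>-m\<close> is the infimum of
  \<open>W\<^sub>x\<close>, attained at a point, then there the derivative of the drift is at least \<open>-k1 m\<^sup>2\<close>, where \<open>k1\<close> bounds the
  slope of \<open>\<xi> V'(\<xi>)\<close> from above (\<open>k1 = 0\<close> under (A), \<open>k1 = \<kappa>1\<close> under (B)). The term \<open>-V'(W) W\<^sub>x\<^sup>2\<close>, which comes
  from differentiating the transport velocity, is at least \<open>k2 m\<^sup>2\<close> there, where \<open>V' \<le> -k2\<close>. Hence
  \<open>m' \<le> -(k2 - k1) m\<^sup>2\<close>, and comparison with the solution \<open>1 / (\<kappa> t)\<close> of the Riccati equation gives the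
  estimate for \<open>\<kappa> = k2 - k1\<close>.

  The solution is only bounded, so \<open>W\<close> is merely Lipschitz in \<open>x\<close>. The argument is therefore
  made with difference quotients of \<open>W\<close> along pairs of characteristics \<open>X' = V(W(t, X))\<close>. Since the drift is
  continuous, \<open>W\<close> is differentiable along every characteristic with the drift as
  derivative (\<open>w_along_characteristic\<close>). This follows from the weak formulation with test functions
  that approximate the kernel of \<open>K\<close>, together with the identity \<open>expavg_flux_identity\<close>, which replaces the
  integration by parts that eliminates \<open>\<rho>\<close>. An infimum of the quotients need not be attained, but the
  inequality for \<open>m'\<close> survives for every quotient \<open>-F\<close> up to a multiple of \<open>m - F\<close>; the part that
  concerns the drift is \<open>drift_difference\<close>. Such an error is what the Gronwall inequality for suprema
  over curves (\<open>sup_gronwall\<close>) absorbs. The same inequality yields the bounds for \<open>W\<close> (\<open>w_range\<close>) and, applied to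
  \<open>t F - 1 / \<kappa>\<close>, the theorem (\<open>one_sided_bound\<close>).
\<close>


section \<open>Smooth functions\<close>

lemma Ck_const: "Ck k (\<lambda>x. c)"
proof (induction k arbitrary: c)
  case (Suc k)
  have "((\<lambda>x. c) has_derivative (\<lambda>v. 0)) (at x)" for x :: 'a by simp
  then show ?case using Suc by (force intro: exI[of _ "\<lambda>x v. 0"])
qed simp

lemma Ck_add: "Ck k f \<Longrightarrow> Ck k g \<Longrightarrow> Ck k (\<lambda>x. f x + g x)"
proof (induction k arbitrary: f g)
  case 0 then show ?case by (simp add: continuous_on_add)
next
  case (Suc k)
  from Suc.prems obtain f' g' where
    d: "\<And>x. (f has_derivative f' x) (at x)" "\<And>x. (g has_derivative g' x) (at x)"
    and c: "\<And>v. Ck k (\<lambda>x. f' x v)" "\<And>v. Ck k (\<lambda>x. g' x v)" by auto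
  have "((\<lambda>x. f x + g x) has_derivative (\<lambda>v. f' x v + g' x v)) (at x)" for x
    using d by (intro has_derivative_add)
  then show ?case using Suc.IH[OF c] by (auto intro!: exI[of _ "\<lambda>x v. f' x v + g' x v"])
qed

lemma Ck_Suc_imp: "Ck (Suc k) f \<Longrightarrow> Ck k f"
proof (induction k arbitrary: f)
  case 0 then show ?case
    using has_derivative_continuous by (fastforce simp: continuous_on_eq_continuous_within)
next
  case (Suc k)
  from Suc.prems obtain f' where
    "\<And>x. (f has_derivative f' x) (at x)" "\<And>v. Ck (Suc k) (\<lambda>x. f' x v)"
    unfolding Ck.simps(2)[of "Suc k"] by blast
  then show ?case using Suc.IH unfolding Ck.simps(2)[of k] by blast
qed

lemma Ck_mult: "Ck k f \<Longrightarrow> Ck k g \<Longrightarrow> Ck k (\<lambda>x. f x * g x)"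
proof (induction k arbitrary: f g)
  case 0 then show ?case by (simp add: continuous_on_mult)
next
  case (Suc k)
  from Suc.prems obtain f' g' where
    d: "\<And>x. (f has_derivative f' x) (at x)" "\<And>x. (g has_derivative g' x) (at x)"
    and c: "\<And>v. Ck k (\<lambda>x. f' x v)" "\<And>v. Ck k (\<lambda>x. g' x v)" by auto
  have fg: "Ck k f" "Ck k g" using Suc.prems Ck_Suc_imp by blast+
  have "((\<lambda>x. f x * g x) has_derivative (\<lambda>v. f x * g' x v + f' x v * g x)) (at x)" for x
    using d by (intro has_derivative_mult)
  moreover have "Ck k (\<lambda>x. f x * g' x v + f' x v * g x)" for v
    using Suc.IH fg c Ck_add by blast
  ultimately show ?case by (auto intro!: exI[of _ "\<lambda>x v. f x * g' x v + f' x v * g x"])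
qed

text \<open>The affine case of the chain rule covers translations, dilations and the coordinate
  projections of the space-time plane.\<close>

lemma Ck_compose_affine:
  assumes "bounded_linear l"
  shows "Ck k f \<Longrightarrow> Ck k (\<lambda>x. f (l x + c))"
proof (induction k arbitrary: f)
  case 0
  have "continuous_on UNIV (\<lambda>x. l x + c)"
    using assms by (intro continuous_intros linear_continuous_on)
  from continuous_on_compose2[OF _ this] 0 show ?case by auto
next
  case (Suc k)
  from Suc.prems obtain f' where
    d: "\<And>x. (f has_derivative f' x) (at x)" and c: "\<And>v. Ck k (\<lambda>x. f' x v)" by auto
  have "((\<lambda>x. l x + c) has_derivative l) (at x)" for x
    using bounded_linear_imp_has_derivative[OF assms] by (auto intro!: derivative_eq_intros)
  from has_derivative_compose[OF this d]
  have "((\<lambda>x. f (l x + c)) has_derivative (\<lambda>v. f' (l x + c) (l v))) (at x)" for x .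
  then show ?case using Suc.IH[OF c] by (auto intro!: exI[of _ "\<lambda>x v. f' (l x + c) (l v)"])
qed

lemma smooth_const: "smooth (\<lambda>x. c)"
  and smooth_add: "smooth f \<Longrightarrow> smooth g \<Longrightarrow> smooth (\<lambda>x. f x + g x)"
  and smooth_mult: "smooth f \<Longrightarrow> smooth g \<Longrightarrow> smooth (\<lambda>x. f x * g x)"
  by (auto simp: smooth_def Ck_const Ck_add Ck_mult)

lemma smooth_compose_affine: "bounded_linear l \<Longrightarrow> smooth f \<Longrightarrow> smooth (\<lambda>x. f (l x + c))"
  by (auto simp: smooth_def Ck_compose_affine)

lemma smooth_tensor:
  assumes "smooth \<theta>" "smooth \<psi>"
  shows "smooth (\<lambda>p :: real \<times> real. \<theta> (fst p) * \<psi> (snd p))"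
  using smooth_mult[OF smooth_compose_affine[OF bounded_linear_fst assms(1), of 0]
    smooth_compose_affine[OF bounded_linear_snd assms(2), of 0]] by simp

lemma smooth_affine_real: "smooth f \<Longrightarrow> smooth (\<lambda>x::real. f (a * x + c))"
  by (rule smooth_compose_affine[OF bounded_linear_mult_right])

lemma smooth_diff: "smooth f \<Longrightarrow> smooth g \<Longrightarrow> smooth (\<lambda>x. f x - g x)"
  using smooth_add[of f "\<lambda>x. -1 * g x"] smooth_mult[OF smooth_const[of "-1"], of g] by simp

lemma Ck_of_derivative:
  assumes "\<And>x. (f has_real_derivative f' x) (at x)" "Ck k f'"
  shows "Ck (Suc k) f"
  using assms Ck_mult[OF Ck_const assms(2)]
  by (auto simp: has_field_derivative_def mult.commute intro!: exI[of _ "\<lambda>x v. f' x * v"])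

lemma smooth_of_derivative:
  assumes "\<And>x. (f has_real_derivative f' x) (at x)" "smooth f'"
  shows "smooth f"
  unfolding smooth_def using Ck_of_derivative[OF assms(1)] assms(2) Ck_Suc_imp
  by (metis smooth_def)

lemma smooth_exp: "smooth (exp :: real \<Rightarrow> real)"
proof -
  have "Ck k (exp :: real \<Rightarrow> real)" for k
  proof (induction k)
    case 0 then show ?case by (simp add: continuous_intros)
  next
    case (Suc k) then show ?case by (intro Ck_of_derivative[of exp exp]) (auto intro: DERIV_exp)
  qed
  then show ?thesis by (simp add: smooth_def)
qed

lemma smooth_imp_continuous: "smooth f \<Longrightarrow> continuous_on UNIV f"
  unfolding smooth_def by (metis Ck.simps(1))

text \<open>\<open>e\<^bsup>-1/x\<^esup> / x\<^sup>n\<close>, extended by \<open>0\<close>: the powers of \<open>x\<close> in the denominator make the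
  family closed under differentiation, so that smoothness is an induction on the order.\<close>

definition flat_exp :: "nat \<Rightarrow> real \<Rightarrow> real" where
  "flat_exp n x = (if x > 0 then exp (- 1 / x) / x ^ n else 0)"

lemma flat_exp_DERIV:
  "(flat_exp n has_real_derivative flat_exp (n + 2) x - of_nat n * flat_exp (Suc n) x) (at x)"
proof (cases x "0::real" rule: linorder_cases)
  case less
  have "((\<lambda>x. 0) has_real_derivative 0) (at x)" by simp
  moreover have "eventually (\<lambda>y. y < 0) (nhds x)" using less eventually_nhds_in_open[of "{..<0}" x] by simp
  then have "eventually (\<lambda>y. flat_exp n y = 0) (nhds x)" by eventually_elim (auto simp: flat_exp_def)
  ultimately have "(flat_exp n has_real_derivative 0) (at x)"
    by (subst DERIV_cong_ev[OF refl _ refl])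
  then show ?thesis using less by (simp add: flat_exp_def)
next
  case greater
  have "((\<lambda>x. exp (- 1 / x) / x ^ n) has_real_derivative flat_exp (n + 2) x - of_nat n * flat_exp (Suc n) x) (at x)"
    using greater
    by (auto intro!: derivative_eq_intros simp: flat_exp_def field_simps power2_eq_square power_eq_if[of x n])
  moreover have "eventually (\<lambda>y. y > 0) (nhds x)" using greater eventually_nhds_in_open[of "{0<..}" x] by simp
  then have "eventually (\<lambda>y. flat_exp n y = exp (- 1 / y) / y ^ n) (nhds x)" by eventually_elim (auto simp: flat_exp_def)
  ultimately show ?thesis by (subst DERIV_cong_ev[OF refl _ refl])
next
  case equal
  have "((\<lambda>h. flat_exp n h / h) \<longlongrightarrow> 0) (at_right 0)"
  proof -
    have "((\<lambda>h::real. exp (- 1 / h) / h ^ n / h) \<longlongrightarrow> 0) (at_right 0)" by real_asymp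
    then show ?thesis by (rule tendsto_cong[THEN iffD1, rotated]) (auto simp: flat_exp_def eventually_at_filter)
  qed
  moreover have "((\<lambda>h. flat_exp n h / h) \<longlongrightarrow> 0) (at_left 0)"
    by (rule tendsto_eventually) (auto simp: flat_exp_def eventually_at_filter)
  ultimately have "((\<lambda>h. flat_exp n h / h) \<longlongrightarrow> 0) (at 0)" by (simp add: filterlim_split_at)
  then show ?thesis using equal by (simp add: DERIV_def flat_exp_def)
qed

lemma smooth_flat_exp: "smooth (flat_exp n)"
proof -
  have "Ck k (flat_exp n)" for k n
  proof (induction k arbitrary: n)
    case 0
    show ?case using DERIV_isCont[OF flat_exp_DERIV] by (simp add: continuous_on_eq_continuous_at)
  next
    case (Suc k)
    have "Ck k (\<lambda>x. flat_exp (n + 2) x + (- of_nat n) * flat_exp (Suc n) x)"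
      by (intro Ck_add Ck_mult Ck_const Suc)
    then show ?case by (intro Ck_of_derivative[OF flat_exp_DERIV]) simp
  qed
  then show ?thesis by (simp add: smooth_def)
qed

lemma continuous_antiderivative:
  fixes f :: "real \<Rightarrow> real"
  assumes "continuous_on UNIV f"
  obtains F where "\<And>x. (F has_real_derivative f x) (at x)"
proof -
  have "\<exists>F. \<forall>x. - \<infinity> < ereal x \<longrightarrow> ereal x < \<infinity> \<longrightarrow> (F has_vector_derivative f x) (at x)"
    using assms by (intro einterval_antiderivative) (auto simp: continuous_on_eq_continuous_at)
  then show ?thesis using that by (auto simp: has_real_derivative_iff_has_vector_derivative)
qed

text \<open>The step is a normalised antiderivative of the product of two flat exponentials, which is a
  bump supported in \<open>[0, 1]\<close>.\<close>

lemma smooth_step_exists: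
  obtains S b where "smooth S" "smooth b"
    "\<And>x. (S has_real_derivative b x) (at x)" "\<And>x. b x \<ge> 0"
    "\<And>x. x \<le> 0 \<Longrightarrow> b x = 0" "\<And>x. x \<ge> 1 \<Longrightarrow> b x = 0"
    "\<And>x. x \<le> 0 \<Longrightarrow> S x = 0" "\<And>x. x \<ge> 1 \<Longrightarrow> S x = 1"
proof -
  define e where "e = (\<lambda>x. flat_exp 0 x * flat_exp 0 (-1 * x + 1))"
  have se: "smooth e" unfolding e_def by (intro smooth_mult smooth_flat_exp smooth_affine_real)
  have epos: "e x \<ge> 0" for x by (auto simp: e_def flat_exp_def)
  obtain F where F: "\<And>x. (F has_real_derivative e x) (at x)"
    using continuous_antiderivative[OF smooth_imp_continuous[OF se]] by blast
  have ze: "e x = 0" if "x \<le> 0 \<or> x \<ge> 1" for x using that by (auto simp: e_def flat_exp_def)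
  have F0: "F x = F 0" if "x \<le> 0" for x
  proof (rule ccontr)
    assume "F x \<noteq> F 0"
    then have "x < 0" using that by (cases "x = 0") auto
    from MVT2[OF this, of F e] F obtain z where "z < 0" "F 0 - F x = (0 - x) * e z" by auto
    then show False using ze[of z] \<open>F x \<noteq> F 0\<close> by simp
  qed
  have F1: "F x = F 1" if "x \<ge> 1" for x
  proof (rule ccontr)
    assume "F x \<noteq> F 1"
    then have "1 < x" using that by (cases "x = 1") auto
    from MVT2[OF this, of F e] F obtain z where "z > 1" "F x - F 1 = (x - 1) * e z" by auto
    then show False using ze[of z] \<open>F x \<noteq> F 1\<close> by simp
  qed
  from MVT2[of 0 1 F e] F obtain z where "0 < z" "z < 1" "F 1 - F 0 = e z" by auto
  then have pos: "F 1 - F 0 > 0" by (simp add: e_def flat_exp_def)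
  have sF: "smooth F" by (rule smooth_of_derivative[OF F se])
  show ?thesis
  proof (rule that[of "\<lambda>x. (F x - F 0) * (1 / (F 1 - F 0))" "\<lambda>x. e x * (1 / (F 1 - F 0))"])
    show "smooth (\<lambda>x. (F x - F 0) * (1 / (F 1 - F 0)))" "smooth (\<lambda>x. e x * (1 / (F 1 - F 0)))"
      by (intro smooth_mult smooth_diff sF smooth_const se)+
    show "((\<lambda>x. (F x - F 0) * (1 / (F 1 - F 0))) has_real_derivative e x * (1 / (F 1 - F 0))) (at x)" for x
      using pos by (auto intro!: derivative_eq_intros F)
    show "(F x - F 0) * (1 / (F 1 - F 0)) = 1" if "1 \<le> x" for x
      using F1[OF that] pos by simp
    show "(F x - F 0) * (1 / (F 1 - F 0)) = 0" if "x \<le> 0" for x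
      using F0[OF that] by simp
  qed (use epos ze pos in auto)
qed

section \<open>Continuous functions as bounded Lebesgue functions\<close>

lemma continuous_on_Icc_bounded:
  fixes f :: "real \<Rightarrow> real"
  assumes "continuous_on {a..b} f"
  obtains B where "B \<ge> 0" "\<And>x. x \<in> {a..b} \<Longrightarrow> \<bar>f x\<bar> \<le> B"
proof -
  have "bounded (f ` {a..b})"
    by (intro compact_imp_bounded compact_continuous_image assms compact_Icc)
  then obtain B where "\<And>x. x \<in> {a..b} \<Longrightarrow> \<bar>f x\<bar> \<le> B"
    unfolding bounded_iff by (metis imageI real_norm_def)
  then show ?thesis by (intro that[of "max B 0"]) (auto intro: le_max_iff_disj[THEN iffD2])
qed

lemma integrable_indicator_Icc: "integrable lebesgue (indicat_real {a..b :: real})"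
  using absolutely_integrable_continuous_real[of a b "\<lambda>_. 1 :: real"] by (simp add: set_integrable_def)

lemma continuous_measurable_lebesgue:
  fixes f :: "real \<Rightarrow> real"
  shows "continuous_on UNIV f \<Longrightarrow> f \<in> borel_measurable lebesgue"
  by (intro measurable_completion) (auto intro: borel_measurable_continuous_onI)

section \<open>A smooth step and averages against its derivative\<close>

text \<open>Some smooth step that rises from \<open>0\<close> to \<open>1\<close> on \<open>[0, 1]\<close>, paired with its derivative. Only the
  properties collected in \<open>step_bump\<close> matter, so the pair is fixed by choice.\<close>

definition smooth_step_pair :: "(real \<Rightarrow> real) \<times> (real \<Rightarrow> real)" where
  "smooth_step_pair = (SOME (S, b). smooth S \<and> smooth b \<and>
    (\<forall>x. (S has_real_derivative b x) (at x)) \<and> (\<forall>x. b x \<ge> 0) \<and>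
    (\<forall>x. x \<le> 0 \<or> x \<ge> 1 \<longrightarrow> b x = 0) \<and>
    (\<forall>x\<le>0. S x = 0) \<and> (\<forall>x\<ge>1. S x = 1))"

definition step :: "real \<Rightarrow> real" where "step = fst smooth_step_pair"
definition bump :: "real \<Rightarrow> real" where "bump = snd smooth_step_pair"

lemma step_bump:
  "smooth step" "smooth bump" "(step has_real_derivative bump x) (at x)" "bump x \<ge> 0"
  "x \<le> 0 \<or> x \<ge> 1 \<Longrightarrow> bump x = 0" "x \<le> 0 \<Longrightarrow> step x = 0" "x \<ge> 1 \<Longrightarrow> step x = 1"
proof -
  let ?P = "\<lambda>(S, b). smooth S \<and> smooth b \<and>
    (\<forall>x. (S has_real_derivative b x) (at x)) \<and> (\<forall>x. b x \<ge> 0) \<and>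
    (\<forall>x::real. x \<le> 0 \<or> x \<ge> 1 \<longrightarrow> b x = 0) \<and>
    (\<forall>x\<le>0. S x = (0::real)) \<and> (\<forall>x\<ge>1. S x = 1)"
  have "\<exists>p. ?P p"
  proof -
    obtain S b where "smooth S" "smooth b"
    "\<And>x. (S has_real_derivative b x) (at x)" "\<And>x. b x \<ge> 0"
    "\<And>x. x \<le> 0 \<Longrightarrow> b x = 0" "\<And>x. x \<ge> 1 \<Longrightarrow> b x = 0"
    "\<And>x. x \<le> 0 \<Longrightarrow> S x = 0" "\<And>x. x \<ge> 1 \<Longrightarrow> S x = 1" using smooth_step_exists by metis
    then show ?thesis by (intro exI[of _ "(S, b)"]) auto
  qed
  then have "?P smooth_step_pair" unfolding smooth_step_pair_def by (rule someI_ex)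
  then show "smooth step" "smooth bump" "(step has_real_derivative bump x) (at x)" "bump x \<ge> 0"
  "x \<le> 0 \<or> x \<ge> 1 \<Longrightarrow> bump x = 0" "x \<le> 0 \<Longrightarrow> step x = 0" "x \<ge> 1 \<Longrightarrow> step x = 1"
    unfolding step_def bump_def by (auto simp: case_prod_beta)
qed

lemma continuous_bump: "continuous_on A bump" and continuous_step: "continuous_on A step"
  by (rule continuous_on_subset[OF smooth_imp_continuous], rule step_bump, simp)+

lemma step_mono: "x \<le> y \<Longrightarrow> step x \<le> step y"
  by (rule DERIV_nonneg_imp_nondecreasing) (auto intro: exI[of _ "bump _"] step_bump(3,4))

lemma step_bounds: "0 \<le> step x" "step x \<le> 1"
proof -
  have "step (min x 0) = 0" "step (max x 1) = 1" by (simp_all add: step_bump)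
  then show "0 \<le> step x" "step x \<le> 1"
    using step_mono[of "min x 0" x] step_mono[of x "max x 1"] by simp_all
qed

lemma bump_bounded: obtains B where "B > 0" "\<And>x. bump x \<le> B"
proof -
  obtain B where B: "\<And>x. x \<in> {0..1} \<Longrightarrow> \<bar>bump x\<bar> \<le> B"
    using continuous_on_Icc_bounded[OF continuous_bump] by blast
  have "bump x \<le> max B 1" for x using B[of x] step_bump(5)[of x] by (cases "x \<in> {0..1}") auto
  then show ?thesis by (intro that[of "max B 1"]) auto
qed

lemma lebesgue_integral_compact_support:
  fixes g :: "real \<Rightarrow> real"
  assumes "continuous_on UNIV g" "\<And>x. x \<notin> {a..b} \<Longrightarrow> g x = 0"
  shows "integrable lebesgue g" "(LINT x|lebesgue. g x) = integral {a..b} g"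
proof -
  have s: "set_integrable lebesgue {a..b} g"
    using assms(1) continuous_on_subset by (intro absolutely_integrable_continuous_real) blast
  have e: "indicat_real {a..b} x *\<^sub>R g x = g x" for x using assms(2) by (auto simp: indicator_def)
  show "integrable lebesgue g" using s unfolding set_integrable_def e .
  show "(LINT x|lebesgue. g x) = integral {a..b} g"
    using set_lebesgue_integral_eq_integral(2)[OF s] unfolding set_lebesgue_integral_def e .
qed

lemma lebesgue_integral_derivative_compact_support:
  fixes g :: "real \<Rightarrow> real"
  assumes d: "\<And>x. (g has_real_derivative g' x) (at x)" and c: "continuous_on UNIV g'"
    and "\<And>x. x \<notin> {a..b} \<Longrightarrow> g' x = 0"
  shows "a \<le> b \<Longrightarrow> (LINT x|lebesgue. g' x) = g b - g a"
proof -
  assume "a \<le> b"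
  have "(g' has_integral g b - g a) {a..b}"
    by (rule fundamental_theorem_of_calculus[OF \<open>a \<le> b\<close>])
       (use d in \<open>auto simp: has_real_derivative_iff_has_vector_derivative[symmetric] intro: has_field_derivative_at_within\<close>)
  then show ?thesis using lebesgue_integral_compact_support[OF c assms(3)] by (simp add: integral_unique)
qed

text \<open>The approximate identity concentrated to the right of \<open>u\<close> at scale \<open>1 / n\<close>.\<close>

definition sbump :: "real \<Rightarrow> real \<Rightarrow> real \<Rightarrow> real" where
  "sbump n u x = n * bump (n * (x - u))"

lemma continuous_sbump: "continuous_on A (sbump n u)"
proof -
  have "continuous_on UNIV (sbump n u)"
    unfolding sbump_def
    by (intro continuous_intros continuous_on_compose2[OF continuous_bump[of UNIV]]) auto
  then show ?thesis by (rule continuous_on_subset) simp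
qed

lemma sbump_nonneg: "n > 0 \<Longrightarrow> sbump n u x \<ge> 0"
  by (simp add: sbump_def step_bump)

lemma sbump_eq_0: "n > 0 \<Longrightarrow> x \<notin> {u..u + 1 / n} \<Longrightarrow> sbump n u x = 0"
  by (auto simp: sbump_def field_simps not_le intro!: step_bump(5))

lemma step_affine_DERIV:
  "((\<lambda>x. step (n * (x - u))) has_real_derivative sbump n u x) (at x)"
proof -
  have "((\<lambda>x. n * (x - u)) has_real_derivative n) (at x)" by (auto intro!: derivative_eq_intros)
  from DERIV_chain2[OF step_bump(3) this] show ?thesis by (simp add: sbump_def mult.commute)
qed

lemma sbump_average:
  assumes "n > 0" and m: "f \<in> borel_measurable lebesgue"
    and f: "\<And>x. x \<in> {u..u + 1 / n} \<Longrightarrow> \<bar>f x - c\<bar> \<le> e"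
  shows "integrable lebesgue (\<lambda>x. f x * sbump n u x)"
    "\<bar>(LINT x|lebesgue. f x * sbump n u x) - c\<bar> \<le> e"
proof -
  have i: "integrable lebesgue (sbump n u)"
    and one: "(LINT x|lebesgue. sbump n u x) = 1"
  proof -
    show "integrable lebesgue (sbump n u)"
      by (rule lebesgue_integral_compact_support[OF continuous_sbump sbump_eq_0[OF \<open>n > 0\<close>]])
    show "(LINT x|lebesgue. sbump n u x) = 1"
      using lebesgue_integral_derivative_compact_support[OF step_affine_DERIV continuous_sbump sbump_eq_0[OF \<open>n > 0\<close>]] \<open>n > 0\<close>
      by (simp add: step_bump)
  qed
  have le: "\<bar>f x - c\<bar> * sbump n u x \<le> e * sbump n u x" for x
    using f[of x] sbump_eq_0[OF \<open>n > 0\<close>, of x u] sbump_nonneg[OF \<open>n > 0\<close>, of u x]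
    by (cases "x \<in> {u..u+1/n}") (auto intro: mult_right_mono)
  have i2: "integrable lebesgue (\<lambda>x. (f x - c) * sbump n u x)"
  proof (rule Bochner_Integration.integrable_bound[OF integrable_mult_right[OF i, of e]])
    show "(\<lambda>x. (f x - c) * sbump n u x) \<in> borel_measurable lebesgue"
      using m borel_measurable_integrable[OF i] by simp
    have "norm ((f x - c) * sbump n u x) \<le> norm (e * sbump n u x)" for x
      using order_trans[OF le[of x] abs_ge_self] sbump_nonneg[OF \<open>n > 0\<close>, of u x]
      by (metis abs_mult abs_of_nonneg real_norm_def)
    then show "AE x in lebesgue. norm ((f x - c) * sbump n u x) \<le> norm (e * sbump n u x)" by simp
  qed
  have eq: "(\<lambda>x. f x * sbump n u x) = (\<lambda>x. (f x - c) * sbump n u x + c * sbump n u x)"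
    by (auto simp: algebra_simps)
  show "integrable lebesgue (\<lambda>x. f x * sbump n u x)"
    unfolding eq by (intro Bochner_Integration.integrable_add i2 integrable_mult_right i)
  have "(LINT x|lebesgue. f x * sbump n u x) = (LINT x|lebesgue. (f x - c) * sbump n u x) + c"
    unfolding eq using i i2 one by (subst Bochner_Integration.integral_add) auto
  moreover have "\<bar>LINT x|lebesgue. (f x - c) * sbump n u x\<bar> \<le> (LINT x|lebesgue. e * sbump n u x)"
    by (rule integral_abs_bound_integral[OF i2 integrable_mult_right[OF i]])
       (use le sbump_nonneg[OF \<open>n > 0\<close>] in \<open>simp add: abs_mult\<close>)
  ultimately show "\<bar>(LINT x|lebesgue. f x * sbump n u x) - c\<bar> \<le> e" using one i by simp
qed

definition plateau :: "real \<Rightarrow> real \<Rightarrow> real \<Rightarrow> real \<Rightarrow> real" where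
  "plateau n u v x = step (n * (x - u)) - step (n * (x - v))"

lemma plateau_DERIV: "(plateau n u v has_real_derivative sbump n u x - sbump n v x) (at x)"
  unfolding plateau_def by (intro derivative_intros step_affine_DERIV)

lemma smooth_step_affine: "smooth (\<lambda>x. step (n * (x - u)))"
  using smooth_affine_real[OF step_bump(1), of n "- n * u"] by (simp add: algebra_simps)

lemma smooth_plateau: "smooth (plateau n u v)"
  unfolding plateau_def by (intro smooth_diff smooth_step_affine)

lemma plateau_bounds: "n > 0 \<Longrightarrow> u \<le> v \<Longrightarrow> 0 \<le> plateau n u v x" "plateau n u v x \<le> 1"
  using step_bounds[of "n * (x - u)"] step_bounds[of "n * (x - v)"]
  by (auto simp: plateau_def intro!: step_mono)

lemma plateau_eq_0: "n > 0 \<Longrightarrow> u \<le> v \<Longrightarrow> x \<notin> {u..v + 1 / n} \<Longrightarrow> plateau n u v x = 0"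
proof -
  assume a: "n > 0" "u \<le> v" "x \<notin> {u..v + 1 / n}"
  show ?thesis
  proof (cases "x < u")
    case True
    then have "n * (x - u) \<le> 0" "n * (x - v) \<le> 0" using a by (auto simp: mult_le_0_iff)
    then show ?thesis by (simp add: plateau_def step_bump)
  next
    case False
    then have "n * (x - v) \<ge> 1" using a by (auto simp: field_simps)
    moreover have "n * (x - u) \<ge> n * (x - v)" using a by auto
    ultimately show ?thesis by (simp add: plateau_def step_bump)
  qed
qed

lemma support_subset: "closed A \<Longrightarrow> (\<And>x. x \<notin> A \<Longrightarrow> f x = 0) \<Longrightarrow> support f \<subseteq> A"
  unfolding support_def by (rule closure_minimal) auto

lemma not_in_support: "x \<notin> support f \<Longrightarrow> f x = 0"
  using closure_subset[of "{x. f x \<noteq> 0}"] by (auto simp: support_def)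

lemma Cc_infinityI:
  assumes "smooth f" "compact A" "A \<subseteq> U" "\<And>x. x \<notin> A \<Longrightarrow> f x = 0"
  shows "f \<in> Cc_infinity U"
proof -
  have s: "support f \<subseteq> A" by (rule support_subset[OF compact_imp_closed[OF assms(2)] assms(4)])
  have "compact (A \<inter> support f)"
    by (rule compact_Int_closed[OF assms(2)]) (simp add: support_def)
  then show ?thesis using s assms by (auto simp: Cc_infinity_def Int_absorb1)
qed

lemma plateau_Cc_infinity:
  "n > 0 \<Longrightarrow> u \<le> v \<Longrightarrow> {u..v + 1 / n} \<subseteq> U \<Longrightarrow> plateau n u v \<in> Cc_infinity U"
  using plateau_eq_0 by (intro Cc_infinityI[of _ "{u..v + 1 / n}"] smooth_plateau) auto

section \<open>Weak derivatives of continuous functions\<close>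

lemma smooth_real_DERIV:
  assumes "smooth (f :: real \<Rightarrow> real)"
  shows "(f has_real_derivative deriv f x) (at x)" "continuous_on A (deriv f)"
proof -
  from assms obtain f' where d: "\<And>x. (f has_derivative f' x) (at x)" and c: "continuous_on UNIV (\<lambda>x. f' x 1)"
    unfolding smooth_def by (metis Ck.simps)
  have lin: "f' x h = f' x 1 * h" for x h
    using linear_cmul[OF has_derivative_linear[OF d], of x h 1] by (simp add: mult.commute)
  have D: "(f has_real_derivative f' x 1) (at x)" for x
    unfolding has_field_derivative_def using d[of x] lin[of x] by (metis (no_types, lifting) ext has_derivative_eq_rhs)
  then have "deriv f = (\<lambda>x. f' x 1)" using DERIV_imp_deriv by blast
  then show "(f has_real_derivative deriv f x) (at x)" "continuous_on A (deriv f)"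
    using D continuous_on_subset[OF c, of A] by auto
qed

lemma Cc_infinity_real_bounds:
  assumes "\<phi> \<in> Cc_infinity (U :: real set)"
  obtains a b where "a \<le> b" "\<And>x. x \<notin> {a..b} \<Longrightarrow> \<phi> x = 0" "\<And>x. x \<notin> {a..b} \<Longrightarrow> deriv \<phi> x = 0"
proof -
  have sm: "smooth \<phi>" and "bounded (support \<phi>)" using assms by (auto simp: Cc_infinity_def compact_imp_bounded)
  then obtain a where a: "\<And>x. x \<in> support \<phi> \<Longrightarrow> \<bar>x\<bar> \<le> a" by (auto simp: bounded_iff)
  let ?a = "max a 0"
  have z: "\<phi> x = 0" if "x \<notin> {- ?a..?a}" for x
    using a[of x] not_in_support[of x \<phi>] that by fastforce
  have "deriv \<phi> x = 0" if "x \<notin> {- ?a..?a}" for x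
  proof -
    have "eventually (\<lambda>y. y \<in> - {- ?a..?a}) (nhds x)"
      using that by (intro eventually_nhds_in_open) auto
    then have "eventually (\<lambda>y. \<phi> y = 0) (nhds x)" by eventually_elim (use z in auto)
    then have "(\<phi> has_real_derivative 0) (at x)" using DERIV_cong_ev[of x x \<phi> "\<lambda>_. 0" 0 0] by simp
    then show ?thesis by (rule DERIV_imp_deriv)
  qed
  with z show ?thesis by (intro that[of "- ?a" ?a]) auto
qed

lemma integral_mult_deriv_test:
  assumes "\<phi> \<in> Cc_infinity (U :: real set)"
    and "\<And>x. (F has_real_derivative F' x) (at x)" "continuous_on UNIV F'"
  shows "integrable lebesgue (\<lambda>x. F x * deriv \<phi> x)" "integrable lebesgue (\<lambda>x. F' x * \<phi> x)"
    "(LINT x|lebesgue. F x * deriv \<phi> x) = - (LINT x|lebesgue. F' x * \<phi> x)"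
proof -
  have sm: "smooth \<phi>" using assms(1) by (auto simp: Cc_infinity_def)
  obtain a b where ab: "a \<le> b" "\<And>x. x \<notin> {a..b} \<Longrightarrow> \<phi> x = 0" "\<And>x. x \<notin> {a..b} \<Longrightarrow> deriv \<phi> x = 0"
    using Cc_infinity_real_bounds[OF assms(1)] by blast
  have cF: "continuous_on UNIV F" using assms(2) DERIV_isCont by (auto simp: continuous_on_eq_continuous_at)
  have c: "continuous_on UNIV (\<lambda>x. F x * deriv \<phi> x)" "continuous_on UNIV (\<lambda>x. F' x * \<phi> x)"
    by (intro continuous_intros cF smooth_real_DERIV[OF sm] smooth_imp_continuous[OF sm] assms(3))+
  show i: "integrable lebesgue (\<lambda>x. F x * deriv \<phi> x)" "integrable lebesgue (\<lambda>x. F' x * \<phi> x)"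
    using ab by (auto intro!: lebesgue_integral_compact_support(1)[of _ a b] c)
  have "(LINT x|lebesgue. F x * deriv \<phi> x + F' x * \<phi> x) = F (b+1) * \<phi> (b+1) - F (a-1) * \<phi> (a-1)"
    using ab by (intro lebesgue_integral_derivative_compact_support[where g = "\<lambda>x. F x * \<phi> x"] continuous_on_add c)
      (auto intro!: derivative_eq_intros assms(2) smooth_real_DERIV[OF sm])
  also have "\<dots> = 0" using ab by auto
  finally show "(LINT x|lebesgue. F x * deriv \<phi> x) = - (LINT x|lebesgue. F' x * \<phi> x)"
    using i by simp
qed

text \<open>The plateau between \<open>u\<close> and \<open>v\<close> is a nonnegative test function whose derivative is a
  bump at \<open>u\<close> minus a bump at \<open>v\<close>; as the bumps shrink, testing with it compares \<open>f u\<close>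
  with \<open>f v\<close>.\<close>

lemma mono_of_weak_derivative_nonneg:
  fixes f :: "real \<Rightarrow> real"
  assumes c: "continuous_on UNIV f"
    and w: "\<And>\<phi>. \<phi> \<in> Cc_infinity UNIV \<Longrightarrow> (\<And>x. \<phi> x \<ge> 0) \<Longrightarrow> (\<And>x. x \<notin> {lo..hi} \<Longrightarrow> \<phi> x = 0) \<Longrightarrow>
       (LINT x|lebesgue. f x * deriv \<phi> x) \<le> 0"
    and "lo \<le> u" "u \<le> v" "v \<le> hi"
  shows "f u \<le> f v"
proof (cases "u = v")
  case False
  then have uv: "u < v" using assms by simp
  have m: "f \<in> borel_measurable lebesgue"
    by (rule continuous_measurable_lebesgue[OF c])
  show ?thesis
  proof (rule field_le_epsilon)
    fix e :: real assume "e > 0"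
    have "isCont f u" "isCont f v" using c by (auto simp: continuous_on_eq_continuous_at)
    then obtain d1 d2 where d: "d1 > 0" "d2 > 0" "\<And>x. \<bar>x - u\<bar> < d1 \<Longrightarrow> \<bar>f x - f u\<bar> < e / 2"
      "\<And>x. \<bar>x - v\<bar> < d2 \<Longrightarrow> \<bar>f x - f v\<bar> < e / 2"
      unfolding continuous_at_eps_delta dist_real_def using half_gt_zero[OF \<open>e > 0\<close>] by metis
    define r where "r = min (v - u) (min d1 d2) / 2"
    define n where "n = 1 / r"
    have r: "r > 0" "r < d1" "r < d2" "r < v - u" and n: "n > 0" "1 / n = r"
      using d uv by (auto simp: r_def n_def min_def)
    have A: "\<bar>f x - f u\<bar> \<le> e / 2" if "x \<in> {u..u + 1 / n}" for x
      using d(3)[of x] that n r by auto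
    have B: "\<bar>f x - f v\<bar> \<le> e / 2" if "x \<in> {v - r..v - r + 1 / n}" for x
      using d(4)[of x] that n r by auto
    note A = sbump_average[of n f u "f u" "e / 2", OF n(1) m A]
      and B = sbump_average[of n f "v - r" "f v" "e / 2", OF n(1) m B]
    have "(LINT x|lebesgue. f x * deriv (plateau n u (v - r)) x) \<le> 0"
      using n r assms by (intro w plateau_Cc_infinity plateau_bounds plateau_eq_0) auto
    then have "(LINT x|lebesgue. f x * sbump n u x) - (LINT x|lebesgue. f x * sbump n (v - r) x) \<le> 0"
      using A(1) B(1) by (simp add: DERIV_imp_deriv[OF plateau_DERIV] right_diff_distrib)
    then show "f u \<le> f v + e" using A(2) B(2) by linarith
  qed
qed simp

text \<open>A continuous weak derivative is a classical one: \<open>V\<close> minus an antiderivative of \<open>V'\<close>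
  has weak derivative zero, so that both this difference and its negative are nondecreasing.\<close>

lemma W2inf_loc_DERIV:
  assumes "W2inf_loc V V' V''"
  shows "(V has_real_derivative V' x) (at x)"
proof -
  have w: "weak_deriv V V'" and c: "continuous_on UNIV V" "continuous_on UNIV V'"
    using assms by (auto simp: W2inf_loc_def)
  obtain F where F: "\<And>x. (F has_real_derivative V' x) (at x)"
    using continuous_antiderivative[OF c(2)] by blast
  have cF: "continuous_on UNIV F" using F DERIV_isCont by (auto simp: continuous_on_eq_continuous_at)
  have eq: "(LINT x|lebesgue. (V x - F x) * deriv \<phi> x) = 0"
    "(LINT x|lebesgue. (F x - V x) * deriv \<phi> x) = 0" if phi: "\<phi> \<in> Cc_infinity UNIV" for \<phi>
  proof -
    have sm: "smooth \<phi>" using phi by (auto simp: Cc_infinity_def)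
    obtain a b where ab: "a \<le> b" "\<And>x. x \<notin> {a..b} \<Longrightarrow> \<phi> x = 0" "\<And>x. x \<notin> {a..b} \<Longrightarrow> deriv \<phi> x = 0"
      using Cc_infinity_real_bounds[OF phi] by blast
    have "integrable lebesgue (\<lambda>x. V x * deriv \<phi> x)"
      using ab by (intro lebesgue_integral_compact_support(1)[of _ a b] continuous_intros c smooth_real_DERIV[OF sm]) auto
    moreover note integral_mult_deriv_test[OF phi F c(2)]
    moreover have "(LINT x|lebesgue. V x * deriv \<phi> x) = - (LINT x|lebesgue. V' x * \<phi> x)"
      using w phi by (auto simp: weak_deriv_def)
    ultimately show "(LINT x|lebesgue. (V x - F x) * deriv \<phi> x) = 0"
      "(LINT x|lebesgue. (F x - V x) * deriv \<phi> x) = 0" by (simp_all add: left_diff_distrib)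
  qed
  have const: "V y - F y = V 0 - F 0" for y
  proof -
    let ?l = "min y 0" and ?h = "max y 0"
    have "V ?l - F ?l \<le> V ?h - F ?h" "F ?l - V ?l \<le> F ?h - V ?h"
      by (rule mono_of_weak_derivative_nonneg[of _ ?l ?h]; use eq in \<open>auto intro!: continuous_intros c cF\<close>)+
    then show ?thesis by (auto simp: min_def max_def split: if_splits)
  qed
  have "V = (\<lambda>y. F y + (V 0 - F 0))" using const by (auto simp: fun_eq_iff algebra_simps)
  moreover have "((\<lambda>y. F y + (V 0 - F 0)) has_real_derivative V' x) (at x)"
    by (auto intro!: derivative_eq_intros F)
  ultimately show ?thesis by simp
qed

lemma Linf_loc_mult_integrable:
  assumes "f \<in> Linf_loc" "continuous_on UNIV g" "\<And>x. x \<notin> {a..b} \<Longrightarrow> g x = 0"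
  shows "integrable lebesgue (\<lambda>x. f x * g x)"
proof -
  obtain C where C: "AE x in lebesgue. x \<in> {a..b} \<longrightarrow> \<bar>f x\<bar> \<le> C"
    using assms(1) compact_Icc[of a b] unfolding Linf_loc_def mem_Collect_eq by metis
  have "integrable lebesgue (\<lambda>x. C * g x)"
    by (intro integrable_mult_right lebesgue_integral_compact_support(1)[OF assms(2,3)])
  then show ?thesis
  proof (rule Bochner_Integration.integrable_bound)
    show "(\<lambda>x. f x * g x) \<in> borel_measurable lebesgue"
      using assms(1) borel_measurable_integrable[OF lebesgue_integral_compact_support(1)[OF assms(2,3)]]
      by (auto simp: Linf_loc_def)
    show "AE x in lebesgue. norm (f x * g x) \<le> norm (C * g x)"
      using C
    proof eventually_elim
      case (elim x)
      then show ?case using assms(3)[of x] by (cases "x \<in> {a..b}") (auto simp: abs_mult intro!: mult_right_mono)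
    qed
  qed
qed

text \<open>Testing \<open>V'\<close> against \<open>\<xi> \<phi>(\<xi>)\<close> shows that the weak derivative of \<open>\<xi> V'(\<xi>)\<close>
  is \<open>V' + V'' \<xi>\<close>, the quantity that condition (B) controls.\<close>

lemma velocity_moment_slope_le:
  assumes W: "W2inf_loc V V' V''"
    and b: "AE \<xi> in lebesgue. \<xi> \<in> {lo..hi} \<longrightarrow> V' \<xi> + V'' \<xi> * \<xi> \<le> \<kappa>"
    and uv: "lo \<le> u" "u \<le> v" "v \<le> hi"
  shows "V' v * v - V' u * u \<le> \<kappa> * (v - u)"
proof -
  have w: "weak_deriv V' V''" and c: "continuous_on UNIV V'" and L: "V'' \<in> Linf_loc"
    using W by (auto simp: W2inf_loc_def)
  have key: "(LINT x|lebesgue. (\<kappa> * x - V' x * x) * deriv \<phi> x) \<le> 0"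
    if phi: "\<phi> \<in> Cc_infinity UNIV" and pos: "\<And>x. \<phi> x \<ge> 0" and z: "\<And>x. x \<notin> {lo..hi} \<Longrightarrow> \<phi> x = 0" for \<phi>
  proof -
    have sm: "smooth \<phi>" using phi by (auto simp: Cc_infinity_def)
    obtain l h where lh: "l \<le> h" "\<And>x. x \<notin> {l..h} \<Longrightarrow> \<phi> x = 0" "\<And>x. x \<notin> {l..h} \<Longrightarrow> deriv \<phi> x = 0"
      using Cc_infinity_real_bounds[OF phi] by blast
    have "smooth (\<lambda>x::real. x)" by (rule smooth_of_derivative[of _ "\<lambda>_. 1"]) (auto intro: smooth_const)
    then have "(\<lambda>x. x * \<phi> x) \<in> Cc_infinity UNIV"
      using lh by (intro Cc_infinityI[of _ "{l..h}"] smooth_mult sm) auto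
    then have "(LINT x|lebesgue. V' x * deriv (\<lambda>x. x * \<phi> x) x) = - (LINT x|lebesgue. V'' x * (x * \<phi> x))"
      using w by (auto simp: weak_deriv_def)
    moreover have "deriv (\<lambda>x. x * \<phi> x) x = \<phi> x + x * deriv \<phi> x" for x
      by (rule DERIV_imp_deriv) (auto intro!: derivative_eq_intros smooth_real_DERIV[OF sm])
    ultimately have 1: "(LINT x|lebesgue. V' x * \<phi> x + (V' x * x) * deriv \<phi> x) = - (LINT x|lebesgue. V'' x * (x * \<phi> x))"
      by (simp add: algebra_simps)
    note ci = continuous_intros c smooth_real_DERIV[OF sm] smooth_imp_continuous[OF sm]
    have i: "integrable lebesgue (\<lambda>x. V' x * \<phi> x)" "integrable lebesgue (\<lambda>x. (V' x * x) * deriv \<phi> x)"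
      "integrable lebesgue (\<lambda>x. V'' x * (x * \<phi> x))" "integrable lebesgue \<phi>"
      subgoal using lh by (intro lebesgue_integral_compact_support(1)[of _ l h] ci) auto
      subgoal using lh by (intro lebesgue_integral_compact_support(1)[of _ l h] ci) auto
      subgoal using lh by (intro Linf_loc_mult_integrable[OF L, of _ l h] ci) auto
      subgoal using lh by (intro lebesgue_integral_compact_support(1)[of _ l h] ci) auto
      done
    let ?g = "\<lambda>x. (V' x + V'' x * x) * \<phi> x"
    have g: "?g = (\<lambda>x. V' x * \<phi> x + V'' x * (x * \<phi> x))" by (auto simp: algebra_simps)
    have ig: "integrable lebesgue ?g" unfolding g using i by auto
    have 2: "(LINT x|lebesgue. (V' x * x) * deriv \<phi> x) = - (LINT x|lebesgue. ?g x)"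
      unfolding g using 1 i by simp
    have "(LINT x|lebesgue. ?g x) \<le> (LINT x|lebesgue. \<kappa> * \<phi> x)"
    proof (rule integral_mono_AE[OF ig integrable_mult_right[OF i(4)]])
      show "AE x in lebesgue. ?g x \<le> \<kappa> * \<phi> x" using b
      proof eventually_elim
        case (elim x) then show ?case using pos[of x] z[of x] by (cases "x \<in> {lo..hi}") (auto intro: mult_right_mono)
      qed
    qed
    moreover have "(LINT x|lebesgue. \<kappa> * x * deriv \<phi> x) = - (LINT x|lebesgue. \<kappa> * \<phi> x)"
      "integrable lebesgue (\<lambda>x. \<kappa> * x * deriv \<phi> x)"
      using integral_mult_deriv_test[OF phi, of "\<lambda>x. \<kappa> * x" "\<lambda>_. \<kappa>"] by (auto intro!: derivative_eq_intros)
    ultimately show ?thesis using 2 i by (simp add: left_diff_distrib)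
  qed
  have "\<kappa> * u - V' u * u \<le> \<kappa> * v - V' v * v"
    by (rule mono_of_weak_derivative_nonneg[OF _ _ uv]) (use key in \<open>auto intro!: continuous_intros c\<close>)
  then show "V' v * v - V' u * u \<le> \<kappa> * (v - u)" by (simp add: algebra_simps)
qed

section \<open>The one-sided exponential average\<close>

definition ekernel :: "real \<Rightarrow> real \<Rightarrow> real \<Rightarrow> real" where
  "ekernel \<epsilon> x y = indicator {x<..} y * exp ((x - y) / \<epsilon>)"

definition expavg :: "real \<Rightarrow> (real \<Rightarrow> real) \<Rightarrow> real \<Rightarrow> real" where
  "expavg \<epsilon> g x = (1 / \<epsilon>) * (LINT y|lebesgue. ekernel \<epsilon> x y * g y)"

lemma W_eq_expavg: "W \<epsilon> \<rho> t x = expavg \<epsilon> (\<rho> t) x"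
  by (simp add: W_def expavg_def ekernel_def set_lebesgue_integral_def mult.assoc)

definition ess_bounded :: "real \<Rightarrow> (real \<Rightarrow> real) \<Rightarrow> bool" where
  "ess_bounded C g \<longleftrightarrow> g \<in> borel_measurable lebesgue \<and> (AE x in lebesgue. \<bar>g x\<bar> \<le> C)"

lemma ekernel_nonneg: "ekernel \<epsilon> x y \<ge> 0" by (simp add: ekernel_def)

lemma ekernel_measurable [measurable]: "ekernel \<epsilon> x \<in> borel_measurable lebesgue"
proof -
  have "ekernel \<epsilon> x \<in> borel_measurable borel" unfolding ekernel_def by measurable
  then show ?thesis by (intro measurable_completion) simp
qed

lemma nonneg_halfline_integral:
  fixes h H :: "real \<Rightarrow> real"
  assumes d: "\<And>y. (H has_real_derivative h y) (at y)" and c: "continuous_on UNIV h"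
    and nn: "\<And>y. y \<ge> a \<Longrightarrow> h y \<ge> 0" and l: "(H \<longlongrightarrow> l) at_top"
  shows "integrable lebesgue (\<lambda>y. indicator {a<..} y * h y)"
    "(LINT y|lebesgue. indicator {a<..} y * h y) = l - H a"
proof -
  have I: "(h has_integral H y - H a) {a..y}" if "a \<le> y" for y
    by (rule fundamental_theorem_of_calculus[OF that])
       (use d in \<open>auto simp: has_real_derivative_iff_has_vector_derivative[symmetric] intro: has_field_derivative_at_within\<close>)
  have "(h has_integral l - H a) {a..}"
  proof (rule has_integral_to_inf)
    show "h integrable_on {a..y}" for y
      using c continuous_on_subset by (intro integrable_continuous_real) blast
    have "eventually (\<lambda>y. H y - H a = integral {a..y} h) at_top"
      using eventually_ge_at_top[of a] by eventually_elim (use integral_unique[OF I] in simp)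
    moreover have "((\<lambda>y. H y - H a) \<longlongrightarrow> l - H a) at_top" by (intro tendsto_intros l)
    ultimately show "((\<lambda>y. integral {a..y} h) \<longlongrightarrow> l - H a) at_top"
      by (rule Lim_transform_eventually[rotated])
  qed (use nn in auto)
  then have ii: "(h has_integral l - H a) {a<..}"
    by (rule has_integral_spike_set_eq[THEN iffD1, rotated 2])
       (auto intro: negligible_subset[of "{a}"] simp: less_le)
  have s: "set_integrable lebesgue {a<..} h"
    using ii nn by (intro nonnegative_absolutely_integrable_1) auto
  then show "integrable lebesgue (\<lambda>y. indicator {a<..} y * h y)"
    by (simp add: set_integrable_def)
  show "(LINT y|lebesgue. indicator {a<..} y * h y) = l - H a"
    using set_lebesgue_integral_eq_integral(2)[OF s] ii
    by (simp add: set_lebesgue_integral_def integral_unique)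
qed

text \<open>Mass and first two moments of the kernel; the moments enter when a Taylor expansion is averaged.\<close>

lemma ekernel_integral:
  assumes "\<epsilon> > 0"
  shows "integrable lebesgue (ekernel \<epsilon> x)" "(LINT y|lebesgue. ekernel \<epsilon> x y) = \<epsilon>"
    "integrable lebesgue (\<lambda>y. ekernel \<epsilon> x y * (y - x))"
    "(LINT y|lebesgue. ekernel \<epsilon> x y * (y - x)) = \<epsilon>\<^sup>2"
    "integrable lebesgue (\<lambda>y. ekernel \<epsilon> x y * (y - x)\<^sup>2)"
    "(LINT y|lebesgue. ekernel \<epsilon> x y * (y - x)\<^sup>2) = 2 * \<epsilon> ^ 3"
proof -
  let ?e = "\<lambda>y. exp ((x - y) / \<epsilon>)"
  have l0: "((\<lambda>y. - \<epsilon> * ?e y) \<longlongrightarrow> 0) at_top" 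
    and l1: "((\<lambda>y. - \<epsilon> * (y - x + \<epsilon>) * ?e y) \<longlongrightarrow> 0) at_top"
    and l2: "((\<lambda>y. - \<epsilon> * ((y - x)\<^sup>2 + 2 * \<epsilon> * (y - x) + 2 * \<epsilon>\<^sup>2) * ?e y) \<longlongrightarrow> 0) at_top"
    using assms by real_asymp+
  have d0: "((\<lambda>y. - \<epsilon> * ?e y) has_real_derivative ?e y) (at y)"
    and d1: "((\<lambda>y. - \<epsilon> * (y - x + \<epsilon>) * ?e y) has_real_derivative ?e y * (y - x)) (at y)"
    and d2: "((\<lambda>y. - \<epsilon> * ((y - x)\<^sup>2 + 2 * \<epsilon> * (y - x) + 2 * \<epsilon>\<^sup>2) * ?e y) has_real_derivative ?e y * (y - x)\<^sup>2) (at y)" for y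
    using assms by (auto intro!: derivative_eq_intros simp: field_simps power2_eq_square)
  have c0: "continuous_on UNIV ?e" and c1: "continuous_on UNIV (\<lambda>y. ?e y * (y - x))"
    and c2: "continuous_on UNIV (\<lambda>y. ?e y * (y - x)\<^sup>2)"
    using assms by (auto intro!: continuous_intros)
  have k: "ekernel \<epsilon> x = (\<lambda>y. indicator {x<..} y * ?e y)" by (simp add: ekernel_def fun_eq_iff)
  show "integrable lebesgue (ekernel \<epsilon> x)" "(LINT y|lebesgue. ekernel \<epsilon> x y) = \<epsilon>"
    using nonneg_halfline_integral[OF d0 c0 _ l0, of x] by (simp_all add: k)
  show "integrable lebesgue (\<lambda>y. ekernel \<epsilon> x y * (y - x))"
    "(LINT y|lebesgue. ekernel \<epsilon> x y * (y - x)) = \<epsilon>\<^sup>2"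
    using nonneg_halfline_integral[OF d1 c1 _ l1, of x] by (simp_all add: k mult.assoc power2_eq_square)
  show "integrable lebesgue (\<lambda>y. ekernel \<epsilon> x y * (y - x)\<^sup>2)"
    "(LINT y|lebesgue. ekernel \<epsilon> x y * (y - x)\<^sup>2) = 2 * \<epsilon> ^ 3"
    using nonneg_halfline_integral[OF d2 c2 _ l2, of x]
    by (simp_all add: k mult.assoc power2_eq_square power3_eq_cube)
qed

lemma ess_bounded_integrable:
  assumes "ess_bounded C g" "integrable lebesgue k"
  shows "integrable lebesgue (\<lambda>y. k y * g y)"
proof (rule Bochner_Integration.integrable_bound[OF integrable_mult_right[OF assms(2), of C]])
  show "(\<lambda>y. k y * g y) \<in> borel_measurable lebesgue"
    using assms by (auto simp: ess_bounded_def borel_measurable_integrable)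
  have "AE y in lebesgue. \<bar>g y\<bar> \<le> C" using assms by (simp add: ess_bounded_def)
  then show "AE y in lebesgue. norm (k y * g y) \<le> norm (C * k y)"
    by eventually_elim (auto simp: abs_mult mult.commute intro!: mult_right_mono)
qed

lemma ess_bounded_integral_bound:
  assumes g: "ess_bounded C g" and k: "integrable lebesgue k" "\<And>y. \<bar>k y\<bar> \<le> k' y" "integrable lebesgue k'"
  shows "\<bar>LINT y|lebesgue. k y * g y\<bar> \<le> C * (LINT y|lebesgue. k' y)"
proof -
  have "\<bar>LINT y|lebesgue. k y * g y\<bar> \<le> (LINT y|lebesgue. \<bar>k y * g y\<bar>)"
    by (rule integral_abs_bound)
  also have "\<dots> \<le> (LINT y|lebesgue. C * k' y)"
  proof (rule integral_mono_AE)
    show "integrable lebesgue (\<lambda>y. \<bar>k y * g y\<bar>)"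
      by (intro integrable_abs ess_bounded_integrable[OF g k(1)])
    have "AE y in lebesgue. \<bar>g y\<bar> \<le> C" using g by (simp add: ess_bounded_def)
    then show "AE y in lebesgue. \<bar>k y * g y\<bar> \<le> C * k' y"
    proof eventually_elim
      case (elim y)
      have "\<bar>k y * g y\<bar> \<le> k' y * C"
        unfolding abs_mult using elim k(2)[of y] by (intro mult_mono) auto
      then show ?case by (simp add: mult.commute)
    qed
  qed (use k in auto)
  finally show ?thesis by simp
qed

lemma ess_bounded_continuous:
  "continuous_on UNIV g \<Longrightarrow> (\<And>x. \<bar>g x\<bar> \<le> C) \<Longrightarrow> ess_bounded C g"
  unfolding ess_bounded_def
  by (auto intro: continuous_measurable_lebesgue)

lemma ess_bounded_mult:
  assumes "ess_bounded C g" "ess_bounded D h"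
  shows "ess_bounded (C * D) (\<lambda>x. g x * h x)"
proof -
  have "AE x in lebesgue. \<bar>g x\<bar> \<le> C" "AE x in lebesgue. \<bar>h x\<bar> \<le> D"
    using assms by (auto simp: ess_bounded_def)
  then have "AE x in lebesgue. \<bar>g x * h x\<bar> \<le> C * D"
    by eventually_elim (auto simp: abs_mult intro!: mult_mono)
  then show ?thesis using assms by (auto simp: ess_bounded_def)
qed

lemma ess_bounded_diff:
  assumes "ess_bounded C g" "ess_bounded D h"
  shows "ess_bounded (C + D) (\<lambda>x. g x - h x)"
proof -
  have "AE x in lebesgue. \<bar>g x\<bar> \<le> C" "AE x in lebesgue. \<bar>h x\<bar> \<le> D"
    using assms by (auto simp: ess_bounded_def)
  then have "AE x in lebesgue. \<bar>g x - h x\<bar> \<le> C + D" by eventually_elim auto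
  then show ?thesis using assms by (auto simp: ess_bounded_def)
qed

lemma ess_bounded_const: "ess_bounded \<bar>c\<bar> (\<lambda>x. c)"
  by (simp add: ess_bounded_def)

context
  fixes \<epsilon> :: real assumes eps: "\<epsilon> > 0"
begin

lemma expavg_integrable: "ess_bounded C g \<Longrightarrow> integrable lebesgue (\<lambda>y. ekernel \<epsilon> x y * g y)"
  by (rule ess_bounded_integrable[OF _ ekernel_integral(1)[OF eps]])

lemma expavg_const: "expavg \<epsilon> (\<lambda>y. c) x = c"
  using eps ekernel_integral[OF eps, of x] by (simp add: expavg_def)

lemma expavg_diff: "ess_bounded C g \<Longrightarrow> ess_bounded D h \<Longrightarrow>
   expavg \<epsilon> (\<lambda>y. g y - h y) x = expavg \<epsilon> g x - expavg \<epsilon> h x"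
  using expavg_integrable[of C g x] expavg_integrable[of D h x]
  by (simp add: expavg_def right_diff_distrib)

lemma expavg_cmult: "expavg \<epsilon> (\<lambda>y. c * g y) x = c * expavg \<epsilon> g x"
  by (simp add: expavg_def mult.left_commute)

lemma expavg_mono_AE:
  assumes "ess_bounded C g" "ess_bounded D h" "AE y in lebesgue. g y \<le> h y"
  shows "expavg \<epsilon> g x \<le> expavg \<epsilon> h x"
proof -
  have "(LINT y|lebesgue. ekernel \<epsilon> x y * g y) \<le> (LINT y|lebesgue. ekernel \<epsilon> x y * h y)"
    by (rule integral_mono_AE)
       (use assms expavg_integrable ekernel_nonneg in \<open>auto elim!: eventually_mono intro!: mult_left_mono\<close>)
  then show ?thesis using eps by (simp add: expavg_def divide_right_mono)
qed

lemma expavg_bounds: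
  assumes "ess_bounded C g" "AE y in lebesgue. a \<le> g y \<and> g y \<le> b"
  shows "a \<le> expavg \<epsilon> g x" "expavg \<epsilon> g x \<le> b"
proof -
  have "AE y in lebesgue. a \<le> g y" "AE y in lebesgue. g y \<le> b" using assms(2) by auto
  from expavg_mono_AE[OF ess_bounded_const assms(1) this(1)] expavg_mono_AE[OF assms(1) ess_bounded_const this(2)]
  show "a \<le> expavg \<epsilon> g x" "expavg \<epsilon> g x \<le> b" by (simp_all add: expavg_const)
qed

lemma expavg_bound: "ess_bounded C g \<Longrightarrow> \<bar>expavg \<epsilon> g x\<bar> \<le> C"
proof -
  assume g: "ess_bounded C g"
  then have "AE y in lebesgue. \<bar>g y\<bar> \<le> C" by (simp add: ess_bounded_def)
  then have "AE y in lebesgue. - C \<le> g y \<and> g y \<le> C" by eventually_elim auto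
  from expavg_bounds[OF g this, of x] show ?thesis by auto
qed

text \<open>With the exponential factor split off, the average is an integral with variable lower
  limit. Its increments are therefore integrals over short intervals, which gives the Lipschitz bound
  and, for continuous \<open>g\<close>, the equation \<open>\<epsilon> k' = k - g\<close> for the average \<open>k\<close> of \<open>g\<close>.\<close>

lemma expavg_increment:
  assumes g: "ess_bounded C g" and "x \<le> z"
  shows "set_integrable lebesgue {x..z} (\<lambda>y. exp (- y / \<epsilon>) * g y)"
   "exp (- x / \<epsilon>) * expavg \<epsilon> g x - exp (- z / \<epsilon>) * expavg \<epsilon> g z
     = (1 / \<epsilon>) * (LINT y:{x..z}|lebesgue. exp (- y / \<epsilon>) * g y)"
proof -
  have ind: "indicator {x..z} y * exp (- y / \<epsilon>) * g y =
     exp (- x / \<epsilon>) * (ekernel \<epsilon> x y * g y) - exp (- z / \<epsilon>) * (ekernel \<epsilon> z y * g y)" if "y \<noteq> x" for y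
    using that \<open>x \<le> z\<close> by (auto simp: ekernel_def indicator_def exp_add[symmetric] mult.assoc[symmetric] diff_divide_distrib)
  have ae: "AE y in lebesgue. exp (- x / \<epsilon>) * (ekernel \<epsilon> x y * g y) - exp (- z / \<epsilon>) * (ekernel \<epsilon> z y * g y) = 
    indicator {x..z} y *\<^sub>R (exp (- y / \<epsilon>) * g y)"
  proof -
    have "AE y in lebesgue. y \<noteq> x"
      by (rule AE_I'[of "{x}"]) (auto simp: null_sets_completionI)
    then show ?thesis by eventually_elim (use ind in \<open>simp add: mult.assoc\<close>)
  qed
  have i: "integrable lebesgue (\<lambda>y. exp (- x / \<epsilon>) * (ekernel \<epsilon> x y * g y) - exp (- z / \<epsilon>) * (ekernel \<epsilon> z y * g y))"
    using expavg_integrable[OF g] by auto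
  have "(\<lambda>y. exp (- y / \<epsilon>)) \<in> borel_measurable lebesgue"
    by (intro measurable_completion) simp
  then have m: "(\<lambda>y. indicator {x..z} y *\<^sub>R (exp (- y / \<epsilon>) * g y)) \<in> borel_measurable lebesgue"
    using g by (auto simp: ess_bounded_def intro!: borel_measurable_times borel_measurable_scaleR borel_measurable_indicator)
  show "set_integrable lebesgue {x..z} (\<lambda>y. exp (- y / \<epsilon>) * g y)"
    unfolding set_integrable_def using integrable_cong_AE_imp[OF i m ae] .
  have "(LINT y:{x..z}|lebesgue. exp (- y / \<epsilon>) * g y) =
    (LINT y|lebesgue. exp (- x / \<epsilon>) * (ekernel \<epsilon> x y * g y) - exp (- z / \<epsilon>) * (ekernel \<epsilon> z y * g y))"
    unfolding set_lebesgue_integral_def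
    by (rule integral_cong_AE[OF m borel_measurable_integrable[OF i]]) (use ae in \<open>auto elim: eventually_mono\<close>)
  also have "\<dots> = exp (- x / \<epsilon>) * (LINT y|lebesgue. ekernel \<epsilon> x y * g y) - exp (- z / \<epsilon>) * (LINT y|lebesgue. ekernel \<epsilon> z y * g y)"
    using expavg_integrable[OF g] by simp
  finally show "exp (- x / \<epsilon>) * expavg \<epsilon> g x - exp (- z / \<epsilon>) * expavg \<epsilon> g z
     = (1 / \<epsilon>) * (LINT y:{x..z}|lebesgue. exp (- y / \<epsilon>) * g y)"
    by (simp add: expavg_def right_diff_distrib)
qed

lemma set_integral_ess_bounded:
  assumes g: "ess_bounded C g" and "x \<le> z"
  shows "\<bar>LINT y:{x..z}|lebesgue. exp (- y / \<epsilon>) * g y\<bar> \<le> C * exp (- x / \<epsilon>) * (z - x)"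
proof -
  have c: "continuous_on {x..z} (\<lambda>y. exp (- y / \<epsilon>))" by (intro continuous_intros) (use eps in auto)
  have "integrable lebesgue (\<lambda>y. indicat_real {x..z} y * exp (- y / \<epsilon>))"
    "integrable lebesgue (\<lambda>y. indicat_real {x..z} y * exp (- x / \<epsilon>))"
    using absolutely_integrable_continuous_real[OF c]
      absolutely_integrable_continuous_real[of x z "\<lambda>_. exp (- x / \<epsilon>)"]
    by (simp_all add: set_integrable_def)
  from ess_bounded_integral_bound[OF g this(1) _ this(2)]
  have "\<bar>LINT y|lebesgue. indicat_real {x..z} y * exp (- y / \<epsilon>) * g y\<bar> \<le>
     C * (LINT y|lebesgue. indicat_real {x..z} y * exp (- x / \<epsilon>))"
    using eps by (auto simp: indicator_def divide_right_mono)
  also have "(LINT y|lebesgue. indicat_real {x..z} y * exp (- x / \<epsilon>)) = (z - x) * exp (- x / \<epsilon>)"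
    using \<open>x \<le> z\<close> by simp
  finally show ?thesis by (simp add: set_lebesgue_integral_def mult.assoc mult.commute[of "z - x"])
qed

lemma expavg_lipschitz:
  assumes g: "ess_bounded C g"
  shows "\<bar>expavg \<epsilon> g x - expavg \<epsilon> g z\<bar> \<le> 2 * C / \<epsilon> * \<bar>x - z\<bar>"
proof -
  have *: "\<bar>expavg \<epsilon> g x - expavg \<epsilon> g z\<bar> \<le> 2 * C / \<epsilon> * (z - x)" if "x \<le> z" for x z
  proof -
    let ?I = "LINT y:{x..z}|lebesgue. exp (- y / \<epsilon>) * g y"
    have C: "C \<ge> 0" using expavg_bound[OF g, of x] by simp
    have "exp (x / \<epsilon>) * (exp (- x / \<epsilon>) * expavg \<epsilon> g x) = exp (x / \<epsilon>) * (exp (- z / \<epsilon>) * expavg \<epsilon> g z + (1 / \<epsilon>) * ?I)"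
      using expavg_increment(2)[OF g that] by (simp add: algebra_simps)
    then have eq: "expavg \<epsilon> g x = exp ((x - z) / \<epsilon>) * expavg \<epsilon> g z + exp (x / \<epsilon>) * ?I / \<epsilon>"
      by (simp add: distrib_left mult.assoc[symmetric] exp_add[symmetric] diff_divide_distrib)
    have "exp ((x - z) / \<epsilon>) \<le> 1" using that eps by (simp add: divide_nonpos_pos)
    moreover have "exp ((x - z) / \<epsilon>) \<ge> 1 + (x - z) / \<epsilon>" by (rule exp_ge_add_one_self)
    moreover have "(x - z) / \<epsilon> = - ((z - x) / \<epsilon>)" by (simp add: diff_divide_distrib)
    ultimately have e1: "\<bar>exp ((x - z) / \<epsilon>) - 1\<bar> \<le> (z - x) / \<epsilon>" by linarith
    have "\<bar>exp (x / \<epsilon>) * ?I\<bar> \<le> exp (x / \<epsilon>) * (C * exp (- x / \<epsilon>) * (z - x))"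
      using set_integral_ess_bounded[OF g that] by (simp add: abs_mult)
    also have "\<dots> = C * (z - x)" by (simp add: mult.assoc[symmetric] mult.commute[of C] exp_add[symmetric])
    finally have e2: "\<bar>exp (x / \<epsilon>) * ?I / \<epsilon>\<bar> \<le> C * (z - x) / \<epsilon>"
      using eps by (simp add: abs_div divide_right_mono)
    have "expavg \<epsilon> g x - expavg \<epsilon> g z = (exp ((x - z) / \<epsilon>) - 1) * expavg \<epsilon> g z + exp (x / \<epsilon>) * ?I / \<epsilon>"
      using eq by (simp add: algebra_simps)
    also have "\<bar>\<dots>\<bar> \<le> (z - x) / \<epsilon> * C + C * (z - x) / \<epsilon>"
      using mult_mono[OF e1 expavg_bound[OF g, of z]] e2 that eps
      by (intro order_trans[OF abs_triangle_ineq] add_mono) (simp_all add: abs_mult)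
    finally show ?thesis by (simp add: mult_ac)
  qed
  show ?thesis
    using *[of x z] *[of z x] by (cases "x \<le> z") (auto simp: abs_minus_commute)
qed

lemma expavg_DERIV:
  assumes c: "continuous_on UNIV g" and b: "\<And>x. \<bar>g x\<bar> \<le> C"
  shows "(expavg \<epsilon> g has_real_derivative (expavg \<epsilon> g x - g x) / \<epsilon>) (at x)"
proof -
  note g = ess_bounded_continuous[OF c b]
  define a where "a = x - 1"
  let ?h = "\<lambda>y. exp (- y / \<epsilon>) * g y"
  have ch: "continuous_on A ?h" for A
    by (intro continuous_intros continuous_on_subset[OF c]) (use eps in auto)
  define H where "H = (\<lambda>x. exp (x / \<epsilon>) * (exp (- a / \<epsilon>) * expavg \<epsilon> g a - (1 / \<epsilon>) * integral {a..x} ?h))"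
  have eq: "expavg \<epsilon> g z = H z" if "z \<ge> a" for z
  proof -
    have "exp (- z / \<epsilon>) * expavg \<epsilon> g z = exp (- a / \<epsilon>) * expavg \<epsilon> g a - (1 / \<epsilon>) * integral {a..z} ?h"
      using expavg_increment[OF g that] set_lebesgue_integral_eq_integral(2) by fastforce
    then have "exp (z / \<epsilon>) * (exp (- z / \<epsilon>) * expavg \<epsilon> g z) = H z" unfolding H_def by simp
    then show ?thesis by (simp add: mult.assoc[symmetric] exp_add[symmetric])
  qed
  have "((\<lambda>z. integral {a..z} ?h) has_real_derivative ?h x) (at x within {a..x+1})"
    by (rule integral_has_real_derivative[OF ch]) (simp add: a_def)
  then have "((\<lambda>z. integral {a..z} ?h) has_real_derivative ?h x) (at x)"
    by (simp add: a_def at_within_Icc_at)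
  then have "(H has_real_derivative (1 / \<epsilon>) * H x - (exp (x / \<epsilon>) * ?h x) / \<epsilon>) (at x)"
    unfolding H_def using eps by (auto intro!: derivative_eq_intros simp: field_simps)
  moreover have "exp (x / \<epsilon>) * ?h x = g x" by (simp add: mult.assoc[symmetric] exp_add[symmetric])
  ultimately have "(H has_real_derivative (1 / \<epsilon>) * H x - g x / \<epsilon>) (at x)" by (simp only:)
  then have "(H has_real_derivative (expavg \<epsilon> g x - g x) / \<epsilon>) (at x)"
    using eq[of x] by (simp add: a_def diff_divide_distrib)
  moreover have "eventually (\<lambda>z. expavg \<epsilon> g z = H z) (nhds x)"
  proof -
    have "eventually (\<lambda>z. z > a) (nhds x)"
      using eventually_nhds_in_open[of "{a<..}" x] by (simp add: a_def)
    then show ?thesis by eventually_elim (simp add: eq)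
  qed
  ultimately show ?thesis by (subst DERIV_cong_ev[OF refl _ refl])
qed

lemma expavg_tendsto:
  assumes g: "\<And>n. ess_bounded C (g n)" "g' \<in> borel_measurable lebesgue"
    and l: "\<And>y. (\<lambda>n. g n y) \<longlonglongrightarrow> g' y"
  shows "(\<lambda>n. expavg \<epsilon> (g n) x) \<longlonglongrightarrow> expavg \<epsilon> g' x"
  unfolding expavg_def
proof (intro tendsto_intros integral_dominated_convergence)
  show "(\<lambda>y. ekernel \<epsilon> x y * g' y) \<in> borel_measurable lebesgue" 
    "(\<lambda>y. ekernel \<epsilon> x y * g n y) \<in> borel_measurable lebesgue" for n
  proof -
    have "g n \<in> borel_measurable lebesgue" using g(1) by (simp add: ess_bounded_def)
    then show "(\<lambda>y. ekernel \<epsilon> x y * g' y) \<in> borel_measurable lebesgue" 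
      "(\<lambda>y. ekernel \<epsilon> x y * g n y) \<in> borel_measurable lebesgue" using g(2) by simp_all
  qed
  show "integrable lebesgue (\<lambda>y. C * ekernel \<epsilon> x y)"
    by (intro integrable_mult_right ekernel_integral eps)
  show "AE y in lebesgue. (\<lambda>n. ekernel \<epsilon> x y * g n y) \<longlonglongrightarrow> ekernel \<epsilon> x y * g' y"
    by (intro AE_I2 tendsto_intros l)
  show "AE y in lebesgue. norm (ekernel \<epsilon> x y * g n y) \<le> C * ekernel \<epsilon> x y" for n
  proof -
    have "AE y in lebesgue. \<bar>g n y\<bar> \<le> C" using g by (simp add: ess_bounded_def)
    then show ?thesis
      by eventually_elim (auto simp: abs_mult ekernel_nonneg mult.commute intro!: mult_right_mono)
  qed
qed

lemma ekernel_tail: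
  assumes "x \<le> N"
  shows "integrable lebesgue (\<lambda>y. indicator {N<..} y * exp ((x - y) / \<epsilon>))"
    "(LINT y|lebesgue. indicator {N<..} y * exp ((x - y) / \<epsilon>)) = \<epsilon> * exp ((x - N) / \<epsilon>)"
proof -
  have "(\<lambda>y. indicator {N<..} y * exp ((x - y) / \<epsilon>)) = (\<lambda>y. exp ((x - N) / \<epsilon>) * ekernel \<epsilon> N y)"
    by (auto simp: ekernel_def fun_eq_iff indicator_def exp_add[symmetric] add_divide_distrib[symmetric])
  then show "integrable lebesgue (\<lambda>y. indicator {N<..} y * exp ((x - y) / \<epsilon>))"
    "(LINT y|lebesgue. indicator {N<..} y * exp ((x - y) / \<epsilon>)) = \<epsilon> * exp ((x - N) / \<epsilon>)"
    using ekernel_integral(1,2)[OF eps, of N] by simp_all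
qed

text \<open>Only the values of \<open>g\<close> on a bounded interval matter up to an exponentially small tail,
  so convergence in \<open>L\<^sup>1\<close> on compact sets is enough for convergence of the averages.\<close>

lemma expavg_dist_le:
  assumes g: "ess_bounded C g" and h: "ess_bounded C h" and "x \<le> N"
  shows "\<bar>expavg \<epsilon> g x - expavg \<epsilon> h x\<bar> \<le>
     (1 / \<epsilon>) * (LINT y:{x..N}|lebesgue. \<bar>g y - h y\<bar>) + 2 * C * exp ((x - N) / \<epsilon>)"
proof -
  note d = ess_bounded_diff[OF g h]
  have C: "C \<ge> 0" using expavg_bound[OF g, of x] by simp
  let ?i = "\<lambda>y. indicat_real {x..N} y"
  have i0: "integrable lebesgue ?i" 
    by (rule integrable_indicator_Icc)
  have i1: "integrable lebesgue (\<lambda>y. ?i y * \<bar>g y - h y\<bar>)"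
    using integrable_abs[OF ess_bounded_integrable[OF d i0]] by (simp add: abs_mult)
  have i2: "integrable lebesgue (\<lambda>y. indicator {N<..} y * exp ((x - y) / \<epsilon>) * (2 * C))"
    using ekernel_tail(1)[OF assms(3)] by simp
  have eq: "expavg \<epsilon> g x - expavg \<epsilon> h x = (1 / \<epsilon>) * (LINT y|lebesgue. ekernel \<epsilon> x y * (g y - h y))"
    using expavg_diff[OF g h, of x] by (simp add: expavg_def)
  have "\<bar>LINT y|lebesgue. ekernel \<epsilon> x y * (g y - h y)\<bar> \<le>
     (LINT y|lebesgue. ?i y * \<bar>g y - h y\<bar> + indicator {N<..} y * exp ((x - y) / \<epsilon>) * (2 * C))"
  proof (rule order_trans[OF integral_abs_bound], rule integral_mono_AE)
    show "integrable lebesgue (\<lambda>y. \<bar>ekernel \<epsilon> x y * (g y - h y)\<bar>)"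
      by (intro integrable_abs expavg_integrable[OF d])
    show "integrable lebesgue (\<lambda>y. ?i y * \<bar>g y - h y\<bar> + indicator {N<..} y * exp ((x - y) / \<epsilon>) * (2 * C))"
      using i1 i2 by simp
    have "AE y in lebesgue. \<bar>g y - h y\<bar> \<le> C + C" using d by (simp add: ess_bounded_def)
    then show "AE y in lebesgue. \<bar>ekernel \<epsilon> x y * (g y - h y)\<bar> \<le>
      ?i y * \<bar>g y - h y\<bar> + indicator {N<..} y * exp ((x - y) / \<epsilon>) * (2 * C)"
    proof eventually_elim
      case (elim y)
      have "exp ((x - y) / \<epsilon>) \<le> 1" if "x < y" using that eps by (simp add: divide_nonpos_pos)
      moreover have "exp ((x - y) / \<epsilon>) * \<bar>g y - h y\<bar> \<le> exp ((x - y) / \<epsilon>) * (2 * C)"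
        using elim by (intro mult_left_mono) auto
      ultimately show ?case
        using \<open>x \<le> N\<close> mult_right_mono[of "exp ((x - y) / \<epsilon>)" 1 "\<bar>g y - h y\<bar>"]
        by (auto simp: ekernel_def indicator_def abs_mult)
    qed
  qed
  also have "\<dots> = (LINT y:{x..N}|lebesgue. \<bar>g y - h y\<bar>) + 2 * C * (\<epsilon> * exp ((x - N) / \<epsilon>))"
    using i1 i2 ekernel_tail[OF assms(3)] by (simp add: set_lebesgue_integral_def)
  finally have b: "\<bar>LINT y|lebesgue. ekernel \<epsilon> x y * (g y - h y)\<bar> \<le>
    (LINT y:{x..N}|lebesgue. \<bar>g y - h y\<bar>) + 2 * C * (\<epsilon> * exp ((x - N) / \<epsilon>))" .
  have "\<bar>expavg \<epsilon> g x - expavg \<epsilon> h x\<bar> =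
     (1 / \<epsilon>) * \<bar>LINT y|lebesgue. ekernel \<epsilon> x y * (g y - h y)\<bar>" using eq eps by (simp add: abs_mult)
  also have "\<dots> \<le> (1 / \<epsilon>) * ((LINT y:{x..N}|lebesgue. \<bar>g y - h y\<bar>) + 2 * C * (\<epsilon> * exp ((x - N) / \<epsilon>)))"
    using b eps by (intro mult_left_mono) auto
  finally show ?thesis using eps by (simp add: distrib_left)
qed

end

section \<open>Time evolution of integrals of the weak solution\<close>

text \<open>First \<open>g n\<close> is replaced by \<open>g'\<close>, at a cost of \<open>D\<close> times an \<open>L\<^sup>1\<close> distance on \<open>[a, b]\<close>; the rest is
  dominated convergence.\<close>

lemma integral_product_tendsto:
  assumes g: "\<And>n. ess_bounded C (g n)" "ess_bounded C g'"
    and l: "(\<lambda>n. LINT y:{a..b}|lebesgue. \<bar>g n y - g' y\<bar>) \<longlonglongrightarrow> 0"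
    and h: "\<And>n. h n \<in> borel_measurable lebesgue" "\<And>n y. \<bar>h n y\<bar> \<le> D * indicator {a..b} y"
    and hl: "\<And>y. (\<lambda>n. h n y) \<longlonglongrightarrow> h' y"
  shows "(\<lambda>n. LINT y|lebesgue. h n y * g n y) \<longlonglongrightarrow> (LINT y|lebesgue. h' y * g' y)"
proof -
  let ?i = "indicat_real {a..b}"
  have i0: "integrable lebesgue ?i" by (rule integrable_indicator_Icc)
  have D: "D * ?i y \<ge> 0" for y using order_trans[OF abs_ge_zero h(2)] .
  have ih: "integrable lebesgue (h n)" for n
    by (rule Bochner_Integration.integrable_bound[OF integrable_mult_right[OF i0, of D] h(1)])
       (use h(2) D in auto)
  have h': "h' \<in> borel_measurable lebesgue"
    by (rule borel_measurable_LIMSEQ_real[OF hl h(1)])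
  have h'b: "\<bar>h' y\<bar> \<le> D * ?i y" for y
    using tendsto_rabs[OF hl[of y]] h(2) by (intro LIMSEQ_le_const2) auto
  have ih': "integrable lebesgue h'"
    by (rule Bochner_Integration.integrable_bound[OF integrable_mult_right[OF i0, of D] h'])
       (use h'b D in auto)
  have 1: "(\<lambda>n. LINT y|lebesgue. h n y * g' y) \<longlonglongrightarrow> (LINT y|lebesgue. h' y * g' y)"
  proof (rule integral_dominated_convergence)
    show "(\<lambda>y. h' y * g' y) \<in> borel_measurable lebesgue" "(\<lambda>y. h n y * g' y) \<in> borel_measurable lebesgue" for n
      using ess_bounded_integrable[OF g(2) ih'] ess_bounded_integrable[OF g(2) ih[of n]] by auto
    show "integrable lebesgue (\<lambda>y. (D * ?i y) * C)"
      using i0 by (intro integrable_mult_left integrable_mult_right) 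
    show "AE y in lebesgue. (\<lambda>n. h n y * g' y) \<longlonglongrightarrow> h' y * g' y"
      by (intro AE_I2 tendsto_intros hl)
    have "AE y in lebesgue. \<bar>g' y\<bar> \<le> C" using g by (simp add: ess_bounded_def)
    then show "AE y in lebesgue. norm (h n y * g' y) \<le> (D * ?i y) * C" for n
      by eventually_elim (use h(2)[of n] D in \<open>auto simp: abs_mult simp del: indicator_simps intro!: mult_mono\<close>)
  qed
  have 2: "(\<lambda>n. LINT y|lebesgue. h n y * (g n y - g' y)) \<longlonglongrightarrow> 0"
  proof (rule Lim_null_comparison)
    show "(\<lambda>n. D * (LINT y:{a..b}|lebesgue. \<bar>g n y - g' y\<bar>)) \<longlonglongrightarrow> 0"
      using tendsto_mult[OF tendsto_const l, of D] by simp
    show "\<forall>\<^sub>F n in sequentially. norm (LINT y|lebesgue. h n y * (g n y - g' y)) \<le> D * (LINT y:{a..b}|lebesgue. \<bar>g n y - g' y\<bar>)"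
    proof (intro always_eventually allI)
      fix n
      note d = ess_bounded_diff[OF g(1)[of n] g(2)]
      have "\<bar>LINT y|lebesgue. h n y * (g n y - g' y)\<bar> \<le> (LINT y|lebesgue. \<bar>h n y * (g n y - g' y)\<bar>)"
        by (rule integral_abs_bound)
      also have "\<dots> \<le> (LINT y|lebesgue. D * (?i y * \<bar>g n y - g' y\<bar>))"
      proof (rule integral_mono)
        show "integrable lebesgue (\<lambda>y. \<bar>h n y * (g n y - g' y)\<bar>)"
          by (intro integrable_abs ess_bounded_integrable[OF d ih])
        show "integrable lebesgue (\<lambda>y. D * (?i y * \<bar>g n y - g' y\<bar>))"
          using integrable_abs[OF ess_bounded_integrable[OF d i0]] by (simp add: abs_mult)
        show "\<bar>h n y * (g n y - g' y)\<bar> \<le> D * (?i y * \<bar>g n y - g' y\<bar>)" for y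
          using mult_right_mono[OF h(2)[of n y], of "\<bar>g n y - g' y\<bar>"] by (simp add: abs_mult mult.assoc)
      qed
      finally show "norm (LINT y|lebesgue. h n y * (g n y - g' y)) \<le> D * (LINT y:{a..b}|lebesgue. \<bar>g n y - g' y\<bar>)"
        by (simp add: set_lebesgue_integral_def)
    qed
  qed
  have "(LINT y|lebesgue. h n y * g n y) = (LINT y|lebesgue. h n y * g' y) + (LINT y|lebesgue. h n y * (g n y - g' y))" for n
    using ess_bounded_integrable[OF g(1)[of n] ih[of n]] ess_bounded_integrable[OF g(2) ih[of n]]
    by (simp add: right_diff_distrib)
  then show ?thesis using tendsto_add[OF 1 2] by simp
qed

lemma expavg_tendsto_L1loc:
  assumes eps: "\<epsilon> > 0" and g: "\<And>n. ess_bounded C (g n)" "ess_bounded C g'"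
    and l: "\<And>a b. (\<lambda>n. LINT y:{a..b}|lebesgue. \<bar>g n y - g' y\<bar>) \<longlonglongrightarrow> 0"
    and x: "x \<longlonglongrightarrow> x'"
  shows "(\<lambda>n. expavg \<epsilon> (g n) (x n)) \<longlonglongrightarrow> expavg \<epsilon> g' x'"
proof -
  have 1: "(\<lambda>n. expavg \<epsilon> (g n) x') \<longlonglongrightarrow> expavg \<epsilon> g' x'"
  proof (rule LIMSEQ_I)
    fix e :: real assume "e > 0"
    have "((\<lambda>N. 2 * C * exp ((x' - N) / \<epsilon>)) \<longlongrightarrow> 0) at_top" using eps by real_asymp
    then have "eventually (\<lambda>N. 2 * C * exp ((x' - N) / \<epsilon>) < e / 2) at_top"
      using \<open>e > 0\<close> by (intro order_tendstoD) auto
    with eventually_ge_at_top[of x'] obtain N where N: "x' \<le> N" "2 * C * exp ((x' - N) / \<epsilon>) < e / 2"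
      by (metis (mono_tags, lifting) eventually_at_top_linorder linorder_linear)
    have "(\<lambda>n. (1 / \<epsilon>) * (LINT y:{x'..N}|lebesgue. \<bar>g n y - g' y\<bar>)) \<longlonglongrightarrow> (1 / \<epsilon>) * 0"
      by (intro tendsto_intros l)
    then have "\<forall>\<^sub>F n in sequentially. (1 / \<epsilon>) * (LINT y:{x'..N}|lebesgue. \<bar>g n y - g' y\<bar>) < e / 2"
      using \<open>e > 0\<close> by (intro order_tendstoD) auto
    then have "\<forall>\<^sub>F n in sequentially. norm (expavg \<epsilon> (g n) x' - expavg \<epsilon> g' x') < e"
    proof eventually_elim
      case (elim n)
      then show ?case using expavg_dist_le[OF eps g(1)[of n] g(2) N(1)] N(2) unfolding real_norm_def by linarith
    qed
    then show "\<exists>no. \<forall>n\<ge>no. norm (expavg \<epsilon> (g n) x' - expavg \<epsilon> g' x') < e"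
      by (simp add: eventually_sequentially)
  qed
  have 2: "(\<lambda>n. expavg \<epsilon> (g n) (x n) - expavg \<epsilon> (g n) x') \<longlonglongrightarrow> 0"
  proof (rule Lim_null_comparison)
    have "(\<lambda>n. 2 * C / \<epsilon> * \<bar>x n - x'\<bar>) \<longlonglongrightarrow> 2 * C / \<epsilon> * \<bar>x' - x'\<bar>" by (intro tendsto_intros x)
    then show "(\<lambda>n. 2 * C / \<epsilon> * \<bar>x n - x'\<bar>) \<longlonglongrightarrow> 0" by simp
  qed (use expavg_lipschitz[OF eps g(1)] in auto)
  show ?thesis using tendsto_add[OF 1 2] by simp
qed

lemma AE_interval_witness:
  fixes a b :: real
  assumes "AE t in lebesgue. t \<in> A \<longrightarrow> P t" "{a<..<b} \<subseteq> A" "a < b"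
  obtains t where "a < t" "t < b" "P t"
proof (rule ccontr)
  assume "\<not> thesis"
  then have n: "\<not> P t" if "a < t" "t < b" for t using that \<open>\<And>t. \<lbrakk>a < t; t < b; P t\<rbrakk> \<Longrightarrow> thesis\<close> by blast
  have "AE t in lebesgue. t \<notin> {a<..<b}"
    using assms(1) by eventually_elim (use n assms(2) in auto)
  then have "{a<..<b} \<in> null_sets lebesgue"
    by (subst AE_iff_null_sets) auto
  then show False using \<open>a < b\<close> by (simp add: null_sets_def)
qed

lemma C_L1_loc_sequence:
  assumes r: "\<rho> \<in> C_L1_loc T" and s: "s \<in> {0..T}" and t: "\<And>n. t n \<in> {0..T}" "t \<longlonglongrightarrow> s"
  shows "(\<lambda>n. LINT y:{a..b}|lebesgue. \<bar>\<rho> (t n) y - \<rho> s y\<bar>) \<longlonglongrightarrow> 0"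
proof -
  let ?F = "\<lambda>t. LINT y:{a..b}|lebesgue. \<bar>\<rho> t y - \<rho> s y\<bar>"
  have "(?F \<longlongrightarrow> 0) (at s within {0..T})"
    using r s by (auto simp: C_L1_loc_def)
  moreover have "?F s = 0" by (simp add: set_lebesgue_integral_def)
  ultimately have "continuous (at s within {0..T}) ?F" by (simp add: continuous_within)
  from continuous_within_tendsto_compose'[OF this t] show ?thesis
    unfolding \<open>?F s = 0\<close> .
qed

lemma L1_loc_measurable:
  assumes "f \<in> L1_loc" shows "f \<in> borel_measurable lebesgue"
proof -
  have "(\<lambda>x. indicat_real {- real n..real n} x * f x) \<in> borel_measurable lebesgue" for n
  proof -
    have "set_integrable lebesgue {- real n..real n} f" using assms by (auto simp: L1_loc_def)
    then show ?thesis using borel_measurable_integrable by (auto simp: set_integrable_def)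
  qed
  moreover have "(\<lambda>n. indicat_real {- real n..real n} x * f x) \<longlonglongrightarrow> f x" for x
  proof (rule tendsto_eventually)
    obtain N :: nat where "\<bar>x\<bar> \<le> N" using real_arch_simple by blast
    then show "\<forall>\<^sub>F n in sequentially. indicat_real {- real n..real n} x * f x = f x"
      by (intro eventually_sequentiallyI[of N]) (auto simp: indicator_def)
  qed
  ultimately show ?thesis by (rule borel_measurable_LIMSEQ_real[rotated])
qed

text \<open>The essential bound is only given for almost every time, but a bound passes to
  limits in \<open>L\<^sup>1\<close> on compact sets, hence to every time.\<close>

lemma C_L1_loc_bounded_everywhere:
  assumes r: "\<rho> \<in> C_L1_loc T" "\<rho> \<in> Linf_Linf T" and "T > 0"
  obtains C where "\<And>s. s \<in> {0..T} \<Longrightarrow> ess_bounded C (\<rho> s)"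
proof -
  obtain C where C: "AE t in lebesgue. t \<in> {0<..<T} \<longrightarrow>
     \<rho> t \<in> borel_measurable lebesgue \<and> (AE x in lebesgue. \<bar>\<rho> t x\<bar> \<le> C)"
    using r(2) by (auto simp: Linf_Linf_def)
  have m: "\<rho> s \<in> borel_measurable lebesgue" if "s \<in> {0..T}" for s
    using r(1) that by (intro L1_loc_measurable) (auto simp: C_L1_loc_def)
  have "AE x in lebesgue. \<bar>\<rho> s x\<bar> \<le> C" if s: "s \<in> {0..T}" for s
  proof -
    have "\<exists>t. t \<in> {0..T} \<and> \<bar>t - s\<bar> < 1 / real (Suc n) \<and> ess_bounded C (\<rho> t)" for n
    proof -
      define d where "d = 1 / real (Suc n)"
      have d: "d > 0" by (simp add: d_def)
      have lt: "max 0 (s - d) < min T (s + d)" and sub: "{max 0 (s - d)<..<min T (s + d)} \<subseteq> {0<..<T}"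
        using s d \<open>T > 0\<close> by auto
      obtain t where "max 0 (s - d) < t" "t < min T (s + d)" 
        "\<rho> t \<in> borel_measurable lebesgue \<and> (AE x in lebesgue. \<bar>\<rho> t x\<bar> \<le> C)"
        using AE_interval_witness[OF C sub lt] by blast
      then show ?thesis by (intro exI[of _ t]) (auto simp: ess_bounded_def d_def)
    qed
    then obtain t where t: "\<And>n. t n \<in> {0..T}" "\<And>n. \<bar>t n - s\<bar> < 1 / real (Suc n)" "\<And>n. ess_bounded C (\<rho> (t n))"
      by metis
    have "(\<lambda>n. t n - s) \<longlonglongrightarrow> 0"
      by (rule Lim_null_comparison[OF _ LIMSEQ_inverse_real_of_nat])
         (use t(2) in \<open>auto simp: inverse_eq_divide intro!: always_eventually less_imp_le\<close>)
    then have ts: "t \<longlonglongrightarrow> s" by (rule LIM_zero_cancel)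
    have "AE x in lebesgue. x \<in> {- real N..real N} \<longrightarrow> \<bar>\<rho> s x\<bar> \<le> C" for N :: nat
    proof -
      let ?K = "{- real N..real N}"
      let ?p = "\<lambda>x. max (\<bar>\<rho> s x\<bar> - C) 0"
      have sr: "set_integrable lebesgue ?K (\<rho> u)" if "u \<in> {0..T}" for u
        using r(1) that by (auto simp: C_L1_loc_def L1_loc_def)
      have id: "integrable lebesgue (\<lambda>x. indicat_real ?K x * \<bar>\<rho> (t n) x - \<rho> s x\<bar>)" for n
        using set_integral_diff(1)[OF sr[OF t(1)[of n]] sr[OF s]]
        by (auto simp: set_integrable_def abs_mult dest: integrable_abs)
      have ae: "AE x in lebesgue. indicat_real ?K x * ?p x \<le> indicat_real ?K x * \<bar>\<rho> (t n) x - \<rho> s x\<bar>" for n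
      proof -
        have "AE x in lebesgue. \<bar>\<rho> (t n) x\<bar> \<le> C" using t(3) by (simp add: ess_bounded_def)
        then show ?thesis by eventually_elim (auto simp: indicator_def)
      qed
      have ip: "integrable lebesgue (\<lambda>x. indicat_real ?K x * ?p x)"
      proof (rule Bochner_Integration.integrable_bound[OF id[of 0]])
        show "(\<lambda>x. indicat_real ?K x * ?p x) \<in> borel_measurable lebesgue"
          using m[OF s] by (intro borel_measurable_times borel_measurable_max borel_measurable_diff borel_measurable_abs borel_measurable_indicator) auto
      qed (use ae[of 0] in \<open>auto simp: abs_mult elim!: eventually_mono\<close>)
      have "(LINT x|lebesgue. indicat_real ?K x * ?p x) \<le> 0"
      proof (rule LIMSEQ_le_const[OF C_L1_loc_sequence[OF r(1) s t(1) ts, of "- real N" "real N"]], intro exI allI impI)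
        show "(LINT x|lebesgue. indicat_real ?K x * ?p x) \<le> (LINT y:?K|lebesgue. \<bar>\<rho> (t n) y - \<rho> s y\<bar>)" for n
          unfolding set_lebesgue_integral_def using integral_mono_AE[OF ip id ae] by simp
      qed
      moreover have "(LINT x|lebesgue. indicat_real ?K x * ?p x) \<ge> 0" by (rule integral_nonneg_AE) auto
      ultimately have "(LINT x|lebesgue. indicat_real ?K x * ?p x) = 0" by simp
      then have "AE x in lebesgue. indicat_real ?K x * ?p x = 0"
        by (subst (asm) integral_nonneg_eq_0_iff_AE[OF ip]) auto
      then show ?thesis by eventually_elim (auto simp: max_def split: if_splits)
    qed
    then have "AE x in lebesgue. \<forall>N. x \<in> {- real N..real N} \<longrightarrow> \<bar>\<rho> s x\<bar> \<le> C"
      unfolding AE_all_countable by blast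
    then show ?thesis
    proof eventually_elim
      case (elim x)
      obtain N :: nat where "\<bar>x\<bar> \<le> N" using real_arch_simple by blast
      then show ?case using elim by (auto simp: abs_le_iff dest!: spec[of _ N])
    qed
  qed
  then show ?thesis using m by (intro that[of C]) (auto simp: ess_bounded_def)
qed

locale nonlocal_solution =
  fixes V \<rho>0 :: "real \<Rightarrow> real" and \<rho> :: "real \<Rightarrow> real \<Rightarrow> real" and \<epsilon> T C :: real
  assumes eps: "\<epsilon> > 0" and T: "T > 0"
    and weak: "weak_solution V \<rho>0 \<epsilon> T \<rho>"
    and V_cont: "continuous_on UNIV V"
    and \<rho>_bound: "t \<in> {0..T} \<Longrightarrow> ess_bounded C (\<rho> t)"
    and \<rho>0_bound: "ess_bounded C \<rho>0"
begin

abbreviation w :: "real \<Rightarrow> real \<Rightarrow> real" where "w t x \<equiv> expavg \<epsilon> (\<rho> t) x"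

lemma \<rho>_sequence:
  assumes "s \<in> {0..T}" "\<And>n. t n \<in> {0..T}" "t \<longlonglongrightarrow> s"
  shows "(\<lambda>n. LINT y:{a..b}|lebesgue. \<bar>\<rho> (t n) y - \<rho> s y\<bar>) \<longlonglongrightarrow> 0"
  using weak assms by (intro C_L1_loc_sequence) (auto simp: weak_solution_def)

lemma w_bound: "t \<in> {0..T} \<Longrightarrow> \<bar>w t x\<bar> \<le> C"
  by (rule expavg_bound[OF eps \<rho>_bound])

lemma C_nonneg: "C \<ge> 0"
  using w_bound[of 0 0] T by auto

lemma w_lipschitz: "t \<in> {0..T} \<Longrightarrow> \<bar>w t x - w t z\<bar> \<le> 2 * C / \<epsilon> * \<bar>x - z\<bar>"
  by (rule expavg_lipschitz[OF eps \<rho>_bound])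

lemma w_tendsto:
  assumes "s \<in> {0..T}" "\<And>n. t n \<in> {0..T}" "t \<longlonglongrightarrow> s" "x \<longlonglongrightarrow> x'"
  shows "(\<lambda>n. w (t n) (x n)) \<longlonglongrightarrow> w s x'"
  using assms by (intro expavg_tendsto_L1loc[OF eps, of C] \<rho>_bound \<rho>_sequence) auto

lemma w_continuous: "t \<in> {0..T} \<Longrightarrow> continuous_on A (w t)"
  by (rule continuous_on_sequentiallyI) (auto intro!: w_tendsto)

lemma Vw_continuous: "t \<in> {0..T} \<Longrightarrow> continuous_on A (\<lambda>x. V (w t x))"
  by (rule continuous_on_compose2[OF V_cont w_continuous]) auto

lemma compose_w_bounded:
  assumes "continuous_on UNIV f"
  obtains B where "B \<ge> 0" "\<And>t x. t \<in> {0..T} \<Longrightarrow> \<bar>f (w t x)\<bar> \<le> (B :: real)"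
proof -
  obtain B where B: "B \<ge> 0" "\<And>x. x \<in> {- C..C} \<Longrightarrow> \<bar>f x\<bar> \<le> B"
    using continuous_on_Icc_bounded[OF continuous_on_subset[OF assms subset_UNIV]] by blast
  moreover have "w t x \<in> {- C..C}" if "t \<in> {0..T}" for t x
    using w_bound[OF that, of x] by (auto simp: abs_le_iff)
  ultimately show ?thesis by (intro that[of B]) auto
qed

lemma flux_integral_tendsto:
  assumes "s \<in> {0..T}" "\<And>n. t n \<in> {0..T}" "t \<longlonglongrightarrow> s"
    and k: "\<And>n. continuous_on UNIV (k n)" "\<And>n y. \<bar>k n y\<bar> \<le> D * indicator {a..b} y"
    and kl: "\<And>y. (\<lambda>n. k n y) \<longlonglongrightarrow> k' y"
  shows "(\<lambda>n. LINT y|lebesgue. k n y * \<rho> (t n) y) \<longlonglongrightarrow> (LINT y|lebesgue. k' y * \<rho> s y)"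
    "(\<lambda>n. LINT y|lebesgue. (V (w (t n) y) * k n y) * \<rho> (t n) y) \<longlonglongrightarrow> (LINT y|lebesgue. (V (w s y) * k' y) * \<rho> s y)"
proof -
  note m = continuous_measurable_lebesgue
  show "(\<lambda>n. LINT y|lebesgue. k n y * \<rho> (t n) y) \<longlonglongrightarrow> (LINT y|lebesgue. k' y * \<rho> s y)"
    by (rule integral_product_tendsto[OF \<rho>_bound \<rho>_bound \<rho>_sequence])
       (use assms m in \<open>auto\<close>)
  obtain B where B: "B \<ge> 0" "\<And>t x. t \<in> {0..T} \<Longrightarrow> \<bar>V (w t x)\<bar> \<le> B" using compose_w_bounded[OF V_cont] by blast
  have "\<bar>V (w (t n) y) * k n y\<bar> \<le> B * D * indicator {a..b} y" for n y
    using mult_mono[OF B(2)[OF assms(2)[of n], of y] k(2)[of n y]] B(1)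
    by (simp add: abs_mult mult.assoc)
  moreover have "(\<lambda>n. V (w (t n) y) * k n y) \<longlonglongrightarrow> V (w s y) * k' y" for y
    using V_cont by (intro tendsto_mult kl isCont_tendsto_compose[of _ V] w_tendsto assms)
       (auto simp: continuous_on_eq_continuous_at)
  ultimately show "(\<lambda>n. LINT y|lebesgue. (V (w (t n) y) * k n y) * \<rho> (t n) y) \<longlonglongrightarrow> (LINT y|lebesgue. (V (w s y) * k' y) * \<rho> s y)"
    by (intro integral_product_tendsto[of C _ _ a b _ "B * D"] \<rho>_bound \<rho>_sequence assms m continuous_intros Vw_continuous) auto
qed

text \<open>Testing with products \<open>\<theta>(t) \<psi>(x)\<close>, where \<open>\<theta>\<close> runs through plateaus that shrink to the
  indicator of \<open>[0, t]\<close>, turns the weak formulation into an integral identity in time.\<close>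

lemma evolution_interior:
  assumes psi: "\<psi> \<in> Cc_infinity UNIV" and t: "0 < t" "t < T"
  defines "b \<equiv> \<lambda>s. LINT y|lebesgue. (V (w s y) * deriv \<psi> y) * \<rho> s y"
  shows "(LINT y|lebesgue. \<psi> y * \<rho> t y) = (LINT y|lebesgue. \<psi> y * \<rho>0 y) + integral {0..t} b"
    and "continuous_on {0..T} b" "continuous_on {0..T} (\<lambda>s. LINT y|lebesgue. \<psi> y * \<rho> s y)"
proof -
  define a where "a = (\<lambda>s. LINT y|lebesgue. \<psi> y * \<rho> s y)"
  have sm: "smooth \<psi>" using psi by (auto simp: Cc_infinity_def)
  obtain l h where lh: "l \<le> h" "\<And>x. x \<notin> {l..h} \<Longrightarrow> \<psi> x = 0" "\<And>x. x \<notin> {l..h} \<Longrightarrow> deriv \<psi> x = 0"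
    using Cc_infinity_real_bounds[OF psi] by blast
  have bdd: "\<exists>D. \<forall>y. \<bar>k y\<bar> \<le> D * indicator {l..h} y"
    if kc: "continuous_on UNIV k" and kz: "\<And>x. x \<notin> {l..h} \<Longrightarrow> k x = 0" for k :: "real \<Rightarrow> real"
  proof -
    obtain B where "\<And>x. x \<in> {l..h} \<Longrightarrow> \<bar>k x\<bar> \<le> B"
      using continuous_on_Icc_bounded[OF continuous_on_subset[OF kc subset_UNIV]] by blast
    then show ?thesis using kz by (intro exI[of _ B]) (auto simp: indicator_def)
  qed
  have cs: "continuous_on UNIV \<psi>" "continuous_on UNIV (deriv \<psi>)"
    using smooth_imp_continuous[OF sm] smooth_real_DERIV[OF sm] by auto
  obtain D1 D2 where D: "\<And>y. \<bar>\<psi> y\<bar> \<le> D1 * indicator {l..h} y" "\<And>y. \<bar>deriv \<psi> y\<bar> \<le> D2 * indicator {l..h} y"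
    using bdd[OF cs(1) lh(2)] bdd[OF cs(2) lh(3)] by metis
  have ca: "continuous_on {0..T} a"
    unfolding a_def by (rule continuous_on_sequentiallyI, rule flux_integral_tendsto(1)) (use cs D in auto)
  have cb: "continuous_on {0..T} b"
    unfolding b_def by (rule continuous_on_sequentiallyI, rule flux_integral_tendsto(2)) (use cs D in auto)
  show "continuous_on {0..T} b" by (rule cb)
  show "continuous_on {0..T} (\<lambda>s. LINT y|lebesgue. \<psi> y * \<rho> s y)" using ca by (simp add: a_def)
  have ia: "set_integrable lebesgue {0<..<T} a" and ib: "set_integrable lebesgue {0<..<T} b"
    using set_integrable_subset[OF absolutely_integrable_continuous_real[OF ca], of "{0<..<T}"]
      set_integrable_subset[OF absolutely_integrable_continuous_real[OF cb], of "{0<..<T}"]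
      greaterThanLessThan_subseteq_atLeastAtMost_iff[of 0 T 0 T] by simp_all
  let ?init = "LINT y|lebesgue. \<psi> y * \<rho>0 y"
  have weak_n: "(LINT s:{0<..<T}|lebesgue. b s * plateau n (-1) t s) + ?init = (LINT s|lebesgue. (indicator {0<..<T} s * a s) * sbump n t s)"
    if n: "n \<ge> 1" "t + 1 / n < T" for n
  proof -
    let ?\<theta> = "plateau n (-1) t"
    let ?\<phi> = "\<lambda>p. ?\<theta> (fst p) * \<psi> (snd p)"
    have "?\<phi> \<in> Cc_infinity ({..<T} \<times> UNIV)"
    proof (rule Cc_infinityI)
      show "smooth ?\<phi>" by (rule smooth_tensor[OF smooth_plateau sm])
      show "compact ({-1..t + 1 / n} \<times> {l..h})" by (intro compact_Times compact_Icc)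
      show "{-1..t + 1 / n} \<times> {l..h} \<subseteq> {..<T} \<times> UNIV" using n by auto
      show "?\<phi> p = 0" if "p \<notin> {-1..t + 1 / n} \<times> {l..h}" for p
        using that plateau_eq_0[of n "-1" t "fst p"] lh(2)[of "snd p"] n t by (cases p) auto
    qed
    then have eq: "(LINT s:{0<..<T}|lebesgue. (LINT x|lebesgue.
            \<rho> s x * deriv (\<lambda>s. ?\<phi> (s, x)) s + V (W \<epsilon> \<rho> s x) * \<rho> s x * deriv (\<lambda>y. ?\<phi> (s, y)) x))
        + (LINT x|lebesgue. \<rho>0 x * ?\<phi> (0, x)) = 0"
      by (rule bspec[OF conjunct2[OF weak[unfolded weak_solution_def]]])
    have inner: "(LINT x|lebesgue.
            \<rho> s x * deriv (\<lambda>s. ?\<phi> (s, x)) s + V (W \<epsilon> \<rho> s x) * \<rho> s x * deriv (\<lambda>y. ?\<phi> (s, y)) x)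
          = b s * ?\<theta> s - a s * sbump n t s" if s: "s \<in> {0<..<T}" for s
    proof -
      have s': "s \<in> {0..T}" using s by auto
      \<comment> \<open>the plateau rises before time \<open>0\<close>, so only its descent at \<open>t\<close> is visible\<close>
      have 0: "sbump n (-1) s = 0"
      proof (rule sbump_eq_0)
        have "1 / n \<le> 1" using n by simp
        then show "s \<notin> {-1..-1 + 1 / n}" using s by auto
      qed (use n in simp)
      have d1: "deriv (\<lambda>s. ?\<phi> (s, x)) s = - sbump n t s * \<psi> x" for x
        by (rule DERIV_imp_deriv) (auto intro!: derivative_eq_intros plateau_DERIV simp: 0)
      have d2: "deriv (\<lambda>y. ?\<phi> (s, y)) x = ?\<theta> s * deriv \<psi> x" for x
        by (rule DERIV_imp_deriv) (auto intro!: derivative_eq_intros smooth_real_DERIV[OF sm])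
      have k: "integrable lebesgue \<psi>" "integrable lebesgue (\<lambda>y. V (w s y) * deriv \<psi> y)"
        using lh by (auto intro!: lebesgue_integral_compact_support(1)[of _ l h] cs continuous_intros Vw_continuous s')
      note i = ess_bounded_integrable[OF \<rho>_bound[OF s'] k(1)] ess_bounded_integrable[OF \<rho>_bound[OF s'] k(2)]
      have "(LINT x|lebesgue.
            \<rho> s x * deriv (\<lambda>s. ?\<phi> (s, x)) s + V (W \<epsilon> \<rho> s x) * \<rho> s x * deriv (\<lambda>y. ?\<phi> (s, y)) x)
         = (LINT x|lebesgue. ?\<theta> s * ((V (w s x) * deriv \<psi> x) * \<rho> s x) - sbump n t s * (\<psi> x * \<rho> s x))"
        unfolding d1 d2 W_eq_expavg by (intro Bochner_Integration.integral_cong) (auto simp: algebra_simps)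
      also have "\<dots> = ?\<theta> s * b s - sbump n t s * a s"
        unfolding a_def b_def using i by (subst Bochner_Integration.integral_diff) auto
      finally show ?thesis by (simp add: mult.commute)
    qed
    have eq2: "(LINT s:{0<..<T}|lebesgue. b s * ?\<theta> s - a s * sbump n t s) + (LINT x|lebesgue. \<rho>0 x * ?\<phi> (0, x)) = 0"
    proof -
      have "(LINT s:{0<..<T}|lebesgue. b s * ?\<theta> s - a s * sbump n t s) = (LINT s:{0<..<T}|lebesgue. (LINT x|lebesgue.
            \<rho> s x * deriv (\<lambda>s. ?\<phi> (s, x)) s + V (W \<epsilon> \<rho> s x) * \<rho> s x * deriv (\<lambda>y. ?\<phi> (s, y)) x))"
        by (rule set_lebesgue_integral_cong) (use inner in auto)
      then show ?thesis using eq by simp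
    qed
    have "step (n * (0 - t)) = 0" "step (n * (0 - (-1))) = 1"
      using n t by (auto intro!: step_bump)
    then have "?\<theta> 0 = 1" by (simp add: plateau_def)
    then have eq3: "(LINT x|lebesgue. \<rho>0 x * ?\<phi> (0, x)) = ?init" by (simp add: mult.commute)
    have i1: "set_integrable lebesgue {0<..<T} (\<lambda>s. b s * ?\<theta> s)"
      by (rule set_integrable_subset[OF absolutely_integrable_continuous_real[of 0 T]])
         (auto intro!: continuous_intros cb continuous_on_subset[OF smooth_imp_continuous[OF smooth_plateau]])
    have i2: "set_integrable lebesgue {0<..<T} (\<lambda>s. a s * sbump n t s)"
      by (rule set_integrable_subset[OF absolutely_integrable_continuous_real[of 0 T]])
         (auto intro!: continuous_intros ca continuous_sbump)
    have "(LINT s:{0<..<T}|lebesgue. b s * ?\<theta> s) - (LINT s:{0<..<T}|lebesgue. a s * sbump n t s) + ?init = 0"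
      using eq2 eq3 set_integral_diff(2)[OF i1 i2] by simp
    then show ?thesis by (simp add: set_lebesgue_integral_def mult.assoc)
  qed
  \<comment> \<open>steepness at least \<open>1\<close> and large enough for the support to end before \<open>T\<close>\<close>
  define N where "N = (\<lambda>n::nat. real n + 1 + 1 / (T - t))"
  have N: "N n \<ge> 1" "t + 1 / N n < T" for n
  proof -
    show "N n \<ge> 1" using t by (simp add: N_def)
    have "N n > 1 / (T - t)" by (simp add: N_def)
    moreover have "1 / (T - t) > 0" using t by simp
    ultimately have "1 / N n < T - t" using t by (metis divide_less_eq_1_pos inverse_divide div_by_1 inverse_eq_divide less_imp_inverse_less)
    then show "t + 1 / N n < T" by simp
  qed
  have Nlim: "(\<lambda>n. 1 / N n) \<longlonglongrightarrow> 0"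
    unfolding N_def using t by real_asymp
  have lim1: "(\<lambda>n. LINT s|lebesgue. (indicator {0<..<T} s * a s) * sbump (N n) t s) \<longlonglongrightarrow> a t"
  proof (rule LIMSEQ_I)
    fix e :: real assume "e > 0"
    have "isCont a t" using ca t by (simp add: continuous_on_interior)
    then obtain d where d: "d > 0" "\<And>x. \<bar>x - t\<bar> < d \<Longrightarrow> \<bar>a x - a t\<bar> < e / 2"
      unfolding continuous_at_eps_delta dist_real_def using half_gt_zero[OF \<open>e > 0\<close>] by metis
    have "\<forall>\<^sub>F n in sequentially. 1 / N n < d" using order_tendstoD(2)[OF Nlim d(1)] .
    then obtain n0 where n0: "\<And>n. n \<ge> n0 \<Longrightarrow> 1 / N n < d" by (auto simp: eventually_sequentially)
    have "\<bar>(LINT s|lebesgue. (indicator {0<..<T} s * a s) * sbump (N n) t s) - a t\<bar> \<le> e / 2" if "n \<ge> n0" for n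
    proof (rule sbump_average(2))
      show "N n > 0" using N(1)[of n] by simp
      show "(\<lambda>s. indicator {0<..<T} s * a s) \<in> borel_measurable lebesgue"
        using borel_measurable_integrable[OF ia[unfolded set_integrable_def]] by simp
      fix x assume "x \<in> {t..t + 1 / N n}"
      then show "\<bar>indicator {0<..<T} x * a x - a t\<bar> \<le> e / 2"
        using d(2)[of x] n0[OF that] N(2)[of n] t by (auto simp: indicator_def)
    qed
    note half = this
    show "\<exists>no. \<forall>n\<ge>no. norm ((LINT s|lebesgue. (indicator {0<..<T} s * a s) * sbump (N n) t s) - a t) < e"
    proof (intro exI[of _ n0] allI impI)
      fix n assume "n \<ge> n0"
      from half[OF this] \<open>e > 0\<close>
      show "norm ((LINT s|lebesgue. (indicator {0<..<T} s * a s) * sbump (N n) t s) - a t) < e"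
        unfolding real_norm_def by linarith
    qed
  qed
  have lim2: "(\<lambda>n. LINT s:{0<..<T}|lebesgue. b s * plateau (N n) (-1) t s) \<longlonglongrightarrow> (LINT s:{0<..<T}|lebesgue. b s * indicator {..t} s)"
    unfolding set_lebesgue_integral_def
  proof (rule integral_dominated_convergence)
    have bm: "(\<lambda>s. indicator {0<..<T} s * b s) \<in> borel_measurable lebesgue"
      using borel_measurable_integrable[OF ib[unfolded set_integrable_def]] by simp
    have pm: "plateau n u v \<in> borel_measurable lebesgue" for n u v
      by (intro continuous_measurable_lebesgue smooth_imp_continuous smooth_plateau)
    have "(\<lambda>s. (indicator {0<..<T} s * b s) * plateau (N n) (-1) t s) \<in> borel_measurable lebesgue" for n
      using bm pm by (rule borel_measurable_times)
    then show "(\<lambda>s. indicator {0<..<T} s *\<^sub>R (b s * plateau (N n) (-1) t s)) \<in> borel_measurable lebesgue" for n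
      by (simp add: mult.assoc)
    have "(\<lambda>s. (indicator {0<..<T} s * b s) * indicator {..t} s) \<in> borel_measurable lebesgue"
      using bm by (rule borel_measurable_times[OF _ borel_measurable_indicator]) simp
    then show "(\<lambda>s. indicator {0<..<T} s *\<^sub>R (b s * indicator {..t} s)) \<in> borel_measurable lebesgue"
      by (simp add: mult.assoc)
    show "integrable lebesgue (\<lambda>s. \<bar>indicator {0<..<T} s *\<^sub>R b s\<bar>)"
      using ib unfolding set_integrable_def by (rule integrable_abs)
    show "AE s in lebesgue. norm (indicator {0<..<T} s *\<^sub>R (b s * plateau (N n) (-1) t s)) \<le> \<bar>indicator {0<..<T} s *\<^sub>R b s\<bar>" for n
    proof (rule AE_I2)
      fix s
      have "\<bar>plateau (N n) (-1) t s\<bar> \<le> 1"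
        using plateau_bounds(1)[of "N n" "-1" t s] plateau_bounds(2)[of "N n" "-1" t s] N(1)[of n] t by auto
      then show "norm (indicator {0<..<T} s *\<^sub>R (b s * plateau (N n) (-1) t s)) \<le> \<bar>indicator {0<..<T} s *\<^sub>R b s\<bar>"
        by (auto simp: indicator_def abs_mult mult_left_le)
    qed
    show "AE s in lebesgue. (\<lambda>n. indicator {0<..<T} s *\<^sub>R (b s * plateau (N n) (-1) t s)) \<longlonglongrightarrow> indicator {0<..<T} s *\<^sub>R (b s * indicator {..t} s)"
    proof (rule AE_I2)
      fix s
      have "(\<lambda>n. plateau (N n) (-1) t s) \<longlonglongrightarrow> indicator {..t} s" if "s > 0"
      proof (rule tendsto_eventually)
        have s1: "step (N n * (s - (-1))) = 1" for n
          using that N(1)[of n] mult_mono[of 1 "N n" 1 "s + 1"] by (intro step_bump) auto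
        show "\<forall>\<^sub>F n in sequentially. plateau (N n) (-1) t s = indicator {..t} s"
        proof (cases "s \<le> t")
          case True
          then have "step (N n * (s - t)) = 0" for n
            using N(1)[of n] by (intro step_bump) (auto simp: mult_le_0_iff)
          then show ?thesis using True s1 by (simp add: plateau_def)
        next
          case False
          then have "\<forall>\<^sub>F n in sequentially. 1 / N n < s - t" using order_tendstoD(2)[OF Nlim, of "s - t"] by simp
          then show ?thesis
          proof eventually_elim
            case (elim n)
            then have "step (N n * (s - t)) = 1"
              using N(1)[of n] by (intro step_bump) (auto simp: field_simps)
            then show ?case using False s1[of n] by (simp add: plateau_def)
          qed
        qed
      qed
      then show "(\<lambda>n. indicator {0<..<T} s *\<^sub>R (b s * plateau (N n) (-1) t s)) \<longlonglongrightarrow> indicator {0<..<T} s *\<^sub>R (b s * indicator {..t} s)"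
        by (cases "s > 0") (auto intro!: tendsto_intros)
    qed
  qed
  have "(\<lambda>n. (LINT s:{0<..<T}|lebesgue. b s * plateau (N n) (-1) t s) + ?init) \<longlonglongrightarrow> (LINT s:{0<..<T}|lebesgue. b s * indicator {..t} s) + ?init"
    by (intro tendsto_intros lim2)
  then have "a t = (LINT s:{0<..<T}|lebesgue. b s * indicator {..t} s) + ?init"
    using LIMSEQ_unique[OF lim1] weak_n[OF N] by simp
  also have "(LINT s:{0<..<T}|lebesgue. b s * indicator {..t} s) = (LINT s:{0<..t}|lebesgue. b s)"
    unfolding set_lebesgue_integral_def using t by (intro Bochner_Integration.integral_cong) (auto simp: indicator_def)
  also have "\<dots> = integral {0<..t} b"
    by (rule set_lebesgue_integral_eq_integral(2)[OF set_integrable_subset[OF ib]]) (use t in auto)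
  also have "\<dots> = integral {0..t} b"
    by (rule integral_spike_set) (auto intro: negligible_subset[of "{0}"])
  finally show "(LINT y|lebesgue. \<psi> y * \<rho> t y) = ?init + integral {0..t} b" by (simp add: a_def)
qed

text \<open>At time \<open>0\<close> the identity says that the solution attains its initial datum; it follows from
  continuity in time.\<close>

lemma evolution:
  assumes psi: "\<psi> \<in> Cc_infinity UNIV" and t: "0 \<le> t" "t < T"
  shows "(LINT y|lebesgue. \<psi> y * \<rho> t y) = (LINT y|lebesgue. \<psi> y * \<rho>0 y) +
     integral {0..t} (\<lambda>s. LINT y|lebesgue. (V (w s y) * deriv \<psi> y) * \<rho> s y)"
proof (cases "t = 0")
  case True
  let ?a = "\<lambda>t. LINT y|lebesgue. \<psi> y * \<rho> t y" and ?init = "LINT y|lebesgue. \<psi> y * \<rho>0 y"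
  let ?I = "\<lambda>t. integral {0..t} (\<lambda>s. LINT y|lebesgue. (V (w s y) * deriv \<psi> y) * \<rho> s y)"
  note e = evolution_interior[OF psi]
  have c: "continuous_on {0..T} ?a" "continuous_on {0..T} ?I"
    using e(2,3)[of "T / 2"] T
    by (auto intro: indefinite_integral_continuous_1 integrable_continuous_real)
  define s where "s = (\<lambda>n::nat. T / (real n + 2))"
  have s: "s \<longlonglongrightarrow> 0" "0 < s n" "s n < T" for n
  proof -
    show "s \<longlonglongrightarrow> 0" unfolding s_def using T by real_asymp
    show "0 < s n" "s n < T" unfolding s_def using T by (auto simp: field_simps add_pos_nonneg)
  qed
  have "(\<lambda>n. ?a (s n)) \<longlonglongrightarrow> ?a 0"
    by (rule continuous_on_tendsto_compose[OF c(1) s(1)]) (use s(2,3) T in \<open>auto intro: less_imp_le always_eventually\<close>)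
  moreover have "(\<lambda>n. ?I (s n)) \<longlonglongrightarrow> ?I 0"
    by (rule continuous_on_tendsto_compose[OF c(2) s(1)]) (use s(2,3) T in \<open>auto intro: less_imp_le always_eventually\<close>)
  ultimately have lims: "(\<lambda>n. ?a (s n)) \<longlonglongrightarrow> ?a 0" "(\<lambda>n. ?I (s n)) \<longlonglongrightarrow> ?I 0" by blast+
  have "?a (s n) = ?init + ?I (s n)" for n using e(1)[OF s(2) s(3)] .
  then have "(\<lambda>n. ?a (s n)) \<longlonglongrightarrow> ?init + ?I 0"
    using tendsto_add[OF tendsto_const lims(2), of ?init] by simp
  from LIMSEQ_unique[OF lims(1) this]
  have "?a 0 = ?init + ?I 0" by simp
  then show ?thesis using True by simp
next
  case False
  then show ?thesis using evolution_interior[OF psi, of t] t by simp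
qed

end

section \<open>Characteristics\<close>

text \<open>Solutions of a scalar ODE with prescribed terminal value, by Banach's fixed-point theorem.
  In the variable \<open>r = s - \<tau>\<close> the unknown is \<open>(x - X (s - r)) e\<^bsup>-\<lambda>r\<^esup>\<close>: the
  exponential weight makes the integral operator a contraction on the whole time interval.\<close>

lemma terminal_value_problem:
  fixes v :: "real \<Rightarrow> real \<Rightarrow> real"
  assumes s: "s \<ge> 0" and L: "L \<ge> 0"
    and cont: "\<And>Z. continuous_on {0..s} Z \<Longrightarrow> continuous_on {0..s} (\<lambda>\<tau>. v \<tau> (Z \<tau>))"
    and lip: "\<And>\<tau> x y. \<tau> \<in> {0..s} \<Longrightarrow> \<bar>v \<tau> x - v \<tau> y\<bar> \<le> L * \<bar>x - y\<bar>"
  obtains X where "X s = x" "\<And>\<tau>. \<tau> \<in> {0..s} \<Longrightarrow> (X has_real_derivative v \<tau> (X \<tau>)) (at \<tau> within {0..s})"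
proof -
  define l where "l = L + 1"
  have l: "l > 0" using L by (simp add: l_def)
  define r where "r = (\<lambda>\<sigma>::real. max 0 (min \<sigma> s))"
  have r: "r \<sigma> \<in> {0..s}" for \<sigma> using s by (auto simp: r_def)
  have r_id: "r \<sigma> = \<sigma>" if "\<sigma> \<in> {0..s}" for \<sigma> using that by (auto simp: r_def)
  have cr: "continuous_on A r" for A unfolding r_def by (intro continuous_intros)
  define q where "q = (\<lambda>(Z :: real \<Rightarrow>\<^sub>C real) \<tau>. v (s - \<tau>) (x - exp (l * \<tau>) * Z \<tau>))"
  have cq: "continuous_on {0..s} (q Z)" for Z
  proof -
    have "continuous_on {0..s} (\<lambda>\<tau>. v \<tau> (x - exp (l * (s - \<tau>)) * apply_bcontfun Z (s - \<tau>)))"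
      by (intro cont continuous_intros continuous_on_compose2[OF continuous_on_apply_bcontfun[of UNIV]]) auto
    moreover have "continuous_on {0..s} (\<lambda>\<tau>. s - \<tau>)" "(\<lambda>\<tau>. s - \<tau>) ` {0..s} \<subseteq> {0..s}"
      by (auto intro!: continuous_intros)
    ultimately have "continuous_on {0..s} (\<lambda>\<tau>. v (s - \<tau>) (x - exp (l * (s - (s - \<tau>))) * apply_bcontfun Z (s - (s - \<tau>))))"
      by (rule continuous_on_compose2)
    then show ?thesis unfolding q_def by simp
  qed
  define G where "G = (\<lambda>Z r. integral {0..r} (q Z))"
  have iq: "q Z integrable_on {0..r \<sigma>}" for Z \<sigma>
    using r[of \<sigma>] by (intro integrable_continuous_real continuous_on_subset[OF cq]) auto
  have cG: "continuous_on {0..s} (G Z)" for Z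
    unfolding G_def by (intro indefinite_integral_continuous_1 integrable_continuous_real cq)
  define F where "F = (\<lambda>Z \<sigma>. exp (- l * r \<sigma>) * G Z (r \<sigma>))"
  have F: "F Z \<in> bcontfun" for Z
  proof -
    let ?h = "\<lambda>\<sigma>. exp (- l * \<sigma>) * G Z \<sigma>"
    have ch: "continuous_on {0..s} ?h" by (intro continuous_intros cG)
    have "continuous_on UNIV (\<lambda>\<sigma>. ?h (r \<sigma>))"
      by (rule continuous_on_compose2[OF ch cr]) (use r in auto)
    moreover have "range (\<lambda>\<sigma>. ?h (r \<sigma>)) \<subseteq> ?h ` {0..s}" using r by blast
    then have "bounded (range (\<lambda>\<sigma>. ?h (r \<sigma>)))"
      by (rule bounded_subset[OF compact_imp_bounded[OF compact_continuous_image[OF ch compact_Icc]]])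
    ultimately show ?thesis by (simp add: bcontfun_def F_def)
  qed
  define \<Phi> where "\<Phi> = (\<lambda>Z. Bcontfun (F Z))"
  have \<Phi>: "apply_bcontfun (\<Phi> Z) = F Z" for Z
    unfolding \<Phi>_def by (rule Bcontfun_inverse[OF F])
  have "dist (\<Phi> Z) (\<Phi> Y) \<le> (L / l) * dist Z Y" for Z Y
  proof (rule dist_bound)
    fix \<sigma>
    let ?D = "dist Z Y"
    let ?r = "r \<sigma>"
    have I: "((\<lambda>\<tau>. L * ?D * exp (l * \<tau>)) has_integral L * ?D * exp (l * ?r) / l - L * ?D * exp (l * 0) / l) {0..?r}"
      by (rule fundamental_theorem_of_calculus)
         (use r[of \<sigma>] l in \<open>auto simp: has_real_derivative_iff_has_vector_derivative[symmetric] intro!: derivative_eq_intros\<close>)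
    have "\<bar>G Z ?r - G Y ?r\<bar> = \<bar>integral {0..?r} (\<lambda>\<tau>. q Z \<tau> - q Y \<tau>)\<bar>"
      unfolding G_def using iq by (simp add: integral_diff)
    also have "\<dots> \<le> integral {0..?r} (\<lambda>\<tau>. L * ?D * exp (l * \<tau>))"
    proof (rule integral_norm_bound_integral[where 'a = real, unfolded real_norm_def])
      show "(\<lambda>\<tau>. q Z \<tau> - q Y \<tau>) integrable_on {0..?r}" by (intro integrable_diff iq)
      show "(\<lambda>\<tau>. L * ?D * exp (l * \<tau>)) integrable_on {0..?r}" using I by blast
      fix \<tau> assume "\<tau> \<in> {0..?r}"
      then have "s - \<tau> \<in> {0..s}" using r[of \<sigma>] by auto
      then have "\<bar>q Z \<tau> - q Y \<tau>\<bar> \<le> L * \<bar>(x - exp (l * \<tau>) * Z \<tau>) - (x - exp (l * \<tau>) * Y \<tau>)\<bar>"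
        unfolding q_def by (rule lip)
      also have "\<dots> = L * (exp (l * \<tau>) * \<bar>Z \<tau> - Y \<tau>\<bar>)"
      proof -
        have "(x - exp (l * \<tau>) * Z \<tau>) - (x - exp (l * \<tau>) * Y \<tau>) = exp (l * \<tau>) * (Y \<tau> - Z \<tau>)"
          by (simp add: algebra_simps)
        then show ?thesis by (simp add: abs_mult abs_minus_commute)
      qed
      also have "\<dots> \<le> L * (exp (l * \<tau>) * ?D)"
        using dist_bounded[of Z \<tau> Y] L by (intro mult_left_mono) (auto simp: dist_real_def)
      finally show "\<bar>q Z \<tau> - q Y \<tau>\<bar> \<le> L * ?D * exp (l * \<tau>)" by (simp add: mult_ac)
    qed
    also have "\<dots> \<le> L * ?D * exp (l * ?r) / l"
      using integral_unique[OF I] L l by simp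
    finally have "exp (- l * ?r) * \<bar>G Z ?r - G Y ?r\<bar> \<le> exp (- l * ?r) * (L * ?D * exp (l * ?r) / l)"
      by (intro mult_left_mono) auto
    also have "\<dots> = (L / l) * ?D" by (simp add: exp_minus field_simps)
    finally show "dist (apply_bcontfun (\<Phi> Z) \<sigma>) (apply_bcontfun (\<Phi> Y) \<sigma>) \<le> (L / l) * dist Z Y"
      unfolding \<Phi> F_def by (simp add: dist_real_def right_diff_distrib[symmetric] abs_mult)
  qed
  moreover have "0 \<le> L / l" "L / l < 1" using L by (auto simp: l_def)
  ultimately obtain Z where Z: "\<Phi> Z = Z"
    using banach_fix_type[of "L / l" \<Phi>] by blast
  have Zr: "exp (l * \<sigma>) * apply_bcontfun Z \<sigma> = G Z \<sigma>" if "\<sigma> \<in> {0..s}" for \<sigma>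
  proof -
    have "apply_bcontfun Z \<sigma> = exp (- l * \<sigma>) * G Z \<sigma>"
      using \<Phi>[of Z] Z r_id[OF that] by (simp add: F_def)
    then show ?thesis by (simp add: mult.assoc[symmetric] exp_add[symmetric])
  qed
  define X where "X = (\<lambda>\<tau>. x - G Z (s - \<tau>))"
  show ?thesis
  proof (rule that)
    show "X s = x" by (simp add: X_def G_def)
    fix \<tau> assume t: "\<tau> \<in> {0..s}"
    have d1: "(G Z has_real_derivative q Z (s - \<tau>)) (at (s - \<tau>) within {0..s})"
      unfolding G_def by (rule integral_has_real_derivative[OF cq]) (use t in auto)
    have "((\<lambda>\<tau>. s - \<tau>) ` {0..s}) = {0..s}" by (auto simp: image_iff intro: bexI[of _ "s - _"])
    then have "((\<lambda>\<tau>. G Z (s - \<tau>)) has_real_derivative q Z (s - \<tau>) * (- 1)) (at \<tau> within {0..s})"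
      using d1 by (intro DERIV_image_chain[of "G Z" _ "\<lambda>\<tau>. s - \<tau>", unfolded o_def]) (auto intro!: derivative_eq_intros)
    then have "(X has_real_derivative q Z (s - \<tau>)) (at \<tau> within {0..s})"
      unfolding X_def by (auto intro!: derivative_eq_intros)
    moreover have "q Z (s - \<tau>) = v \<tau> (X \<tau>)"
      using Zr[of "s - \<tau>"] t by (simp add: q_def X_def)
    ultimately show "(X has_real_derivative v \<tau> (X \<tau>)) (at \<tau> within {0..s})" by simp
  qed
qed

section \<open>The nonlocal flux in terms of the average alone\<close>

lemma C1_lipschitz:
  fixes f :: "real \<Rightarrow> real"
  assumes d: "\<And>x. (f has_real_derivative f' x) (at x)" and c: "continuous_on UNIV f'"
  obtains L where "L \<ge> 0" "\<And>x y. \<bar>x\<bar> \<le> C \<Longrightarrow> \<bar>y\<bar> \<le> C \<Longrightarrow> \<bar>f x - f y\<bar> \<le> L * \<bar>x - y\<bar>"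
proof -
  obtain B where B: "B \<ge> 0" "\<And>x. x \<in> {- C..C} \<Longrightarrow> \<bar>f' x\<bar> \<le> B"
    using continuous_on_Icc_bounded[OF continuous_on_subset[OF c subset_UNIV]] by blast
  have "\<bar>f x - f y\<bar> \<le> B * \<bar>x - y\<bar>" if "\<bar>x\<bar> \<le> C" "\<bar>y\<bar> \<le> C" for x y
  proof -
    have "norm (f x - f y) \<le> B * norm (x - y)"
    proof (rule field_differentiable_bound[of "{- C..C}" f f'])
      show "norm (f' z) \<le> B" if "z \<in> {- C..C}" for z using B(2)[OF that] by simp
      show "(f has_real_derivative f' z) (at z within {- C..C})" for z
        by (rule has_field_derivative_at_within[OF d])
    qed (use that in auto)
    then show ?thesis by simp
  qed
  then show ?thesis by (intro that[of B] B(1)) auto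
qed

lemma DERIV_zero_of_quadratic_bound:
  fixes F :: "real \<Rightarrow> real"
  assumes b: "\<And>z. \<bar>z - a\<bar> \<le> 1 \<Longrightarrow> \<bar>F z - F a\<bar> \<le> M * (z - a)\<^sup>2"
  shows "(F has_real_derivative 0) (at a)"
  unfolding has_field_derivative_iff
proof (rule Lim_null_comparison)
  have "((\<lambda>z. M * \<bar>z - a\<bar>) \<longlongrightarrow> M * \<bar>a - a\<bar>) (at a)" by (intro tendsto_intros)
  then show "((\<lambda>z. M * \<bar>z - a\<bar>) \<longlongrightarrow> 0) (at a)" by simp
  have "\<forall>\<^sub>F z in at a. \<bar>z - a\<bar> < 1"
    by (auto simp: eventually_at dist_real_def intro!: exI[of _ 1])
  moreover have "\<forall>\<^sub>F z in at a. z \<noteq> a" by (auto simp: eventually_at_filter)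
  ultimately show "\<forall>\<^sub>F z in at a. norm ((F z - F a) / (z - a)) \<le> M * \<bar>z - a\<bar>"
  proof eventually_elim
    case (elim z)
    then have "\<bar>F z - F a\<bar> \<le> M * \<bar>z - a\<bar> * \<bar>z - a\<bar>"
      using b[of z] by (simp add: power2_eq_square mult.assoc abs_mult[symmetric])
    then show ?case using elim by (simp add: abs_divide divide_le_eq)
  qed
qed

text \<open>Formally the identity is an integration by parts with \<open>\<epsilon> w' = w - g\<close>. As \<open>g\<close> is only
  measurable, \<open>V\<close> is replaced by its tangent at one point: for affine \<open>V\<close> the identity
  is exact, and the error is quadratic in the distance from that point.\<close>

lemma expavg_flux_identity:
  fixes V V' U g :: "real \<Rightarrow> real"
  assumes eps: "\<epsilon> > 0" and g: "ess_bounded C g"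
    and dV: "\<And>x. (V has_real_derivative V' x) (at x)" and cV': "continuous_on UNIV V'"
    and dU: "\<And>x. (U has_real_derivative V' x * x) (at x)"
  defines "k \<equiv> expavg \<epsilon> g"
  shows "expavg \<epsilon> (\<lambda>y. V (k y) * g y) x = V (k x) * k x - U (k x) + expavg \<epsilon> (\<lambda>y. U (k y)) x"
proof -
  have kb: "\<bar>k x\<bar> \<le> C" for x unfolding k_def by (rule expavg_bound[OF eps g])
  have C0: "C \<ge> 0" using kb[of 0] by simp
  have klip: "\<bar>k x - k y\<bar> \<le> 2 * C / \<epsilon> * \<bar>x - y\<bar>" for x y unfolding k_def by (rule expavg_lipschitz[OF eps g])
  define Lk where "Lk = 2 * C / \<epsilon>"
  have Lk: "Lk \<ge> 0" using C0 eps by (simp add: Lk_def)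
  have ck: "continuous_on UNIV k"
    by (rule lipschitz_on_continuous_on[of Lk]) (rule lipschitz_onI[OF _ Lk], use klip in \<open>simp add: dist_real_def Lk_def\<close>)
  obtain LV where LV: "LV \<ge> 0" "\<And>x y. \<bar>x\<bar> \<le> C \<Longrightarrow> \<bar>y\<bar> \<le> C \<Longrightarrow> \<bar>V x - V y\<bar> \<le> LV * \<bar>x - y\<bar>"
    using C1_lipschitz[OF dV cV', of C] by blast
  have "continuous_on UNIV (\<lambda>x. V' x * x)" by (intro continuous_intros cV')
  from C1_lipschitz[OF dU this, of C]
  obtain LU where LU: "LU \<ge> 0" "\<And>x y. \<bar>x\<bar> \<le> C \<Longrightarrow> \<bar>y\<bar> \<le> C \<Longrightarrow> \<bar>U x - U y\<bar> \<le> LU * \<bar>x - y\<bar>"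
    by blast
  have cVU: "continuous_on UNIV V" "continuous_on UNIV U"
    using DERIV_isCont[OF dV] DERIV_isCont[OF dU] by (auto simp: continuous_on_eq_continuous_at)
  have cVk: "continuous_on UNIV (\<lambda>y. V (k y))" "continuous_on UNIV (\<lambda>y. U (k y))"
    by (rule continuous_on_compose2[OF cVU(1) ck] continuous_on_compose2[OF cVU(2) ck]; simp)+
  define BV where "BV = \<bar>V 0\<bar> + LV * C"
  define BU where "BU = \<bar>U 0\<bar> + LU * C"
  have VkB: "\<bar>V (k y)\<bar> \<le> BV" and UkB: "\<bar>U (k y)\<bar> \<le> BU" for y
  proof -
    have "\<bar>V (k y) - V 0\<bar> \<le> LV * \<bar>k y - 0\<bar>" "\<bar>U (k y) - U 0\<bar> \<le> LU * \<bar>k y - 0\<bar>"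
      using LV(2)[of "k y" 0] LU(2)[of "k y" 0] kb[of y] C0 by auto
    moreover have "LV * \<bar>k y - 0\<bar> \<le> LV * C" "LU * \<bar>k y - 0\<bar> \<le> LU * C"
      using kb[of y] LV(1) LU(1) by (auto intro: mult_left_mono)
    ultimately show "\<bar>V (k y)\<bar> \<le> BV" "\<bar>U (k y)\<bar> \<le> BU" unfolding BV_def BU_def by linarith+
  qed
  have eV: "ess_bounded BV (\<lambda>y. V (k y))" and eU: "ess_bounded BU (\<lambda>y. U (k y))"
    by (intro ess_bounded_continuous cVk VkB UkB)+
  note eVg = ess_bounded_mult[OF eV g]
  define S where "S = (\<lambda>a. V a * a - U a)"
  have dS: "(S has_real_derivative V x) (at x)" for x
    unfolding S_def by (auto intro!: derivative_eq_intros dV dU)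
  have S2: "\<bar>S b - S a - V a * (b - a)\<bar> \<le> LV * (b - a)\<^sup>2" if "\<bar>a\<bar> \<le> C" "\<bar>b\<bar> \<le> C" for a b
  proof -
    have seg: "\<bar>y\<bar> \<le> C \<and> \<bar>y - a\<bar> \<le> \<bar>b - a\<bar>" if "y \<in> closed_segment a b" for y
      using that \<open>\<bar>a\<bar> \<le> C\<close> \<open>\<bar>b\<bar> \<le> C\<close> by (auto simp: closed_segment_eq_real_ivl abs_if split: if_splits)
    have "norm ((S b - V a * b) - (S a - V a * a)) \<le> (LV * \<bar>b - a\<bar>) * norm (b - a)"
    proof (rule field_differentiable_bound[of "closed_segment a b" _ "\<lambda>y. V y - V a"])
      show "((\<lambda>y. S y - V a * y) has_field_derivative V y - V a) (at y within closed_segment a b)" for y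
        by (rule has_field_derivative_at_within) (auto intro!: derivative_eq_intros dS)
      fix y assume "y \<in> closed_segment a b"
      note y = seg[OF this]
      have "\<bar>V y - V a\<bar> \<le> LV * \<bar>y - a\<bar>" using y that(1) by (intro LV(2)) auto
      also have "\<dots> \<le> LV * \<bar>b - a\<bar>" using y LV(1) by (intro mult_left_mono) auto
      finally show "norm (V y - V a) \<le> LV * \<bar>b - a\<bar>" by simp
    qed auto
    moreover have "(S b - V a * b) - (S a - V a * a) = S b - S a - V a * (b - a)" by (simp add: algebra_simps)
    moreover have "(LV * \<bar>b - a\<bar>) * norm (b - a) = LV * (b - a)\<^sup>2"
      by (simp add: power2_eq_square mult.assoc abs_mult[symmetric])
    ultimately show ?thesis by (simp only: real_norm_def)
  qed
  define h where "h = (\<lambda>y. V (k y) * g y - U (k y))"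
  have eh: "ess_bounded (BV * C + BU) h" unfolding h_def by (rule ess_bounded_diff[OF eVg eU])
  define F where "F = (\<lambda>x. exp (- x / \<epsilon>) * (expavg \<epsilon> h x - S (k x)))"
  have dF: "(F has_real_derivative 0) (at a)" for a
  proof -
    let ?va = "V (k a)" and ?ua = "U (k a)"
    define ha where "ha = (\<lambda>y. h y - (?va * g y - ?ua))"
    have el: "ess_bounded (\<bar>?va\<bar> * C + \<bar>?ua\<bar>) (\<lambda>y. ?va * g y - ?ua)"
      by (intro ess_bounded_diff ess_bounded_mult g ess_bounded_const)
    have eha: "ess_bounded (BV * C + BU + (\<bar>?va\<bar> * C + \<bar>?ua\<bar>)) ha"
      unfolding ha_def by (rule ess_bounded_diff[OF eh el])
    have avg: "expavg \<epsilon> h x = expavg \<epsilon> ha x + ?va * k x - ?ua" for x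
      using expavg_diff[OF eps eh el, of x] expavg_diff[OF eps ess_bounded_mult[OF ess_bounded_const[of ?va] g] ess_bounded_const[of ?ua], of x]
      by (simp add: ha_def expavg_cmult[OF eps] expavg_const[OF eps] k_def)
    define D where "D = (LV * C + LU) * Lk"
    have D0: "D \<ge> 0" using LV(1) LU(1) C0 Lk by (simp add: D_def)
    let ?E = "exp ((1 - a) / \<epsilon>)"
    have E: "exp (- z / \<epsilon>) \<le> ?E" if "\<bar>z - a\<bar> \<le> 1" for z
    proof -
      have "- z / \<epsilon> \<le> (1 - a) / \<epsilon>" using that eps by (intro divide_right_mono) auto
      then show ?thesis by simp
    qed
    have inc: "\<bar>exp (- x / \<epsilon>) * expavg \<epsilon> ha x - exp (- z / \<epsilon>) * expavg \<epsilon> ha z\<bar> \<le> ?E * D / \<epsilon> * (z - x)\<^sup>2"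
      if "x \<le> z" "x = a \<or> z = a" "\<bar>x - z\<bar> \<le> 1" for x z
    proof -
      let ?h = "\<lambda>y. indicator {x..z} y * ha y"
      have "AE y in lebesgue. \<bar>g y\<bar> \<le> C" using g by (simp add: ess_bounded_def)
      then have "AE y in lebesgue. \<bar>?h y\<bar> \<le> D * (z - x)"
      proof eventually_elim
        case (elim y)
        show ?case
        proof (cases "y \<in> {x..z}")
          case True
          then have ya: "\<bar>y - a\<bar> \<le> z - x" using that by auto
          have kk: "\<bar>k y - k a\<bar> \<le> Lk * (z - x)"
            using klip[of y a] mult_left_mono[OF ya Lk] by (simp add: Lk_def)
          have "\<bar>(V (k y) - ?va) * g y\<bar> \<le> (LV * (Lk * (z - x))) * C"
            unfolding abs_mult using LV(2)[OF kb kb, of y a] mult_left_mono[OF kk LV(1)] elim LV(1) Lk that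
            by (intro mult_mono) auto
          moreover have "\<bar>U (k y) - ?ua\<bar> \<le> LU * (Lk * (z - x))"
            using LU(2)[OF kb kb, of y a] mult_left_mono[OF kk LU(1)] by simp
          moreover have "ha y = (V (k y) - ?va) * g y - (U (k y) - ?ua)"
            by (simp add: ha_def h_def algebra_simps)
          ultimately have "\<bar>ha y\<bar> \<le> (LV * (Lk * (z - x))) * C + LU * (Lk * (z - x))" by linarith
          then show ?thesis using True by (simp add: D_def algebra_simps)
        qed (use D0 that in auto)
      qed
      then have e: "ess_bounded (D * (z - x)) ?h"
        using eha by (auto simp: ess_bounded_def intro!: borel_measurable_times borel_measurable_indicator)
      have "(LINT y:{x..z}|lebesgue. exp (- y / \<epsilon>) * ha y) = (LINT y:{x..z}|lebesgue. exp (- y / \<epsilon>) * ?h y)"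
        by (rule set_lebesgue_integral_cong) auto
      then have "\<bar>LINT y:{x..z}|lebesgue. exp (- y / \<epsilon>) * ha y\<bar> \<le> D * (z - x) * exp (- x / \<epsilon>) * (z - x)"
        using set_integral_ess_bounded[OF eps e \<open>x \<le> z\<close>] by simp
      also have "\<dots> \<le> D * (z - x) * ?E * (z - x)"
        using E[of x] that D0 by (intro mult_right_mono mult_left_mono) auto
      finally have "\<bar>LINT y:{x..z}|lebesgue. exp (- y / \<epsilon>) * ha y\<bar> \<le> ?E * D * (z - x)\<^sup>2"
        by (simp add: power2_eq_square mult_ac)
      then have "(1 / \<epsilon>) * \<bar>LINT y:{x..z}|lebesgue. exp (- y / \<epsilon>) * ha y\<bar> \<le> (1 / \<epsilon>) * (?E * D * (z - x)\<^sup>2)"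
        using eps by (intro mult_left_mono) auto
      moreover have "\<bar>exp (- x / \<epsilon>) * expavg \<epsilon> ha x - exp (- z / \<epsilon>) * expavg \<epsilon> ha z\<bar> =
         (1 / \<epsilon>) * \<bar>LINT y:{x..z}|lebesgue. exp (- y / \<epsilon>) * ha y\<bar>"
        using expavg_increment(2)[OF eps eha \<open>x \<le> z\<close>] eps by (simp add: abs_mult)
      ultimately show ?thesis by simp
    qed
    show ?thesis
    proof (rule DERIV_zero_of_quadratic_bound)
      fix z assume z: "\<bar>z - a\<bar> \<le> 1"
      let ?G = "\<lambda>z. exp (- z / \<epsilon>) * expavg \<epsilon> ha z"
      let ?P = "S (k z) - S (k a) - ?va * (k z - k a)"
      have "F z - F a = ?G z - ?G a - exp (- z / \<epsilon>) * ?P"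
        unfolding F_def avg by (simp add: S_def algebra_simps)
      moreover have "\<bar>?G z - ?G a\<bar> \<le> ?E * D / \<epsilon> * (z - a)\<^sup>2"
        using inc[of a z] inc[of z a] z by (cases "a \<le> z") (auto simp: abs_minus_commute power2_commute)
      moreover have "\<bar>exp (- z / \<epsilon>) * ?P\<bar> \<le> ?E * (LV * Lk\<^sup>2 * (z - a)\<^sup>2)"
      proof -
        have "(k z - k a)\<^sup>2 \<le> (Lk * \<bar>z - a\<bar>)\<^sup>2"
          using klip[of z a] Lk by (intro power2_le_iff_abs_le[THEN iffD2]) (auto simp: Lk_def)
        then have "LV * (k z - k a)\<^sup>2 \<le> LV * (Lk\<^sup>2 * (z - a)\<^sup>2)"
          using LV(1) by (intro mult_left_mono) (simp_all add: power_mult_distrib)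
        then have "\<bar>?P\<bar> \<le> LV * Lk\<^sup>2 * (z - a)\<^sup>2"
          using S2[OF kb[of a] kb[of z]] by linarith
        from mult_mono[OF E[OF z] this] show ?thesis by (simp add: abs_mult)
      qed
      ultimately show "\<bar>F z - F a\<bar> \<le> (?E * D / \<epsilon> + ?E * LV * Lk\<^sup>2) * (z - a)\<^sup>2"
        by (simp add: distrib_right mult.assoc)
    qed
  qed
  have Fconst: "F x = F y" for x y using DERIV_isconst_all dF by blast
  have "F x = 0"
  proof -
    have Sb: "\<bar>S (k y)\<bar> \<le> BV * C + BU" for y
      unfolding S_def using VkB[of y] UkB[of y] kb[of y]
      by (intro order_trans[OF abs_triangle_ineq4] add_mono) (auto simp: abs_mult intro!: mult_mono order_trans[OF abs_ge_zero VkB])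
    have "((\<lambda>y. 2 * (BV * C + BU) * exp (- y / \<epsilon>)) \<longlongrightarrow> 0) at_top" using eps by real_asymp
    moreover have "norm (F y) \<le> 2 * (BV * C + BU) * exp (- y / \<epsilon>)" for y
      using Sb[of y] expavg_bound[OF eps eh, of y]
      by (auto simp: F_def abs_mult mult.commute intro!: mult_right_mono)
    ultimately have "(F \<longlongrightarrow> 0) at_top" by (intro Lim_null_comparison[of F]) auto
    moreover have "F = (\<lambda>_. F x)" using Fconst by blast
    ultimately show ?thesis using tendsto_unique[OF trivial_limit_at_top_linorder _ tendsto_const] by metis
  qed
  then have "expavg \<epsilon> h x = S (k x)" by (simp add: F_def)
  then show ?thesis
    using expavg_diff[OF eps eVg eU, of x] by (simp add: h_def S_def algebra_simps)
qed

section \<open>Evolution of the average along characteristics\<close>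

text \<open>A smooth test function that tends to the kernel of the average as \<open>n\<close> grows: the jump at
  \<open>x\<close> is smoothed at scale \<open>1 / n\<close> and the tail is cut off beyond \<open>n\<close>. Away from the tail it
  depends on \<open>x - y\<close> only, so its two partial derivatives almost cancel.\<close>

definition cut_kernel :: "real \<Rightarrow> real \<Rightarrow> real \<Rightarrow> real \<Rightarrow> real" where
  "cut_kernel \<epsilon> n x y = exp ((x - y) / \<epsilon>) * step (n * (y - x)) * (1 - step (1 * (y - n)))"

definition cut_kernel_dx :: "real \<Rightarrow> real \<Rightarrow> real \<Rightarrow> real \<Rightarrow> real" where
  "cut_kernel_dx \<epsilon> n x y =
     exp ((x - y) / \<epsilon>) * (1 - step (1 * (y - n))) * (step (n * (y - x)) / \<epsilon> - sbump n x y)"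

definition cut_kernel_dy :: "real \<Rightarrow> real \<Rightarrow> real \<Rightarrow> real \<Rightarrow> real" where
  "cut_kernel_dy \<epsilon> n x y =
     - cut_kernel_dx \<epsilon> n x y - exp ((x - y) / \<epsilon>) * step (n * (y - x)) * sbump 1 n y"

lemma cut_kernel_DERIV_y:
  assumes "\<epsilon> > 0"
  shows "(cut_kernel \<epsilon> n x has_real_derivative cut_kernel_dy \<epsilon> n x y) (at y)"
proof -
  have e: "((\<lambda>y. exp ((x - y) / \<epsilon>)) has_real_derivative - exp ((x - y) / \<epsilon>) / \<epsilon>) (at y)"
    using assms by (auto intro!: derivative_eq_intros)
  have r: "((\<lambda>y. 1 - step (1 * (y - n))) has_real_derivative 0 - sbump 1 n y) (at y)"
    by (intro derivative_intros step_affine_DERIV)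
  show ?thesis
    unfolding cut_kernel_def
    by (rule DERIV_cong[OF DERIV_mult[OF DERIV_mult[OF e step_affine_DERIV] r]])
       (simp add: cut_kernel_dy_def cut_kernel_dx_def diff_divide_distrib algebra_simps)
qed

lemma cut_kernel_DERIV_x:
  assumes "\<epsilon> > 0"
  shows "((\<lambda>x. cut_kernel \<epsilon> n x y) has_real_derivative cut_kernel_dx \<epsilon> n x y) (at x)"
proof -
  have "((\<lambda>x. n * (y - x)) has_real_derivative - n) (at x)" by (auto intro!: derivative_eq_intros)
  from DERIV_chain2[OF step_bump(3) this]
  have "((\<lambda>x. step (n * (y - x))) has_real_derivative - sbump n x y) (at x)"
    by (simp add: sbump_def mult.commute)
  then show ?thesis
    unfolding cut_kernel_def cut_kernel_dx_def using assms
    by (auto intro!: derivative_eq_intros simp: field_simps)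
qed

lemma cut_kernel_zero:
  assumes "n > 0" "y \<notin> {x..n + 1}"
  shows "cut_kernel \<epsilon> n x y = 0" "cut_kernel_dx \<epsilon> n x y = 0" "cut_kernel_dy \<epsilon> n x y = 0"
proof -
  have "step (n * (y - x)) = 0 \<and> sbump n x y = 0 \<or> step (1 * (y - n)) = 1 \<and> sbump 1 n y = 0"
  proof (cases "y < x")
    case True
    then show ?thesis using assms by (intro disjI1 conjI step_bump sbump_eq_0) (auto simp: mult_le_0_iff)
  next
    case False
    then show ?thesis using assms by (intro disjI2 conjI step_bump sbump_eq_0) auto
  qed
  then show "cut_kernel \<epsilon> n x y = 0" "cut_kernel_dx \<epsilon> n x y = 0" "cut_kernel_dy \<epsilon> n x y = 0"
    by (auto simp: cut_kernel_def cut_kernel_dx_def cut_kernel_dy_def)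
qed

lemma cut_kernel_test:
  assumes "n > 0" shows "cut_kernel \<epsilon> n x \<in> Cc_infinity UNIV"
proof (rule Cc_infinityI)
  have "smooth (\<lambda>y. exp ((- 1 / \<epsilon>) * y + x / \<epsilon>))" by (rule smooth_affine_real[OF smooth_exp])
  then have "smooth (\<lambda>y. exp ((x - y) / \<epsilon>))" by (simp add: diff_divide_distrib)
  then show "smooth (cut_kernel \<epsilon> n x)"
    unfolding cut_kernel_def by (intro smooth_mult smooth_diff smooth_const smooth_step_affine)
  show "cut_kernel \<epsilon> n x y = 0" if "y \<notin> {x..n + 1}" for y by (rule cut_kernel_zero[OF assms that])
qed auto

lemma cut_kernel_continuous:
  assumes "\<epsilon> > 0"
  shows "continuous_on UNIV (cut_kernel \<epsilon> n x)" "continuous_on UNIV (cut_kernel_dx \<epsilon> n x)"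
    "continuous_on UNIV (cut_kernel_dy \<epsilon> n x)" "continuous_on UNIV (\<lambda>x. cut_kernel_dx \<epsilon> n x y)"
    "continuous_on UNIV (\<lambda>x. cut_kernel_dy \<epsilon> n x y)"
  unfolding cut_kernel_def cut_kernel_dx_def cut_kernel_dy_def sbump_def using assms
  by (auto intro!: continuous_intros continuous_on_compose2[OF continuous_step[of UNIV]]
      continuous_on_compose2[OF continuous_bump[of UNIV]])

lemma cut_kernel_bounds:
  assumes "\<epsilon> > 0" "n > 0" and B: "\<And>x. bump x \<le> B"
  shows "\<bar>cut_kernel_dx \<epsilon> n x y\<bar> \<le> 1 / \<epsilon> + n * B"
    "\<bar>cut_kernel_dy \<epsilon> n x y\<bar> \<le> 1 / \<epsilon> + n * B + B"
proof -
  have B0: "B \<ge> 0" using B[of 0] step_bump(4)[of 0] by simp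
  let ?e = "exp ((x - y) / \<epsilon>)" and ?s = "step (n * (y - x))" and ?r = "1 - step (1 * (y - n))"
  have s: "0 \<le> ?s" "?s \<le> 1" "0 \<le> ?r" "?r \<le> 1" using step_bounds by auto
  have sb: "0 \<le> sbump n x y" "sbump n x y \<le> n * B" "0 \<le> sbump 1 n y" "sbump 1 n y \<le> B"
    using assms step_bump(4) by (auto simp: sbump_def intro: mult_left_mono)
  have "\<bar>cut_kernel_dx \<epsilon> n x y\<bar> \<le> 1 / \<epsilon> + n * B \<and>
    \<bar>?e * ?s * sbump 1 n y\<bar> \<le> B"
  proof (cases "y < x")
    case True
    then have z: "y \<notin> {x..n + 1}" by simp
    have "?s = 0" using True assms by (intro step_bump) (auto simp: mult_le_0_iff)
    then show ?thesis using cut_kernel_zero[OF assms(2) z] B0 assms by simp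
  next
    case False
    then have e: "0 \<le> ?e" "?e \<le> 1" using assms by (auto simp: divide_nonpos_pos)
    have "\<bar>?s / \<epsilon> - sbump n x y\<bar> \<le> 1 / \<epsilon> + n * B"
    proof -
      have "?s / \<epsilon> \<le> 1 / \<epsilon>" "0 \<le> ?s / \<epsilon>" using s assms by (auto simp: divide_right_mono)
      then show ?thesis using sb by linarith
    qed
    then have "(?e * ?r) * \<bar>?s / \<epsilon> - sbump n x y\<bar> \<le> 1 * (1 / \<epsilon> + n * B)"
      using e s by (intro mult_mono mult_le_one) auto
    moreover have "(?e * ?s) * sbump 1 n y \<le> 1 * B" using e s sb by (intro mult_mono mult_le_one) auto
    ultimately show ?thesis using e s sb
      by (simp add: cut_kernel_dx_def abs_mult)
  qed
  then show "\<bar>cut_kernel_dx \<epsilon> n x y\<bar> \<le> 1 / \<epsilon> + n * B"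
    "\<bar>cut_kernel_dy \<epsilon> n x y\<bar> \<le> 1 / \<epsilon> + n * B + B"
    unfolding cut_kernel_dy_def by linarith+
qed

text \<open>The smoothed kernel differs from the exact one only on the strip where the step rises and
  beyond the cut-off.\<close>

lemma cut_kernel_error:
  assumes "\<epsilon> > 0" "n > 0" "x \<le> n"
  shows "\<bar>exp ((x - y) / \<epsilon>) * step (n * (y - x)) * (1 - step (1 * (y - n))) - ekernel \<epsilon> x y\<bar>
      \<le> indicator {x..x + 1 / n} y + indicator {n<..} y * exp ((x - y) / \<epsilon>)"
proof -
  let ?e = "exp ((x - y) / \<epsilon>)" and ?s = "step (n * (y - x))" and ?r = "1 - step (1 * (y - n))"
  have s: "0 \<le> ?s" "?s \<le> 1" "0 \<le> ?r" "?r \<le> 1" using step_bounds by auto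
  consider "y \<le> x" | "x < y" "y \<le> x + 1 / n" | "x + 1 / n < y" "x < y" using assms by fastforce
  then show ?thesis
  proof cases
    case 1
    then have "?s = 0" using assms by (intro step_bump) (auto simp: mult_le_0_iff)
    then show ?thesis using 1 by (simp add: ekernel_def)
  next
    case 2
    then have "?e \<le> 1" using assms by (auto simp: divide_nonpos_pos)
    moreover have "\<bar>?s * ?r - 1\<bar> \<le> 1" using mult_le_one[of ?s ?r] mult_nonneg_nonneg[of ?s ?r] s by auto
    ultimately have "?e * \<bar>?s * ?r - 1\<bar> \<le> 1" by (intro mult_le_one) auto
    moreover have "?e * ?s * ?r - ekernel \<epsilon> x y = ?e * (?s * ?r - 1)"
      using 2 by (simp add: ekernel_def right_diff_distrib)
    ultimately have "\<bar>?e * ?s * ?r - ekernel \<epsilon> x y\<bar> \<le> 1" by (simp add: abs_mult)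
    then show ?thesis using 2 by (simp add: indicator_def add_increasing2)
  next
    case 3
    then have "?s = 1" using assms by (intro step_bump) (auto simp: field_simps)
    moreover have "step (1 * (y - n)) = 0" if "y \<le> n" using that by (intro step_bump) auto
    ultimately show ?thesis using 3 s step_bounds(2)[of "y - n"]
      by (cases "y \<le> n") (auto simp: ekernel_def right_diff_distrib abs_mult mult_left_le)
  qed
qed

lemma error_kernel_integral:
  assumes eps: "\<epsilon> > 0" and n: "n > 0" "x \<le> n" and g: "ess_bounded C g"
    and k: "integrable lebesgue k"
      "\<And>y. \<bar>k y\<bar> \<le> c1 * indicator {x..x + 1 / n} y + c2 * (indicator {n<..} y * exp ((x - y) / \<epsilon>))"
  shows "\<bar>LINT y|lebesgue. k y * g y\<bar> \<le> C * (c1 / n + c2 * \<epsilon> * exp ((x - n) / \<epsilon>))"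
proof -
  note i = integrable_indicator_Icc[of x "x + 1 / n"]
  note t = ekernel_tail[OF eps n(2)]
  have "\<bar>LINT y|lebesgue. k y * g y\<bar> \<le> C * (LINT y|lebesgue. c1 * indicator {x..x + 1 / n} y + c2 * (indicator {n<..} y * exp ((x - y) / \<epsilon>)))"
    by (rule ess_bounded_integral_bound[OF g k]) (use i t in auto)
  also have "(LINT y|lebesgue. c1 * indicator {x..x + 1 / n} y + c2 * (indicator {n<..} y * exp ((x - y) / \<epsilon>)))
     = c1 * (1 / n) + c2 * (\<epsilon> * exp ((x - n) / \<epsilon>))"
    using i t n by (subst Bochner_Integration.integral_add) auto
  finally show ?thesis by (simp add: mult.assoc)
qed

lemma DERIV_sequentiallyI:
  fixes f :: "real \<Rightarrow> real"
  assumes "\<And>s. (\<And>n. s n \<in> S) \<Longrightarrow> (\<And>n. s n \<noteq> x) \<Longrightarrow> s \<longlonglongrightarrow> x \<Longrightarrow> (\<lambda>n. (f (s n) - f x) / (s n - x)) \<longlonglongrightarrow> D"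
  shows "(f has_real_derivative D) (at x within S)"
  unfolding has_field_derivative_iff tendsto_at_iff_sequentially
  using assms by (auto simp: o_def)

lemma DERIV_sequentiallyD:
  fixes f :: "real \<Rightarrow> real"
  assumes "(f has_real_derivative D) (at x within S)" "\<And>n. s n \<in> S" "\<And>n. s n \<noteq> x" "s \<longlonglongrightarrow> x"
  shows "(\<lambda>n. (f (s n) - f x) / (s n - x)) \<longlonglongrightarrow> D"
  using assms unfolding has_field_derivative_iff tendsto_at_iff_sequentially
  by (auto simp: o_def)

text \<open>Joint continuity is only required of the space derivative, which the mean value theorem moves
  to an intermediate point.\<close>

lemma curve_chain_rule:
  fixes A Ax :: "real \<Rightarrow> real \<Rightarrow> real"
  assumes t: "t \<in> I"
    and At: "((\<lambda>s. A s (X t)) has_real_derivative a) (at t within I)"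
    and Ax: "\<And>s x. s \<in> I \<Longrightarrow> (A s has_real_derivative Ax s x) (at x)"
    and X: "(X has_real_derivative v) (at t within I)"
    and cont: "\<And>s x. (\<And>n. s n \<in> I) \<Longrightarrow> s \<longlonglongrightarrow> t \<Longrightarrow> x \<longlonglongrightarrow> X t \<Longrightarrow> (\<lambda>n. Ax (s n) (x n)) \<longlonglongrightarrow> Ax t (X t)"
  shows "((\<lambda>s. A s (X s)) has_real_derivative a + Ax t (X t) * v) (at t within I)"
proof (rule DERIV_sequentiallyI)
  fix s assume s: "\<And>n. s n \<in> I" "\<And>n. s n \<noteq> t" "s \<longlonglongrightarrow> t"
  have "isCont (A r) x" if "r \<in> I" for r x using DERIV_isCont[OF Ax[OF that]] .
  have "\<exists>\<xi>. \<bar>\<xi> - X t\<bar> \<le> \<bar>X (s n) - X t\<bar> \<and> A (s n) (X (s n)) - A (s n) (X t) = Ax (s n) \<xi> * (X (s n) - X t)" for n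
  proof (cases "X (s n)" "X t" rule: linorder_cases)
    case less
    from MVT2[OF this, of "A (s n)" "Ax (s n)"] Ax[OF s(1)] obtain z where
      "X (s n) < z" "z < X t" "A (s n) (X t) - A (s n) (X (s n)) = (X t - X (s n)) * Ax (s n) z" by blast
    then show ?thesis by (intro exI[of _ z]) (auto simp: algebra_simps)
  next
    case greater
    from MVT2[OF this, of "A (s n)" "Ax (s n)"] Ax[OF s(1)] obtain z where
      "X t < z" "z < X (s n)" "A (s n) (X (s n)) - A (s n) (X t) = (X (s n) - X t) * Ax (s n) z" by blast
    then show ?thesis by (intro exI[of _ z]) (auto simp: algebra_simps)
  qed auto
  then obtain \<xi> where xi: "\<And>n. \<bar>\<xi> n - X t\<bar> \<le> \<bar>X (s n) - X t\<bar>"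
    "\<And>n. A (s n) (X (s n)) - A (s n) (X t) = Ax (s n) (\<xi> n) * (X (s n) - X t)" by metis
  have "(\<lambda>n. X (s n)) \<longlonglongrightarrow> X t"
    using continuous_within_tendsto_compose'[OF DERIV_continuous[OF X], of s sequentially] s by blast
  then have "(\<lambda>n. \<bar>X (s n) - X t\<bar>) \<longlonglongrightarrow> 0" by (simp add: LIM_zero tendsto_rabs_zero)
  then have "(\<lambda>n. \<xi> n - X t) \<longlonglongrightarrow> 0" by (rule Lim_null_comparison[rotated]) (use xi(1) in auto)
  then have xil: "\<xi> \<longlonglongrightarrow> X t" by (rule LIM_zero_cancel)
  have "(\<lambda>n. (A (s n) (X t) - A t (X t)) / (s n - t) + Ax (s n) (\<xi> n) * ((X (s n) - X t) / (s n - t)))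
      \<longlonglongrightarrow> a + Ax t (X t) * v"
    by (intro tendsto_intros cont s xil DERIV_sequentiallyD[OF At] DERIV_sequentiallyD[OF X])
  moreover have "(A (s n) (X (s n)) - A t (X t)) / (s n - t) =
    (A (s n) (X t) - A t (X t)) / (s n - t) + Ax (s n) (\<xi> n) * ((X (s n) - X t) / (s n - t))" for n
  proof -
    have "A (s n) (X (s n)) - A t (X t) = (A (s n) (X t) - A t (X t)) + Ax (s n) (\<xi> n) * (X (s n) - X t)"
      using xi(2)[of n] by simp
    then show ?thesis by (simp only: add_divide_distrib times_divide_eq_right)
  qed
  ultimately show "(\<lambda>n. (A (s n) (X (s n)) - A t (X t)) / (s n - t)) \<longlonglongrightarrow> a + Ax t (X t) * v" by simp
qed

lemma convergent_sequence_bound: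
  fixes x :: "nat \<Rightarrow> real" assumes "x \<longlonglongrightarrow> x'"
  obtains M where "\<And>n. - M \<le> x n" "- M \<le> x'"
proof -
  have "Bseq x" using convergentI[OF assms] by (rule convergent_imp_Bseq)
  then obtain K where K: "\<And>n. \<bar>x n\<bar> \<le> K" by (auto simp: Bseq_def)
  have "- max K (- x') \<le> x n" for n using K[of n] by linarith
  moreover have "- max K (- x') \<le> x'" by linarith
  ultimately show ?thesis by (rule that)
qed

text \<open>\<open>U\<close> is an antiderivative of \<open>\<xi> V'(\<xi>)\<close>; with it the equation for the average closes.\<close>

locale nonlocal_solution_C1 = nonlocal_solution +
  fixes V' U :: "real \<Rightarrow> real"
  assumes V_DERIV: "(V has_real_derivative V' x) (at x)"
    and V'_cont: "continuous_on UNIV V'"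
    and U_DERIV: "(U has_real_derivative V' x * x) (at x)"
begin

text \<open>The nonlocal right-hand side of the transport equation for the average.\<close>

definition drift :: "real \<Rightarrow> real \<Rightarrow> real" where
  "drift t x = (U (w t x) - expavg \<epsilon> (\<lambda>y. U (w t y)) x) / \<epsilon>"

lemma U_cont: "continuous_on UNIV U"
  using DERIV_isCont[OF U_DERIV] by (simp add: continuous_on_eq_continuous_at)

lemma velocity_lipschitz:
  obtains L where "L \<ge> 0" "\<And>t x y. t \<in> {0..T} \<Longrightarrow> \<bar>V (w t x) - V (w t y)\<bar> \<le> L * \<bar>x - y\<bar>"
proof -
  obtain L where L: "L \<ge> 0" "\<And>x y. \<bar>x\<bar> \<le> C \<Longrightarrow> \<bar>y\<bar> \<le> C \<Longrightarrow> \<bar>V x - V y\<bar> \<le> L * \<bar>x - y\<bar>"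
    using C1_lipschitz[OF V_DERIV V'_cont, of C] by blast
  show ?thesis
  proof (rule that)
    show "L * (2 * C / \<epsilon>) \<ge> 0" using L(1) C_nonneg eps by simp
    fix t x y assume t: "t \<in> {0..T}"
    have "\<bar>V (w t x) - V (w t y)\<bar> \<le> L * \<bar>w t x - w t y\<bar>" by (intro L(2) w_bound t)
    also have "\<dots> \<le> L * (2 * C / \<epsilon> * \<bar>x - y\<bar>)" by (intro mult_left_mono w_lipschitz t L(1))
    finally show "\<bar>V (w t x) - V (w t y)\<bar> \<le> L * (2 * C / \<epsilon>) * \<bar>x - y\<bar>" by (simp add: mult.assoc)
  qed
qed

lemma Uw_continuous: "t \<in> {0..T} \<Longrightarrow> continuous_on A (\<lambda>x. U (w t x))"
  by (rule continuous_on_compose2[OF U_cont w_continuous]) auto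

lemma drift_tendsto:
  assumes "s \<in> {0..T}" "\<And>n. t n \<in> {0..T}" "t \<longlonglongrightarrow> s" "x \<longlonglongrightarrow> x'"
  shows "(\<lambda>n. drift (t n) (x n)) \<longlonglongrightarrow> drift s x'"
proof -
  obtain B where B: "B \<ge> 0" "\<And>t x. t \<in> {0..T} \<Longrightarrow> \<bar>U (w t x)\<bar> \<le> B" using compose_w_bounded[OF U_cont] by blast
  have e: "ess_bounded B (\<lambda>y. U (w t y))" if "t \<in> {0..T}" for t
    using that by (intro ess_bounded_continuous Uw_continuous B)
  have Ul: "(\<lambda>n. U (w (t n) (x n))) \<longlonglongrightarrow> U (w s x')" if "x \<longlonglongrightarrow> x'" for x x'
    using U_cont by (intro isCont_tendsto_compose[of _ U] w_tendsto assms that) (auto simp: continuous_on_eq_continuous_at)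
  have 1: "(\<lambda>n. expavg \<epsilon> (\<lambda>y. U (w (t n) y)) x') \<longlonglongrightarrow> expavg \<epsilon> (\<lambda>y. U (w s y)) x'"
    using e[OF assms(1)] by (intro expavg_tendsto[OF eps e] Ul assms tendsto_const) (auto simp: ess_bounded_def)
  have "(\<lambda>n. expavg \<epsilon> (\<lambda>y. U (w (t n) y)) (x n) - expavg \<epsilon> (\<lambda>y. U (w (t n) y)) x') \<longlonglongrightarrow> 0"
  proof (rule Lim_null_comparison)
    have "(\<lambda>n. 2 * B / \<epsilon> * \<bar>x n - x'\<bar>) \<longlonglongrightarrow> 2 * B / \<epsilon> * \<bar>x' - x'\<bar>" by (intro tendsto_intros assms)
    then show "(\<lambda>n. 2 * B / \<epsilon> * \<bar>x n - x'\<bar>) \<longlonglongrightarrow> 0" by simp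
  qed (use expavg_lipschitz[OF eps e[OF assms(2)]] in auto)
  from tendsto_add[OF 1 this] have "(\<lambda>n. expavg \<epsilon> (\<lambda>y. U (w (t n) y)) (x n)) \<longlonglongrightarrow> expavg \<epsilon> (\<lambda>y. U (w s y)) x'" by simp
  then show ?thesis unfolding drift_def by (intro tendsto_intros Ul assms) (use eps in auto)
qed

text \<open>In this form the drift is what remains when the kernel is differentiated along the velocity
  \<open>V (w t x)\<close> while mass at \<open>y\<close> moves with velocity \<open>V (w t y)\<close>.\<close>

lemma drift_eq:
  assumes "t \<in> {0..T}"
  shows "\<epsilon> * drift t x = (1 / \<epsilon>) * (LINT y|lebesgue. (ekernel \<epsilon> x y * (V (w t x) - V (w t y))) * \<rho> t y)"
proof -
  obtain B where B: "B \<ge> 0" "\<And>t x. t \<in> {0..T} \<Longrightarrow> \<bar>V (w t x)\<bar> \<le> B" using compose_w_bounded[OF V_cont] by blast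
  have eV: "ess_bounded B (\<lambda>y. V (w t y))"
    using assms by (intro ess_bounded_continuous Vw_continuous B)
  have "expavg \<epsilon> (\<lambda>y. V (w t y) * \<rho> t y) x = V (w t x) * w t x - U (w t x) + expavg \<epsilon> (\<lambda>y. U (w t y)) x"
    by (rule expavg_flux_identity[OF eps \<rho>_bound[OF assms] V_DERIV V'_cont U_DERIV])
  then have "\<epsilon> * drift t x = V (w t x) * w t x - expavg \<epsilon> (\<lambda>y. V (w t y) * \<rho> t y) x"
    using eps by (simp add: drift_def)
  also have "\<dots> = (1 / \<epsilon>) * (V (w t x) * (LINT y|lebesgue. ekernel \<epsilon> x y * \<rho> t y) - (LINT y|lebesgue. ekernel \<epsilon> x y * (V (w t y) * \<rho> t y)))"
    by (simp add: expavg_def algebra_simps)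
  also have "\<dots> = (1 / \<epsilon>) * (LINT y|lebesgue. V (w t x) * (ekernel \<epsilon> x y * \<rho> t y) - ekernel \<epsilon> x y * (V (w t y) * \<rho> t y))"
    using expavg_integrable[OF eps \<rho>_bound[OF assms], of x] expavg_integrable[OF eps ess_bounded_mult[OF eV \<rho>_bound[OF assms]], of x]
    by simp
  also have "(\<lambda>y. V (w t x) * (ekernel \<epsilon> x y * \<rho> t y) - ekernel \<epsilon> x y * (V (w t y) * \<rho> t y)) =
     (\<lambda>y. (ekernel \<epsilon> x y * (V (w t x) - V (w t y))) * \<rho> t y)" by (auto simp: algebra_simps)
  finally show ?thesis .
qed

definition cut_avg :: "real \<Rightarrow> real \<Rightarrow> real \<Rightarrow> real" where
  "cut_avg n t x = (LINT y|lebesgue. cut_kernel \<epsilon> n x y * \<rho> t y)"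

definition cut_avg_dx :: "real \<Rightarrow> real \<Rightarrow> real \<Rightarrow> real" where
  "cut_avg_dx n t x = (LINT y|lebesgue. cut_kernel_dx \<epsilon> n x y * \<rho> t y)"

definition cut_avg_dt :: "real \<Rightarrow> real \<Rightarrow> real \<Rightarrow> real" where
  "cut_avg_dt n t x = (LINT y|lebesgue. (V (w t y) * cut_kernel_dy \<epsilon> n x y) * \<rho> t y)"

lemma cut_avg_DERIV_x:
  assumes n: "n > 0" and t: "t \<in> {0..T}"
  shows "(cut_avg n t has_real_derivative cut_avg_dx n t x) (at x)"
proof (rule DERIV_sequentiallyI)
  fix s assume s: "\<And>m. s m \<noteq> x" "s \<longlonglongrightarrow> x"
  obtain B where B: "B > 0" "\<And>x. bump x \<le> B" using bump_bounded by blast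
  let ?D = "1 / \<epsilon> + n * B"
  obtain M where M: "\<And>m. - M \<le> s m" "- M \<le> x" using convergent_sequence_bound[OF s(2)] by blast
  let ?q = "\<lambda>m y. (cut_kernel \<epsilon> n (s m) y - cut_kernel \<epsilon> n x y) / (s m - x)"
  have q: "\<bar>?q m y\<bar> \<le> ?D * indicator {- M..n + 1} y" for m y
  proof (cases "y \<in> {- M..n + 1}")
    case True
    have "norm (cut_kernel \<epsilon> n (s m) y - cut_kernel \<epsilon> n x y) \<le> ?D * norm (s m - x)"
      by (rule field_differentiable_bound[of UNIV "\<lambda>x. cut_kernel \<epsilon> n x y" "\<lambda>x. cut_kernel_dx \<epsilon> n x y"])
         (use cut_kernel_DERIV_x[OF eps] cut_kernel_bounds[OF eps n B(2)] in auto)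
    then show ?thesis using True s(1)[of m] by (simp add: abs_divide divide_le_eq)
  next
    case False
    then have "y \<notin> {s m..n + 1}" "y \<notin> {x..n + 1}" using M(1)[of m] M(2) by auto
    then show ?thesis using False cut_kernel_zero[OF n] by simp
  qed
  have "(\<lambda>m. LINT y|lebesgue. ?q m y * \<rho> t y) \<longlonglongrightarrow> (LINT y|lebesgue. cut_kernel_dx \<epsilon> n x y * \<rho> t y)"
  proof (rule flux_integral_tendsto(1)[OF t _ tendsto_const _ q])
    show "t \<in> {0..T}" by (rule t)
    show "continuous_on UNIV (?q m)" for m
      by (intro continuous_intros cut_kernel_continuous eps) (use s in auto)
    show "(\<lambda>m. ?q m y) \<longlonglongrightarrow> cut_kernel_dx \<epsilon> n x y" for y
      using DERIV_sequentiallyD[OF cut_kernel_DERIV_x[OF eps], of s x n y] s by auto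
  qed
  moreover have "(LINT y|lebesgue. ?q m y * \<rho> t y) = (cut_avg n t (s m) - cut_avg n t x) / (s m - x)" for m
  proof -
    have i: "integrable lebesgue (\<lambda>y. cut_kernel \<epsilon> n z y * \<rho> t y)" for z
      by (rule ess_bounded_integrable[OF \<rho>_bound[OF t]], rule lebesgue_integral_compact_support(1)[OF cut_kernel_continuous(1)[OF eps]])
         (rule cut_kernel_zero[OF n])
    have "(\<lambda>y. ?q m y * \<rho> t y) = (\<lambda>y. (cut_kernel \<epsilon> n (s m) y * \<rho> t y - cut_kernel \<epsilon> n x y * \<rho> t y) / (s m - x))"
      by (auto simp: field_simps fun_eq_iff)
    then show ?thesis using i unfolding cut_avg_def
      by (simp only: integral_divide_zero Bochner_Integration.integral_diff)
  qed
  ultimately show "(\<lambda>m. (cut_avg n t (s m) - cut_avg n t x) / (s m - x)) \<longlonglongrightarrow> cut_avg_dx n t x"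
    unfolding cut_avg_dx_def by (simp only:)
qed

lemma cut_avg_tendsto:
  assumes n: "n > 0" and s: "s \<in> {0..T}" "\<And>m. t m \<in> {0..T}" "t \<longlonglongrightarrow> s" and x: "x \<longlonglongrightarrow> x'"
  shows "(\<lambda>m. cut_avg_dx n (t m) (x m)) \<longlonglongrightarrow> cut_avg_dx n s x'"
    "(\<lambda>m. cut_avg_dt n (t m) (x m)) \<longlonglongrightarrow> cut_avg_dt n s x'"
proof -
  obtain B where B: "B > 0" "\<And>x. bump x \<le> B" using bump_bounded by blast
  obtain M where M: "\<And>m. - M \<le> x m" "- M \<le> x'" using convergent_sequence_bound[OF x] by blast
  have z: "y \<notin> {x m..n + 1}" if "y \<notin> {- M..n + 1}" for m y using that M(1)[of m] by auto
  have bx: "\<bar>cut_kernel_dx \<epsilon> n (x m) y\<bar> \<le> (1 / \<epsilon> + n * B) * indicator {- M..n + 1} y" for m y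
    using cut_kernel_bounds(1)[OF eps n B(2), of "x m" y] cut_kernel_zero(2)[OF n z] by (auto simp: indicator_def)
  have bdy: "\<bar>cut_kernel_dy \<epsilon> n (x m) y\<bar> \<le> (1 / \<epsilon> + n * B + B) * indicator {- M..n + 1} y" for m y
    using cut_kernel_bounds(2)[OF eps n B(2), of "x m" y] cut_kernel_zero(3)[OF n z] by (auto simp: indicator_def)
  have l: "(\<lambda>m. cut_kernel_dx \<epsilon> n (x m) y) \<longlonglongrightarrow> cut_kernel_dx \<epsilon> n x' y"
    "(\<lambda>m. cut_kernel_dy \<epsilon> n (x m) y) \<longlonglongrightarrow> cut_kernel_dy \<epsilon> n x' y" for y
    by (rule continuous_on_tendsto_compose[OF cut_kernel_continuous(4)[OF eps] x]; simp)
       (rule continuous_on_tendsto_compose[OF cut_kernel_continuous(5)[OF eps] x]; simp)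
  show "(\<lambda>m. cut_avg_dx n (t m) (x m)) \<longlonglongrightarrow> cut_avg_dx n s x'"
    unfolding cut_avg_dx_def by (rule flux_integral_tendsto(1)[OF s cut_kernel_continuous(2)[OF eps] bx l(1)])
  show "(\<lambda>m. cut_avg_dt n (t m) (x m)) \<longlonglongrightarrow> cut_avg_dt n s x'"
    unfolding cut_avg_dt_def by (rule flux_integral_tendsto(2)[OF s cut_kernel_continuous(3)[OF eps] bdy l(2)])
qed

lemma cut_avg_DERIV_t:
  assumes n: "n > 0" and s: "s < T" and t: "t \<in> {0..s}"
  shows "((\<lambda>t. cut_avg n t x) has_real_derivative cut_avg_dt n t x) (at t within {0..s})"
proof -
  have d: "deriv (cut_kernel \<epsilon> n x) = cut_kernel_dy \<epsilon> n x"
    using DERIV_imp_deriv[OF cut_kernel_DERIV_y[OF eps]] by blast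
  have e: "cut_avg n t x = (LINT y|lebesgue. cut_kernel \<epsilon> n x y * \<rho>0 y) + integral {0..t} (\<lambda>t. cut_avg_dt n t x)"
    if "t \<in> {0..s}" for t
    using evolution[OF cut_kernel_test[OF n], of t \<epsilon> x] that s unfolding d cut_avg_def cut_avg_dt_def by auto
  have "continuous_on {0..s} (\<lambda>t. cut_avg_dt n t x)"
    by (rule continuous_on_sequentiallyI, rule cut_avg_tendsto(2)[OF n])
       (use s in \<open>auto intro: order_trans[OF _ less_imp_le[OF s]]\<close>)
  from integral_has_real_derivative[OF this t]
  have "((\<lambda>t. (LINT y|lebesgue. cut_kernel \<epsilon> n x y * \<rho>0 y) + integral {0..t} (\<lambda>t. cut_avg_dt n t x)) has_real_derivative cut_avg_dt n t x) (at t within {0..s})"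
    by (auto intro!: derivative_eq_intros)
  then show ?thesis
    by (rule has_field_derivative_transform_within[of _ _ _ _ 1]) (use e t in auto)
qed

lemma cut_avg_limit_error:
  assumes n: "n > 0" "x \<le> n" and t: "t \<in> {0..T}"
  shows "\<bar>cut_avg n t x - \<epsilon> * w t x\<bar> \<le> C * (1 / n + \<epsilon> * exp ((x - n) / \<epsilon>))"
proof -
  have i: "integrable lebesgue (cut_kernel \<epsilon> n x)"
    by (rule lebesgue_integral_compact_support(1)[OF cut_kernel_continuous(1)[OF eps]]) (rule cut_kernel_zero[OF n(1)])
  note k = ekernel_integral(1)[OF eps, of x]
  have "\<bar>LINT y|lebesgue. (cut_kernel \<epsilon> n x y - ekernel \<epsilon> x y) * \<rho> t y\<bar> \<le> C * (1 / n + 1 * \<epsilon> * exp ((x - n) / \<epsilon>))"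
    by (rule error_kernel_integral[OF eps n \<rho>_bound[OF t]])
       (use Bochner_Integration.integrable_diff[OF i k] cut_kernel_error[OF eps n, folded cut_kernel_def] in simp_all)
  moreover have "(LINT y|lebesgue. (cut_kernel \<epsilon> n x y - ekernel \<epsilon> x y) * \<rho> t y) = cut_avg n t x - \<epsilon> * w t x"
    using ess_bounded_integrable[OF \<rho>_bound[OF t] i] ess_bounded_integrable[OF \<rho>_bound[OF t] k] eps
    by (simp add: left_diff_distrib cut_avg_def expavg_def)
  ultimately show ?thesis by simp
qed

text \<open>Along the characteristic the singular parts of the two derivatives cancel: what is left
  of \<open>\<partial>\<^sub>t + V \<partial>\<^sub>x\<close> differs from the drift only near the cut-offs of the kernel, and the
  bump of height \<open>n\<close> is multiplied by a velocity difference of order \<open>1 / n\<close>.\<close>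

lemma cut_avg_material_derivative_error:
  obtains K where "K \<ge> 0" "\<And>n t x. n \<ge> 1 \<Longrightarrow> x \<le> n \<Longrightarrow> t \<in> {0..T} \<Longrightarrow>
    \<bar>cut_avg_dt n t x + cut_avg_dx n t x * V (w t x) - \<epsilon> * drift t x\<bar> \<le> K * (1 / n + exp ((x - n) / \<epsilon>))"
proof -
  obtain B where B: "B > 0" "\<And>x. bump x \<le> B" using bump_bounded by blast
  obtain BV where BV: "BV \<ge> 0" "\<And>t x. t \<in> {0..T} \<Longrightarrow> \<bar>V (w t x)\<bar> \<le> BV" using compose_w_bounded[OF V_cont] by blast
  obtain L where L: "L \<ge> 0" "\<And>t x y. t \<in> {0..T} \<Longrightarrow> \<bar>V (w t x) - V (w t y)\<bar> \<le> L * \<bar>x - y\<bar>"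
    using velocity_lipschitz by blast
  define c1 where "c1 = 2 * BV / \<epsilon> + L * B"
  define c2 where "c2 = 2 * BV / \<epsilon> + BV * B"
  have c: "c1 \<ge> 0" "c2 \<ge> 0" using BV(1) L(1) B(1) eps by (auto simp: c1_def c2_def)
  show ?thesis
  proof (rule that)
    show "C * (c1 + c2 * \<epsilon>) \<ge> 0" using C_nonneg c eps by simp
    fix n t x :: real assume n: "n \<ge> 1" "x \<le> n" and t: "t \<in> {0..T}"
    have n0: "n > 0" using n by simp
    let ?dV = "\<lambda>y. V (w t x) - V (w t y)"
    let ?k = "\<lambda>y. V (w t y) * cut_kernel_dy \<epsilon> n x y + V (w t x) * cut_kernel_dx \<epsilon> n x y - ekernel \<epsilon> x y * ?dV y / \<epsilon>"
    let ?e = "\<lambda>y. exp ((x - y) / \<epsilon>)" and ?s = "\<lambda>y. step (n * (y - x))" and ?r = "\<lambda>y. 1 - step (1 * (y - n))"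
    have Vb: "\<bar>V (w t y)\<bar> \<le> BV" for y by (rule BV(2)[OF t])
    have dVb: "\<bar>?dV y\<bar> \<le> 2 * BV" for y using Vb[of x] Vb[of y] by linarith
    have dVl: "\<bar>?dV y\<bar> \<le> L * \<bar>x - y\<bar>" for y by (rule L(2)[OF t])
    have "\<bar>?k y\<bar> \<le> c1 * indicator {x..x + 1 / n} y + c2 * (indicator {n<..} y * ?e y)" for y
    proof -
      have eq: "?k y = ?dV y / \<epsilon> * (?e y * ?s y * ?r y - ekernel \<epsilon> x y)
           - ?dV y * (?e y * ?r y * sbump n x y) - V (w t y) * (?e y * ?s y * sbump 1 n y)"
        by (simp add: cut_kernel_dy_def cut_kernel_dx_def algebra_simps add_divide_distrib diff_divide_distrib)
      have s: "0 \<le> ?s y" "?s y \<le> 1" "0 \<le> ?r y" "?r y \<le> 1" using step_bounds by auto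
      let ?i = "indicat_real {x..x + 1 / n} y" and ?j = "indicat_real {n<..} y"
      have "\<bar>?dV y / \<epsilon> * (?e y * ?s y * ?r y - ekernel \<epsilon> x y)\<bar> \<le> 2 * BV / \<epsilon> * (?i + ?j * ?e y)"
        unfolding abs_mult using dVb[of y] eps BV(1)
        by (intro mult_mono cut_kernel_error n0 n) (auto simp: abs_divide divide_right_mono)
      moreover have "\<bar>?dV y * (?e y * ?r y * sbump n x y)\<bar> \<le> L * B * ?i"
      proof (cases "y \<in> {x..x + 1 / n}")
        case True
        then have "?e y \<le> 1" using eps by (auto simp: divide_nonpos_pos)
        then have "?e y * ?r y \<le> 1" using s by (intro mult_le_one) auto
        moreover have sb: "0 \<le> sbump n x y" "sbump n x y \<le> n * B"
          using n0 step_bump(4) B(2) by (auto simp: sbump_def intro: mult_left_mono)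
        ultimately have "(?e y * ?r y) * sbump n x y \<le> 1 * (n * B)"
          using s by (intro mult_mono) simp_all
        moreover have nn: "0 \<le> (?e y * ?r y) * sbump n x y" using s sb by simp
        moreover have "\<bar>?dV y\<bar> \<le> L * (1 / n)"
          using dVl[of y] mult_left_mono[of "\<bar>x - y\<bar>" "1 / n" L] True L(1) by auto
        ultimately have "\<bar>?dV y\<bar> * ((?e y * ?r y) * sbump n x y) \<le> (L * (1 / n)) * (1 * (n * B))"
          using L(1) n0 mult_mono[of "\<bar>?dV y\<bar>" "L * (1 / n)" "(?e y * ?r y) * sbump n x y" "1 * (n * B)"] by simp
        also have "\<dots> = L * B" using n0 by simp
        finally show ?thesis using True unfolding abs_mult[of "?dV y"] abs_of_nonneg[OF nn] by simp
      next
        case False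
        then show ?thesis using sbump_eq_0[OF n0 False] by simp
      qed
      moreover have "\<bar>V (w t y) * (?e y * ?s y * sbump 1 n y)\<bar> \<le> BV * B * (?j * ?e y)"
      proof (cases "y > n")
        case True
        have "0 \<le> sbump 1 n y" "sbump 1 n y \<le> B" using step_bump(4) B(2) by (auto simp: sbump_def)
        then have "?s y * sbump 1 n y \<le> 1 * B" "0 \<le> ?s y * sbump 1 n y"
          using s mult_mono[of "?s y" 1 "sbump 1 n y" B] by simp_all
        then have "?e y * (?s y * sbump 1 n y) \<le> ?e y * B" "0 \<le> ?e y * (?s y * sbump 1 n y)" by auto
        then have "\<bar>V (w t y)\<bar> * (?e y * (?s y * sbump 1 n y)) \<le> BV * (?e y * B)"
          using Vb[of y] BV(1) mult_mono[of "\<bar>V (w t y)\<bar>" BV "?e y * (?s y * sbump 1 n y)" "?e y * B"] by simp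
        then show ?thesis
          using True abs_of_nonneg[OF \<open>0 \<le> ?e y * (?s y * sbump 1 n y)\<close>]
          unfolding abs_mult[of "V (w t y)"] by (simp add: mult_ac)
      next
        case False
        then have "sbump 1 n y = 0" by (auto simp: sbump_def intro: step_bump(5))
        then show ?thesis using False by simp
      qed
      ultimately have "\<bar>?k y\<bar> \<le> 2 * BV / \<epsilon> * (?i + ?j * ?e y) + L * B * ?i + BV * B * (?j * ?e y)"
        unfolding eq by linarith
      then show ?thesis by (simp add: c1_def c2_def algebra_simps)
    qed
    moreover have i1: "integrable lebesgue (\<lambda>y. V (w t y) * cut_kernel_dy \<epsilon> n x y)"
      by (rule lebesgue_integral_compact_support(1)[of _ x "n + 1"])
         (use cut_kernel_zero[OF n0] in \<open>auto intro!: continuous_intros Vw_continuous t cut_kernel_continuous eps\<close>)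
    moreover have i2: "integrable lebesgue (cut_kernel_dx \<epsilon> n x)"
      by (rule lebesgue_integral_compact_support(1)[of _ x "n + 1"])
         (use cut_kernel_zero[OF n0] in \<open>auto intro!: cut_kernel_continuous eps\<close>)
    moreover have i3: "integrable lebesgue (\<lambda>y. ekernel \<epsilon> x y * ?dV y)"
      using ekernel_integral(1)[OF eps] dVb t
      by (intro ess_bounded_integrable[of "2 * BV"] ess_bounded_continuous continuous_intros Vw_continuous) auto
    ultimately have "\<bar>LINT y|lebesgue. ?k y * \<rho> t y\<bar> \<le> C * (c1 / n + c2 * \<epsilon> * exp ((x - n) / \<epsilon>))"
      by (intro error_kernel_integral[OF eps n0 n(2) \<rho>_bound[OF t]]) auto
    also have "\<dots> \<le> C * ((c1 + c2 * \<epsilon>) * (1 / n) + (c1 + c2 * \<epsilon>) * exp ((x - n) / \<epsilon>))"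
      using c eps n0 C_nonneg by (intro mult_left_mono add_mono mult_right_mono) (auto simp: divide_right_mono)
    finally have "\<bar>LINT y|lebesgue. ?k y * \<rho> t y\<bar> \<le> C * (c1 + c2 * \<epsilon>) * (1 / n + exp ((x - n) / \<epsilon>))"
      by (simp add: algebra_simps)
    moreover have "(LINT y|lebesgue. ?k y * \<rho> t y) = cut_avg_dt n t x + cut_avg_dx n t x * V (w t x) - \<epsilon> * drift t x"
    proof -
      note j = ess_bounded_integrable[OF \<rho>_bound[OF t] i1] ess_bounded_integrable[OF \<rho>_bound[OF t] i2] ess_bounded_integrable[OF \<rho>_bound[OF t] i3]
      have "(\<lambda>y. ?k y * \<rho> t y) = (\<lambda>y. (V (w t y) * cut_kernel_dy \<epsilon> n x y) * \<rho> t y + V (w t x) * (cut_kernel_dx \<epsilon> n x y * \<rho> t y) - (1 / \<epsilon>) * ((ekernel \<epsilon> x y * ?dV y) * \<rho> t y))"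
        by (simp add: fun_eq_iff algebra_simps diff_divide_distrib)
      then have "(LINT y|lebesgue. ?k y * \<rho> t y) = (LINT y|lebesgue. (V (w t y) * cut_kernel_dy \<epsilon> n x y) * \<rho> t y) + (LINT y|lebesgue. V (w t x) * (cut_kernel_dx \<epsilon> n x y * \<rho> t y)) - (LINT y|lebesgue. (1 / \<epsilon>) * ((ekernel \<epsilon> x y * ?dV y) * \<rho> t y))"
        using j by (simp only: Bochner_Integration.integral_diff Bochner_Integration.integral_add Bochner_Integration.integrable_add integrable_mult_right)
      then show ?thesis
        unfolding drift_eq[OF t] cut_avg_dt_def cut_avg_dx_def by (simp add: mult.commute)
    qed
    ultimately show "\<bar>cut_avg_dt n t x + cut_avg_dx n t x * V (w t x) - \<epsilon> * drift t x\<bar> \<le> C * (c1 + c2 * \<epsilon>) * (1 / n + exp ((x - n) / \<epsilon>))"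
      by simp
  qed
qed

text \<open>The regularised averages have an explicit derivative along the curve, which is uniformly close
  to the drift; their difference to the time integral of the drift is then constant in the limit.\<close>

lemma w_along_characteristic:
  assumes s: "s < T" and X: "\<And>\<tau>. \<tau> \<in> {0..s} \<Longrightarrow> (X has_real_derivative V (w \<tau> (X \<tau>))) (at \<tau> within {0..s})"
    and t: "t \<in> {0..s}"
  shows "((\<lambda>\<tau>. w \<tau> (X \<tau>)) has_real_derivative drift t (X t)) (at t within {0..s})"
proof -
  have sub: "\<tau> \<in> {0..T}" if "\<tau> \<in> {0..s}" for \<tau> using that s by auto
  have cX: "continuous_on {0..s} X"
    unfolding continuous_on_eq_continuous_within using DERIV_continuous[OF X] by blast
  have cR: "continuous_on {0..s} (\<lambda>\<tau>. drift \<tau> (X \<tau>))"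
  proof (rule continuous_on_sequentiallyI)
    fix u a assume u: "\<forall>n. u n \<in> {0..s}" "a \<in> {0..s}" "u \<longlonglongrightarrow> a"
    then have "(\<lambda>n. X (u n)) \<longlonglongrightarrow> X a" by (intro continuous_on_tendsto_compose[OF cX]) auto
    then show "(\<lambda>n. drift (u n) (X (u n))) \<longlonglongrightarrow> drift a (X a)"
      using u by (intro drift_tendsto sub) auto
  qed
  define F where "F = (\<lambda>\<tau>. integral {0..\<tau>} (\<lambda>\<tau>. drift \<tau> (X \<tau>)))"
  have F: "(F has_real_derivative drift \<tau> (X \<tau>)) (at \<tau> within {0..s})" if "\<tau> \<in> {0..s}" for \<tau>
    unfolding F_def by (rule integral_has_real_derivative[OF cR that])
  obtain K where K: "K \<ge> 0" "\<And>n t x. n \<ge> 1 \<Longrightarrow> x \<le> n \<Longrightarrow> t \<in> {0..T} \<Longrightarrow>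
    \<bar>cut_avg_dt n t x + cut_avg_dx n t x * V (w t x) - \<epsilon> * drift t x\<bar> \<le> K * (1 / n + exp ((x - n) / \<epsilon>))"
    using cut_avg_material_derivative_error by blast
  obtain M where M: "\<And>\<tau>. \<tau> \<in> {0..s} \<Longrightarrow> \<bar>X \<tau>\<bar> \<le> M"
    using continuous_on_Icc_bounded[OF cX] by blast
  have const: "\<epsilon> * w a (X a) - \<epsilon> * F a = \<epsilon> * w b (X b) - \<epsilon> * F b" if ab: "a \<in> {0..s}" "b \<in> {0..s}" for a b
  proof -
    define E where "E = (\<lambda>n. K * (1 / n + exp ((M - n) / \<epsilon>)) * \<bar>a - b\<bar> + 2 * (C * (1 / n + \<epsilon> * exp ((M - n) / \<epsilon>))))"
    have bound: "\<bar>(\<epsilon> * w a (X a) - \<epsilon> * F a) - (\<epsilon> * w b (X b) - \<epsilon> * F b)\<bar> \<le> E n" if n: "n \<ge> 1" "n \<ge> M" for n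
    proof -
      have n0: "n > 0" using n by simp
      have Xn: "X \<tau> \<le> n" if "\<tau> \<in> {0..s}" for \<tau> using M[OF that] n by auto
      have eM: "exp ((X \<tau> - n) / \<epsilon>) \<le> exp ((M - n) / \<epsilon>)" if "\<tau> \<in> {0..s}" for \<tau>
        using M[OF that] eps by (auto simp: divide_right_mono)
      have "norm ((cut_avg n a (X a) - \<epsilon> * F a) - (cut_avg n b (X b) - \<epsilon> * F b)) \<le> (K * (1 / n + exp ((M - n) / \<epsilon>))) * norm (a - b)"
      proof (rule field_differentiable_bound[of "{0..s}" "\<lambda>\<tau>. cut_avg n \<tau> (X \<tau>) - \<epsilon> * F \<tau>"
            "\<lambda>\<tau>. cut_avg_dt n \<tau> (X \<tau>) + cut_avg_dx n \<tau> (X \<tau>) * V (w \<tau> (X \<tau>)) - \<epsilon> * drift \<tau> (X \<tau>)"])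
        fix \<tau> assume tau: "\<tau> \<in> {0..s}"
        have "((\<lambda>\<tau>. cut_avg n \<tau> (X \<tau>)) has_real_derivative cut_avg_dt n \<tau> (X \<tau>) + cut_avg_dx n \<tau> (X \<tau>) * V (w \<tau> (X \<tau>))) (at \<tau> within {0..s})"
          by (rule curve_chain_rule[OF tau cut_avg_DERIV_t[OF n0 s tau] cut_avg_DERIV_x[OF n0 sub] X[OF tau]])
             (use sub tau in \<open>auto intro!: cut_avg_tendsto n0\<close>)
        then show "((\<lambda>\<tau>. cut_avg n \<tau> (X \<tau>) - \<epsilon> * F \<tau>) has_real_derivative
          cut_avg_dt n \<tau> (X \<tau>) + cut_avg_dx n \<tau> (X \<tau>) * V (w \<tau> (X \<tau>)) - \<epsilon> * drift \<tau> (X \<tau>)) (at \<tau> within {0..s})"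
          by (intro DERIV_diff DERIV_cmult F tau)
        have "K * (1 / n + exp ((X \<tau> - n) / \<epsilon>)) \<le> K * (1 / n + exp ((M - n) / \<epsilon>))"
          using eM[OF tau] K(1) by (intro mult_left_mono) auto
        then show "norm (cut_avg_dt n \<tau> (X \<tau>) + cut_avg_dx n \<tau> (X \<tau>) * V (w \<tau> (X \<tau>)) - \<epsilon> * drift \<tau> (X \<tau>)) \<le> K * (1 / n + exp ((M - n) / \<epsilon>))"
          using K(2)[OF n(1) Xn[OF tau] sub[OF tau]] by simp
      qed (use ab in auto)
      moreover have "\<bar>cut_avg n \<tau> (X \<tau>) - \<epsilon> * w \<tau> (X \<tau>)\<bar> \<le> C * (1 / n + \<epsilon> * exp ((M - n) / \<epsilon>))" if tau: "\<tau> \<in> {0..s}" for \<tau>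
      proof -
        have "C * (1 / n + \<epsilon> * exp ((X \<tau> - n) / \<epsilon>)) \<le> C * (1 / n + \<epsilon> * exp ((M - n) / \<epsilon>))"
          using eM[OF tau] C_nonneg eps by (intro mult_left_mono add_left_mono) auto
        then show ?thesis using cut_avg_limit_error[OF n0 Xn[OF tau] sub[OF tau]] by linarith
      qed
      from this[OF ab(1)] this[OF ab(2)] calculation
      show ?thesis unfolding E_def real_norm_def by linarith
    qed
    have "(E \<longlongrightarrow> 0) at_top" unfolding E_def using eps by real_asymp
    moreover have "\<forall>\<^sub>F n in at_top. \<bar>(\<epsilon> * w a (X a) - \<epsilon> * F a) - (\<epsilon> * w b (X b) - \<epsilon> * F b)\<bar> \<le> E n"
      using eventually_ge_at_top[of "1 :: real"] eventually_ge_at_top[of M] by eventually_elim (rule bound)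
    ultimately have "\<bar>(\<epsilon> * w a (X a) - \<epsilon> * F a) - (\<epsilon> * w b (X b) - \<epsilon> * F b)\<bar> \<le> 0"
      by (rule tendsto_lowerbound) simp
    then show ?thesis by simp
  qed
  have eq: "w \<tau> (X \<tau>) = w 0 (X 0) - F 0 + F \<tau>" if "\<tau> \<in> {0..s}" for \<tau>
  proof -
    have "\<epsilon> * (w \<tau> (X \<tau>) - F \<tau>) = \<epsilon> * (w 0 (X 0) - F 0)"
      using const[OF that, of 0] that by (simp add: right_diff_distrib)
    then show ?thesis using eps by simp
  qed
  have "((\<lambda>\<tau>. w 0 (X 0) - F 0 + F \<tau>) has_real_derivative drift t (X t)) (at t within {0..s})"
    by (auto intro!: derivative_eq_intros F t)
  then show ?thesis
    by (rule has_field_derivative_transform_within[of _ _ _ _ 1]) (use t eq[symmetric] in simp_all)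
qed

lemma characteristic_exists:
  assumes s: "0 \<le> s" "s < T"
  obtains X where "X s = x" "\<And>\<tau>. \<tau> \<in> {0..s} \<Longrightarrow> (X has_real_derivative V (w \<tau> (X \<tau>))) (at \<tau> within {0..s})"
proof -
  obtain L where L: "L \<ge> 0" "\<And>t x y. t \<in> {0..T} \<Longrightarrow> \<bar>V (w t x) - V (w t y)\<bar> \<le> L * \<bar>x - y\<bar>"
    using velocity_lipschitz by blast
  have sub: "\<tau> \<in> {0..T}" if "\<tau> \<in> {0..s}" for \<tau> using that s by auto
  show ?thesis
  proof (rule terminal_value_problem[of s L "\<lambda>\<tau> x. V (w \<tau> x)" x])
    show "continuous_on {0..s} (\<lambda>\<tau>. V (w \<tau> (Z \<tau>)))" if Z: "continuous_on {0..s} Z" for Z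
    proof (rule continuous_on_sequentiallyI)
      fix u a assume u: "\<forall>n. u n \<in> {0..s}" "a \<in> {0..s}" "u \<longlonglongrightarrow> a"
      then have "(\<lambda>n. Z (u n)) \<longlonglongrightarrow> Z a" by (intro continuous_on_tendsto_compose[OF Z]) auto
      then show "(\<lambda>n. V (w (u n) (Z (u n)))) \<longlonglongrightarrow> V (w a (Z a))"
        using u V_cont by (intro isCont_tendsto_compose[of _ V] w_tendsto sub) (auto simp: continuous_on_eq_continuous_at)
    qed
  qed (use s that L sub in auto)
qed

lemma w_initial: "w 0 x = expavg \<epsilon> \<rho>0 x"
proof -
  have 0: "0 \<in> {0..T}" using T by simp
  define E where "E = (\<lambda>n. 2 * (C * (1 / n + \<epsilon> * exp ((x - n) / \<epsilon>))))"
  have bound: "\<bar>\<epsilon> * w 0 x - \<epsilon> * expavg \<epsilon> \<rho>0 x\<bar> \<le> E n" if n: "n \<ge> 1" "n \<ge> x" for n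
  proof -
    have n0: "n > 0" using n by simp
    have "cut_avg n 0 x = (LINT y|lebesgue. cut_kernel \<epsilon> n x y * \<rho>0 y)"
      using evolution[OF cut_kernel_test[OF n0], of 0] T by (simp add: cut_avg_def)
    have i: "integrable lebesgue (cut_kernel \<epsilon> n x)"
      by (rule lebesgue_integral_compact_support(1)[OF cut_kernel_continuous(1)[OF eps]]) (rule cut_kernel_zero[OF n0])
    note k = ekernel_integral(1)[OF eps, of x]
    have "\<bar>LINT y|lebesgue. (cut_kernel \<epsilon> n x y - ekernel \<epsilon> x y) * \<rho>0 y\<bar> \<le> C * (1 / n + 1 * \<epsilon> * exp ((x - n) / \<epsilon>))"
      by (rule error_kernel_integral[OF eps n0 n(2) \<rho>0_bound])
         (use Bochner_Integration.integrable_diff[OF i k] cut_kernel_error[OF eps n0 n(2), folded cut_kernel_def] in simp_all)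
    moreover have "(LINT y|lebesgue. (cut_kernel \<epsilon> n x y - ekernel \<epsilon> x y) * \<rho>0 y) = cut_avg n 0 x - \<epsilon> * expavg \<epsilon> \<rho>0 x"
      using ess_bounded_integrable[OF \<rho>0_bound i] ess_bounded_integrable[OF \<rho>0_bound k] eps
        \<open>cut_avg n 0 x = (LINT y|lebesgue. cut_kernel \<epsilon> n x y * \<rho>0 y)\<close>
      by (simp add: left_diff_distrib expavg_def)
    ultimately show ?thesis
      using cut_avg_limit_error[OF n0 n(2) 0] unfolding E_def by simp
  qed
  have "(E \<longlongrightarrow> 0) at_top" unfolding E_def using eps by real_asymp
  moreover have "\<forall>\<^sub>F n in at_top. \<bar>\<epsilon> * w 0 x - \<epsilon> * expavg \<epsilon> \<rho>0 x\<bar> \<le> E n"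
    using eventually_ge_at_top[of "1 :: real"] eventually_ge_at_top[of x] by eventually_elim (rule bound)
  ultimately have "\<bar>\<epsilon> * w 0 x - \<epsilon> * expavg \<epsilon> \<rho>0 x\<bar> \<le> 0"
    by (rule tendsto_lowerbound) simp
  then show ?thesis using eps by simp
qed

end

section \<open>Comparison along curves\<close>

text \<open>After its last zero, a function that is positive at the end would have to be
  nonincreasing.\<close>

lemma barrier_nonpos:
  fixes e e' :: "real \<Rightarrow> real"
  assumes ab: "a \<le> b" and e0: "e a \<le> 0"
    and d: "\<And>\<tau>. \<tau> \<in> {a..b} \<Longrightarrow> (e has_real_derivative e' \<tau>) (at \<tau> within {a..b})"
    and neg: "\<And>\<tau>. \<tau> \<in> {a..b} \<Longrightarrow> e \<tau> > 0 \<Longrightarrow> e' \<tau> \<le> 0"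
  shows "e b \<le> 0"
proof (rule ccontr)
  assume "\<not> e b \<le> 0"
  then have eb: "e b > 0" by simp
  have ce: "continuous_on {a..b} e"
    unfolding continuous_on_eq_continuous_within using DERIV_continuous[OF d] by blast
  define S where "S = {\<tau> \<in> {a..b}. e \<tau> \<le> 0}"
  have cS: "compact S"
  proof -
    have "S = {a..b} \<inter> e -` {..0}" by (auto simp: S_def)
    then have "closed S" using continuous_closed_preimage[OF ce closed_atLeastAtMost closed_atMost] by simp
    moreover have "bounded S" by (rule bounded_subset[OF bounded_closed_interval[of a b]]) (auto simp: S_def)
    ultimately show ?thesis by (simp add: compact_eq_bounded_closed)
  qed
  have "S \<noteq> {}" using e0 ab by (auto simp: S_def)
  from compact_attains_sup[OF cS this] obtain c where c: "c \<in> S" "\<And>\<tau>. \<tau> \<in> S \<Longrightarrow> \<tau> \<le> c" by blast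
  have cb: "a \<le> c" "c < b" using c(1) eb ab by (auto simp: S_def less_le)
  have pos: "e \<tau> > 0" if "c < \<tau>" "\<tau> \<le> b" for \<tau>
    using c(2)[of \<tau>] that cb by (force simp: S_def)
  have "(e has_derivative (\<lambda>h. e' x * h)) (at x within {c..b})" if "c \<le> x" "x \<le> b" for x
  proof -
    have "(e has_real_derivative e' x) (at x within {c..b})"
      using cb that by (intro has_field_derivative_subset[OF d]) auto
    then show ?thesis by (simp add: has_field_derivative_def)
  qed
  from mvt_simple[OF cb(2) this] obtain z where "z \<in> {c<..<b}" "e b - e c = e' z * (b - c)" by blast
  then have z: "c < z" "z < b" "e b - e c = (b - c) * e' z" by (simp_all add: mult.commute)
  have "e' z \<le> 0" using neg[of z] pos[of z] z cb by auto
  then have "(b - c) * e' z \<le> 0" using cb by (simp add: mult_le_0_iff)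
  then show False using z(3) c(1) eb by (simp add: S_def)
qed

text \<open>Gronwall's inequality for the supremum of a family \<open>z t p\<close>, \<open>p \<in> Q\<close>, when only the derivatives
  along suitable curves in \<open>Q\<close> are controlled, by the current supremum. Let \<open>M\<close> be the supremum of
  the positive part of \<open>e\<^bsup>-2At\<^esup> z t p\<close> over all \<open>t\<close> and \<open>p\<close>. Comparing \<open>z\<close> along a curve that ends at \<open>p\<close> with
  \<open>(M / 2) e\<^bsup>2At\<^esup>\<close> halves the bound, so that \<open>M \<le> M / 2\<close>.\<close>

lemma sup_gronwall:
  fixes z :: "real \<Rightarrow> 'p \<Rightarrow> real"
  assumes A: "A \<ge> 0"
    and bdd: "\<And>t p. t \<in> {0..s} \<Longrightarrow> p \<in> Q \<Longrightarrow> z t p \<le> B"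
    and init: "\<And>p. p \<in> Q \<Longrightarrow> z 0 p \<le> 0"
    and curve: "\<And>t p. t \<in> {0..s} \<Longrightarrow> p \<in> Q \<Longrightarrow> \<exists>P dz. P t = p \<and> (\<forall>\<tau>\<in>{0..t}. P \<tau> \<in> Q \<and>
       ((\<lambda>\<tau>. z \<tau> (P \<tau>)) has_real_derivative dz \<tau>) (at \<tau> within {0..t}) \<and>
       (z \<tau> (P \<tau>) > 0 \<longrightarrow> (\<forall>n. (\<forall>q\<in>Q. z \<tau> q \<le> n) \<longrightarrow> dz \<tau> \<le> A * n)))"
    and t: "t \<in> {0..s}" and p: "p \<in> Q"
  shows "z t p \<le> 0"
proof -
  define l where "l = 2 * A"
  define g where "g = (\<lambda>(t, p). max 0 (exp (- l * t) * z t p))"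
  define M where "M = (SUP tp \<in> {0..s} \<times> Q. g tp)"
  have ne: "{0..s} \<times> Q \<noteq> {}" using t p by blast
  have bd: "bdd_above (g ` ({0..s} \<times> Q))"
  proof (rule bdd_aboveI2)
    fix tp assume "tp \<in> {0..s} \<times> Q"
    then obtain t p where tp: "tp = (t, p)" "t \<in> {0..s}" "p \<in> Q" by auto
    have "exp (- l * t) \<le> 1" using tp A by (simp add: l_def)
    then have "exp (- l * t) * z t p \<le> 1 * max B 0"
      using bdd[OF tp(2,3)] by (intro order_trans[OF mult_left_mono[of "z t p" "max B 0"] mult_right_mono]) auto
    then show "g tp \<le> max B 0" by (simp add: g_def tp(1))
  qed
  have gM: "z t p \<le> M * exp (l * t)" if "t \<in> {0..s}" "p \<in> Q" for t p
  proof -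
    have "g (t, p) \<le> M" unfolding M_def using that by (intro cSUP_upper bd) auto
    then have "exp (- l * t) * z t p \<le> M" by (simp add: g_def)
    then have "exp (l * t) * (exp (- l * t) * z t p) \<le> exp (l * t) * M" by (intro mult_left_mono) auto
    moreover have "exp (l * t) * (exp (- l * t) * z t p) = z t p"
      by (simp add: exp_minus)
    ultimately have "z t p \<le> exp (l * t) * M" by (simp only:)
    then show ?thesis by (simp only: mult.commute)
  qed
  have M0: "M \<ge> 0"
  proof -
    have "g (t, p) \<le> M" unfolding M_def using t p by (intro cSUP_upper bd) auto
    then show ?thesis by (simp add: g_def)
  qed
  have half: "z t p \<le> M / 2 * exp (l * t)" if t: "t \<in> {0..s}" and p: "p \<in> Q" for t p
  proof -
    from curve[OF t p] obtain P dz where Pt: "P t = p" and PP: "\<forall>\<tau>\<in>{0..t}. P \<tau> \<in> Q \<and>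
       ((\<lambda>\<tau>. z \<tau> (P \<tau>)) has_real_derivative dz \<tau>) (at \<tau> within {0..t}) \<and>
       (z \<tau> (P \<tau>) > 0 \<longrightarrow> (\<forall>n. (\<forall>q\<in>Q. z \<tau> q \<le> n) \<longrightarrow> dz \<tau> \<le> A * n))"
      by (elim exE conjE)
    have P: "P \<tau> \<in> Q" "((\<lambda>\<tau>. z \<tau> (P \<tau>)) has_real_derivative dz \<tau>) (at \<tau> within {0..t})"
      if "\<tau> \<in> {0..t}" for \<tau> using bspec[OF PP that] by blast+
    have Pn: "dz \<tau> \<le> A * n" if "\<tau> \<in> {0..t}" "z \<tau> (P \<tau>) > 0" "\<And>q. q \<in> Q \<Longrightarrow> z \<tau> q \<le> n" for \<tau> n
      using bspec[OF PP that(1)] that(2,3) by blast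
    have "z t (P t) - M / 2 * exp (l * t) \<le> 0"
    proof (rule barrier_nonpos[of 0 t "\<lambda>\<tau>. z \<tau> (P \<tau>) - M / 2 * exp (l * \<tau>)" "\<lambda>\<tau>. dz \<tau> - M / 2 * (exp (l * \<tau>) * l)"])
      show "0 \<le> t" using t by simp
      show "z 0 (P 0) - M / 2 * exp (l * 0) \<le> 0" using init[OF P(1)[of 0]] t M0 by simp
      fix \<tau> assume tau: "\<tau> \<in> {0..t}"
      show "((\<lambda>\<tau>. z \<tau> (P \<tau>) - M / 2 * exp (l * \<tau>)) has_real_derivative dz \<tau> - M / 2 * (exp (l * \<tau>) * l)) (at \<tau> within {0..t})"
        by (rule DERIV_diff[OF P(2)[OF tau]]) (auto intro!: derivative_eq_intros)
      assume pos: "z \<tau> (P \<tau>) - M / 2 * exp (l * \<tau>) > 0"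
      have "M / 2 * exp (l * \<tau>) \<ge> 0" using M0 by simp
      with pos have "z \<tau> (P \<tau>) > 0" by linarith
      then have "dz \<tau> \<le> A * (M * exp (l * \<tau>))" using tau t by (intro Pn gM) auto
      then show "dz \<tau> - M / 2 * (exp (l * \<tau>) * l) \<le> 0" by (simp add: l_def mult_ac)
    qed
    then show ?thesis using Pt by simp
  qed
  have "M \<le> M / 2"
    unfolding M_def
  proof (rule cSUP_least[OF ne], fold M_def)
    fix tp assume "tp \<in> {0..s} \<times> Q"
    then obtain t p where tp: "tp = (t, p)" "t \<in> {0..s}" "p \<in> Q" by auto
    have "exp (- l * t) * z t p \<le> exp (- l * t) * (M / 2 * exp (l * t))" by (intro mult_left_mono half tp) auto
    also have "\<dots> = M / 2" by (simp add: mult.commute[of "exp (- l * t)"] mult.assoc exp_add[symmetric])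
    finally show "g tp \<le> M / 2" using M0 by (simp add: g_def tp(1))
  qed
  then have "M = 0" using M0 by simp
  then show ?thesis using gM[OF t p] by simp
qed

text \<open>A differentiation-free substitute for a nonnegative derivative, obtained by adding up the
  increments over a fine partition.\<close>

lemma mono_of_local_increments:
  fixes f :: "real \<Rightarrow> real"
  assumes loc: "\<And>e. e > 0 \<Longrightarrow> \<exists>d>0. \<forall>y y'. y < y' \<longrightarrow> y' < y + d \<longrightarrow> f y' - f y \<ge> - e * (y' - y)"
    and ab: "a < b"
  shows "f a \<le> f b"
proof (rule field_le_epsilon)
  fix \<eta> :: real assume "\<eta> > 0"
  define e where "e = \<eta> / (b - a)"
  have "e > 0" using \<open>\<eta> > 0\<close> ab by (simp add: e_def)
  from loc[OF this] obtain d where d: "d > 0" "\<And>y y'. y < y' \<Longrightarrow> y' < y + d \<Longrightarrow> f y' - f y \<ge> - e * (y' - y)" by blast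
  obtain N :: nat where N: "(b - a) / d < N" using reals_Archimedean2 by blast
  have N0: "N > 0" using N d(1) ab by (cases "N = 0") (auto simp: divide_less_0_iff)
  define h where "h = (b - a) / N"
  have h: "h > 0" "h < d" using N N0 d(1) ab by (auto simp: h_def field_simps)
  have "f (a + k * h) \<ge> f a - e * (k * h)" for k :: nat
  proof (induction k)
    case (Suc k)
    have "f (a + Suc k * h) - f (a + k * h) \<ge> - e * ((a + Suc k * h) - (a + k * h))"
      using h by (intro d) (auto simp: algebra_simps)
    then show ?case using Suc by (simp add: algebra_simps)
  qed simp
  from this[of N] have "f b \<ge> f a - e * (b - a)" using N0 by (simp add: h_def)
  then show "f a \<le> f b + \<eta>" using ab by (simp add: e_def)
qed

section \<open>Maximum principle and the one-sided Lipschitz bound\<close>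

text \<open>Both structural conditions reduce to the last two assumptions with \<open>\<kappa> = k2 - k1\<close>: \<open>V'\<close> is at
  most \<open>-k2\<close> on the range of the datum, and \<open>\<xi> V'(\<xi>)\<close> grows there with slope at most \<open>k1\<close>.\<close>

locale oleinik_setting = nonlocal_solution_C1 +
  fixes lo hi k1 k2 :: real
  assumes range0: "AE x in lebesgue. lo \<le> \<rho>0 x \<and> \<rho>0 x \<le> hi"
    and lo_nonneg: "0 \<le> lo"
    and V'_nonpos: "V' x \<le> 0"
    and k: "0 \<le> k1" "k1 < k2"
    and V'_le: "\<xi> \<in> {lo..hi} \<Longrightarrow> V' \<xi> \<le> - k2"
    and moment_slope: "lo \<le> x \<Longrightarrow> x \<le> y \<Longrightarrow> y \<le> hi \<Longrightarrow> V' y * y - V' x * x \<le> k1 * (y - x)"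
begin

lemma w_initial_bounds: "lo \<le> w 0 x" "w 0 x \<le> hi"
  unfolding w_initial using expavg_bounds[OF eps \<rho>0_bound range0] by auto

lemma U_antimono: "0 \<le> x \<Longrightarrow> x \<le> y \<Longrightarrow> U y \<le> U x"
  by (rule DERIV_nonpos_imp_nonincreasing)
     (auto intro!: exI U_DERIV mult_nonpos_nonneg V'_nonpos)

lemma U_lipschitz: obtains L where "L \<ge> 0" "\<And>x y. \<bar>x\<bar> \<le> C \<Longrightarrow> \<bar>y\<bar> \<le> C \<Longrightarrow> \<bar>U x - U y\<bar> \<le> L * \<bar>x - y\<bar>"
  using C1_lipschitz[OF U_DERIV continuous_on_mult[OF V'_cont continuous_on_id], of C] by blast

lemma w_along:
  assumes s: "s \<in> {0..<T}"
  obtains X where "X s = x"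
    "\<And>\<tau>. \<tau> \<in> {0..s} \<Longrightarrow> (X has_real_derivative V (w \<tau> (X \<tau>))) (at \<tau> within {0..s})"
    "\<And>\<tau>. \<tau> \<in> {0..s} \<Longrightarrow> ((\<lambda>\<tau>. w \<tau> (X \<tau>)) has_real_derivative drift \<tau> (X \<tau>)) (at \<tau> within {0..s})"
proof -
  obtain X where X: "X s = x" "\<And>\<tau>. \<tau> \<in> {0..s} \<Longrightarrow> (X has_real_derivative V (w \<tau> (X \<tau>))) (at \<tau> within {0..s})"
    using characteristic_exists[of s x] s by auto
  show ?thesis by (rule that[OF X w_along_characteristic[OF _ X(2)]]) (use s in auto)
qed

lemma lo_bound: "\<bar>lo\<bar> \<le> C" and lo_le_hi: "lo \<le> hi"
  using w_initial_bounds[of 0] w_bound[of 0 0] T lo_nonneg by auto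

text \<open>Where the excess \<open>\<sigma> (w - c)\<close> is positive, \<open>\<sigma> U(w)\<close> is above \<open>\<sigma> U(c)\<close> by at most a multiple of the
  excess, and nowhere is it below \<open>\<sigma> U(c)\<close> by more than that multiple of the largest excess. As the drift
  compares \<open>U(w)\<close> with its average, it increases the excess at a rate proportional to the largest one,
  and Gronwall's argument applies.\<close>

lemma excess_nonpos:
  assumes t: "t \<in> {0..<T}" and c: "\<bar>c\<bar> \<le> C" and \<sigma>: "\<bar>\<sigma>\<bar> = 1"
    and init: "\<And>x. \<sigma> * (w 0 x - c) \<le> 0"
    and side: "\<And>\<tau> y. \<tau> \<in> {0..t} \<Longrightarrow> \<sigma> * (w \<tau> y - c) \<le> 0 \<Longrightarrow> \<sigma> * U c \<le> \<sigma> * U (w \<tau> y)"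
  shows "\<sigma> * (w t x - c) \<le> 0"
proof -
  obtain L where L: "L \<ge> 0" "\<And>x y. \<bar>x\<bar> \<le> C \<Longrightarrow> \<bar>y\<bar> \<le> C \<Longrightarrow> \<bar>U x - U y\<bar> \<le> L * \<bar>x - y\<bar>"
    using U_lipschitz by blast
  obtain B where B: "B \<ge> 0" "\<And>t x. t \<in> {0..T} \<Longrightarrow> \<bar>U (w t x)\<bar> \<le> B" using compose_w_bounded[OF U_cont] by blast
  have abs: "\<bar>\<sigma> * r\<bar> = \<bar>r\<bar>" for r using \<sigma> by (simp add: abs_mult)
  show ?thesis
  proof (rule sup_gronwall[where z = "\<lambda>t x. \<sigma> * (w t x - c)" and s = t and Q = UNIV and A = "2 * L / \<epsilon>" and B = "2 * C"])
    show "0 \<le> 2 * L / \<epsilon>" using L eps by simp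
    show "\<sigma> * (w r x - c) \<le> 2 * C" if "r \<in> {0..t}" for r x
    proof -
      have "\<bar>w r x\<bar> \<le> C" using that t by (intro w_bound) auto
      then show ?thesis using abs[of "w r x - c"] c by linarith
    qed
    show "\<sigma> * (w 0 x - c) \<le> 0" for x by (rule init)
    fix r x assume r: "r \<in> {0..t}"
    then have "r \<in> {0..<T}" using t by auto
    from w_along[OF this, of x] obtain X where X: "X r = x"
      "\<And>\<tau>. \<tau> \<in> {0..r} \<Longrightarrow> ((\<lambda>\<tau>. w \<tau> (X \<tau>)) has_real_derivative drift \<tau> (X \<tau>)) (at \<tau> within {0..r})" by blast
    have "\<sigma> * drift \<tau> (X \<tau>) \<le> 2 * L / \<epsilon> * n"
      if tau: "\<tau> \<in> {0..r}" and pos: "\<sigma> * (w \<tau> (X \<tau>) - c) > 0" and n: "\<And>q. \<sigma> * (w \<tau> q - c) \<le> n" for \<tau> n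
    proof -
      have tT: "\<tau> \<in> {0..T}" "\<tau> \<in> {0..t}" using tau r t by auto
      have n0: "n > 0" using less_le_trans[OF pos n] .
      have U_near: "\<bar>\<sigma> * U (w \<tau> y) - \<sigma> * U c\<bar> \<le> L * n" if "\<sigma> * (w \<tau> y - c) > 0" for y
      proof -
        have "\<bar>w \<tau> y - c\<bar> \<le> n" using abs[of "w \<tau> y - c"] that n[of y] by linarith
        then have "L * \<bar>w \<tau> y - c\<bar> \<le> L * n" using L(1) by (rule mult_left_mono)
        moreover have "\<bar>U (w \<tau> y) - U c\<bar> \<le> L * \<bar>w \<tau> y - c\<bar>" by (intro L w_bound tT c)
        ultimately show ?thesis using abs[of "U (w \<tau> y) - U c"] by (simp add: right_diff_distrib)
      qed
      have "\<sigma> * U c - L * n \<le> \<sigma> * U (w \<tau> y)" for y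
      proof (cases "\<sigma> * (w \<tau> y - c) \<le> 0")
        case True
        then show ?thesis using side[OF tT(2) True] mult_nonneg_nonneg[OF L(1) less_imp_le[OF n0]] by linarith
      next
        case False
        then show ?thesis using U_near[of y] by linarith
      qed
      moreover have "ess_bounded B (\<lambda>y. \<sigma> * U (w \<tau> y))"
        using abs B(2)[OF tT(1)] by (intro ess_bounded_continuous continuous_intros Uw_continuous tT) simp
      ultimately have "\<sigma> * U c - L * n \<le> expavg \<epsilon> (\<lambda>y. \<sigma> * U (w \<tau> y)) (X \<tau>)"
        using expavg_mono_AE[OF eps ess_bounded_const, of B "\<lambda>y. \<sigma> * U (w \<tau> y)" "\<sigma> * U c - L * n" "X \<tau>"]
        by (simp add: expavg_const[OF eps])
      then have "\<sigma> * (U (w \<tau> (X \<tau>)) - expavg \<epsilon> (\<lambda>y. U (w \<tau> y)) (X \<tau>)) \<le> 2 * L * n"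
        using U_near[OF pos] unfolding expavg_cmult[OF eps] right_diff_distrib by linarith
      then have "\<sigma> * (U (w \<tau> (X \<tau>)) - expavg \<epsilon> (\<lambda>y. U (w \<tau> y)) (X \<tau>)) / \<epsilon> \<le> 2 * L * n / \<epsilon>"
        using eps by (intro divide_right_mono) auto
      then show ?thesis by (simp add: drift_def)
    qed
    moreover have "((\<lambda>\<tau>. \<sigma> * (w \<tau> (X \<tau>) - c)) has_real_derivative \<sigma> * drift \<tau> (X \<tau>)) (at \<tau> within {0..r})" if "\<tau> \<in> {0..r}" for \<tau>
      using DERIV_cmult[OF DERIV_diff[OF X(2)[OF that] DERIV_const, of c], of \<sigma>] by simp
    ultimately show "\<exists>P dz. P r = x \<and> (\<forall>\<tau>\<in>{0..r}. P \<tau> \<in> UNIV \<and>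
       ((\<lambda>\<tau>. \<sigma> * (w \<tau> (P \<tau>) - c)) has_real_derivative dz \<tau>) (at \<tau> within {0..r}) \<and>
       (\<sigma> * (w \<tau> (P \<tau>) - c) > 0 \<longrightarrow> (\<forall>n. (\<forall>q\<in>UNIV. \<sigma> * (w \<tau> q - c) \<le> n) \<longrightarrow> dz \<tau> \<le> 2 * L / \<epsilon> * n)))"
      using X(1) by (intro exI[of _ X] exI[of _ "\<lambda>\<tau>. \<sigma> * drift \<tau> (X \<tau>)"]) auto
  qed (use t in auto)
qed

text \<open>The lower bound comes first: it makes \<open>w\<close> nonnegative, where \<open>U\<close> is nonincreasing, and this
  monotonicity is what the upper bound rests on.\<close>

lemma w_range:
  assumes t: "t \<in> {0..<T}" shows "w t x \<in> {lo..hi}"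
proof -
  have ge: "lo \<le> w t x" if "t \<in> {0..<T}" for t x
    using excess_nonpos[OF that lo_bound, of "- 1" x] w_initial_bounds U_antimono[OF lo_nonneg] by simp
  have "w t x \<le> hi"
  proof (cases "C \<le> hi")
    case True
    then show ?thesis using w_bound[of t x] t by auto
  next
    case False
    have "U hi \<le> U (w \<tau> y)" if "\<tau> \<in> {0..t}" "w \<tau> y \<le> hi" for \<tau> y
      using ge[of \<tau> y] that t lo_nonneg by (intro U_antimono) auto
    then show ?thesis
      using excess_nonpos[OF t, of hi 1 x] w_initial_bounds False lo_nonneg lo_le_hi by simp
  qed
  with ge[OF t] show ?thesis by simp
qed

text \<open>\<open>U\<close> is nonincreasing on the range of \<open>w\<close> and its derivative \<open>\<xi> V'(\<xi>)\<close> has slope at most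
  \<open>k1\<close>, so a lower bound for the argument gives a quadratic upper bound for the value.\<close>

lemma U_one_sided_taylor:
  assumes "a \<in> {lo..hi}" "b \<in> {lo..hi}" and s: "s \<ge> 0" "b \<ge> a - s"
  shows "U b \<le> U a - V' a * a * s + k1 * s\<^sup>2 / 2"
proof -
  have p: "V' a * a \<le> 0" using V'_nonpos[of a] assms(1) lo_nonneg by (intro mult_nonpos_nonneg) auto
  have mono: "- (V' a * a) * r + k1 * r\<^sup>2 / 2 \<le> - (V' a * a) * s + k1 * s\<^sup>2 / 2" if "0 \<le> r" "r \<le> s" for r
    using that p k(1) by (intro add_mono mult_left_mono divide_right_mono power_mono) auto
  show ?thesis
  proof (cases "a \<le> b")
    case True
    then have "U b \<le> U a" using assms(1) lo_nonneg by (intro U_antimono) auto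
    then show ?thesis using mono[of 0] s by simp
  next
    case False
    let ?G = "\<lambda>x. U x - V' a * a * (x - a) - k1 * (x - a)\<^sup>2 / 2"
    have "?G b \<le> ?G a"
    proof (rule DERIV_nonneg_imp_nondecreasing[of b a ?G])
      show "b \<le> a" using False by simp
      fix x assume x: "b \<le> x" "x \<le> a"
      have "(?G has_real_derivative V' x * x - V' a * a - k1 * (x - a)) (at x)"
        by (auto intro!: derivative_eq_intros U_DERIV)
      moreover have "V' x * x - V' a * a - k1 * (x - a) \<ge> 0"
        using moment_slope[of x a] x assms by (simp add: algebra_simps)
      ultimately show "\<exists>y. (?G has_real_derivative y) (at x) \<and> 0 \<le> y" by blast
    qed
    then have "U b \<le> U a + (- (V' a * a) * (a - b) + k1 * (a - b)\<^sup>2 / 2)"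
      by (simp add: algebra_simps power2_commute)
    then show ?thesis using mono[of "a - b"] False s by simp
  qed
qed

text \<open>If \<open>-m\<close> bounds all difference quotients from below, then \<open>w t y \<ge> w t x - m (y - x)\<close> to
  the right of \<open>x\<close>. The expansion of \<open>U\<close> can then be averaged: the exponential kernel has first
  moment \<open>\<epsilon>\<close> and second moment \<open>2 \<epsilon>\<^sup>2\<close>.\<close>

lemma drift_lower_bound:
  assumes t: "t \<in> {0..<T}" and m: "m \<ge> 0" "\<And>x y. x < y \<Longrightarrow> w t x - w t y \<le> m * (y - x)"
  shows "drift t x \<ge> V' (w t x) * w t x * m - k1 * m\<^sup>2 * \<epsilon>"
proof -
  have tT: "t \<in> {0..T}" using t by auto
  obtain B where B: "B \<ge> 0" "\<And>t x. t \<in> {0..T} \<Longrightarrow> \<bar>U (w t x)\<bar> \<le> B" using compose_w_bounded[OF U_cont] by blast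
  have e: "ess_bounded B (\<lambda>y. U (w t y))" by (intro ess_bounded_continuous Uw_continuous B tT)
  let ?p = "V' (w t x) * w t x" and ?k = "ekernel \<epsilon> x"
  note K = ekernel_integral[OF eps, of x]
  have i2: "integrable lebesgue (\<lambda>y. U (w t x) * ?k y - ?p * m * (?k y * (y - x)) + k1 * m\<^sup>2 / 2 * (?k y * (y - x)\<^sup>2))"
    by (intro Bochner_Integration.integrable_add Bochner_Integration.integrable_diff integrable_mult_right K)
  have "(LINT y|lebesgue. ?k y * U (w t y)) \<le>
    (LINT y|lebesgue. U (w t x) * ?k y - ?p * m * (?k y * (y - x)) + k1 * m\<^sup>2 / 2 * (?k y * (y - x)\<^sup>2))"
  proof (rule integral_mono[OF expavg_integrable[OF eps e] i2])
    fix y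
    show "?k y * U (w t y) \<le> U (w t x) * ?k y - ?p * m * (?k y * (y - x)) + k1 * m\<^sup>2 / 2 * (?k y * (y - x)\<^sup>2)"
    proof (cases "x < y")
      case True
      have "U (w t y) \<le> U (w t x) - ?p * (m * (y - x)) + k1 * (m * (y - x))\<^sup>2 / 2"
        using m(2)[OF True] True m(1) by (intro U_one_sided_taylor w_range t) auto
      then have "?k y * U (w t y) \<le> ?k y * (U (w t x) - ?p * (m * (y - x)) + k1 * (m * (y - x))\<^sup>2 / 2)"
        by (intro mult_left_mono ekernel_nonneg)
      then show ?thesis unfolding power_mult_distrib by (simp add: algebra_simps)
    next
      case False
      then show ?thesis by (simp add: ekernel_def)
    qed
  qed
  also have "\<dots> = U (w t x) * \<epsilon> - ?p * m * \<epsilon>\<^sup>2 + k1 * m\<^sup>2 / 2 * (2 * \<epsilon> ^ 3)"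
    using K by (subst Bochner_Integration.integral_add) (auto intro!: Bochner_Integration.integrable_diff integrable_mult_right)
  also have "\<dots> = \<epsilon> * (U (w t x) - (?p * m - k1 * m\<^sup>2 * \<epsilon>) * \<epsilon>)"
    by (simp add: algebra_simps power2_eq_square power3_eq_cube)
  finally have "(1 / \<epsilon>) * (LINT y|lebesgue. ?k y * U (w t y)) \<le> (1 / \<epsilon>) * (\<epsilon> * (U (w t x) - (?p * m - k1 * m\<^sup>2 * \<epsilon>) * \<epsilon>))"
    using eps by (intro mult_left_mono) auto
  then have "expavg \<epsilon> (\<lambda>y. U (w t y)) x \<le> U (w t x) - (?p * m - k1 * m\<^sup>2 * \<epsilon>) * \<epsilon>"
    using eps by (simp add: expavg_def)
  then have "(?p * m - k1 * m\<^sup>2 * \<epsilon>) * \<epsilon> \<le> U (w t x) - expavg \<epsilon> (\<lambda>y. U (w t y)) x" by linarith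
  then show ?thesis unfolding drift_def using eps by (simp add: le_divide_eq)
qed

lemma moment_bound: obtains P where "P \<ge> 0" "\<And>\<xi>. \<xi> \<in> {lo..hi} \<Longrightarrow> - P \<le> V' \<xi> * \<xi>"
proof -
  obtain B where "B \<ge> 0" "\<And>x. x \<in> {lo..hi} \<Longrightarrow> \<bar>V' x * x\<bar> \<le> B"
    using continuous_on_Icc_bounded[of lo hi "\<lambda>\<xi>. V' \<xi> * \<xi>"]
      continuous_on_mult[OF continuous_on_subset[OF V'_cont subset_UNIV] continuous_on_id] by blast
  then show ?thesis by (intro that[of B]) (auto simp: abs_le_iff minus_le_iff)
qed

text \<open>Formally \<open>\<epsilon> \<partial>\<^sub>x drift = p(w) \<partial>\<^sub>x w + drift\<close> with \<open>p(\<xi>) = \<xi> V'(\<xi>)\<close>, since the average \<open>Q\<close> of \<open>U (w t \<cdot>)\<close>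
  satisfies \<open>\<partial>\<^sub>x Q = - drift\<close>. Inserting the lower bound for the drift leaves
  \<open>p(w) (\<partial>\<^sub>x w + m)\<close>, where \<open>\<partial>\<^sub>x w + m \<ge> 0\<close> and \<open>p(w) \<ge> -P\<close>. As \<open>w\<close> is only Lipschitz, this is carried
  out for small increments, by showing that \<open>\<Psi>\<close> below is nondecreasing.\<close>

lemma drift_difference:
  assumes P: "P \<ge> 0" "\<And>\<xi>. \<xi> \<in> {lo..hi} \<Longrightarrow> - P \<le> V' \<xi> * \<xi>"
    and t: "t \<in> {0..<T}" and m: "m \<ge> 0" "\<And>x y. x < y \<Longrightarrow> w t x - w t y \<le> m * (y - x)"
    and xy: "a < b"
  shows "drift t a - drift t b \<le> P / \<epsilon> * (w t b - w t a + m * (b - a)) + k1 * m\<^sup>2 * (b - a)"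
proof -
  have tT: "t \<in> {0..T}" using t by auto
  obtain B where B: "B \<ge> 0" "\<And>t x. t \<in> {0..T} \<Longrightarrow> \<bar>U (w t x)\<bar> \<le> B" using compose_w_bounded[OF U_cont] by blast
  let ?Q = "expavg \<epsilon> (\<lambda>y. U (w t y))"
  have dQ: "(?Q has_real_derivative - drift t x) (at x)" for x
  proof -
    have "(?Q has_real_derivative (?Q x - U (w t x)) / \<epsilon>) (at x)"
      by (rule expavg_DERIV[OF eps Uw_continuous[OF tT] B(2)[OF tT]])
    moreover have "(?Q x - U (w t x)) / \<epsilon> = - drift t x" by (simp add: drift_def diff_divide_distrib)
    ultimately show ?thesis by simp
  qed
  define L where "L = 2 * C / \<epsilon>"
  have L: "L \<ge> 0" using C_nonneg eps by (simp add: L_def)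
  let ?p = "\<lambda>\<xi>. V' \<xi> * \<xi>"
  let ?\<Psi> = "\<lambda>y. U (w t y) - ?Q y + P * (w t y + m * y) + k1 * m\<^sup>2 * \<epsilon> * y"
  have "?\<Psi> a \<le> ?\<Psi> b"
  proof (rule mono_of_local_increments[OF _ xy])
    fix e :: real assume "e > 0"
    have "uniformly_continuous_on {lo..hi} ?p"
      by (intro compact_uniformly_continuous continuous_intros continuous_on_subset[OF V'_cont]) auto
    moreover have "e / (m + 1) > 0" using \<open>e > 0\<close> m(1) by simp
    ultimately obtain d where d: "d > 0" "\<And>x y. x \<in> {lo..hi} \<Longrightarrow> y \<in> {lo..hi} \<Longrightarrow> \<bar>x - y\<bar> < d \<Longrightarrow> \<bar>?p x - ?p y\<bar> < e / (m + 1)"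
      unfolding uniformly_continuous_on_def dist_real_def by metis
    show "\<exists>d>0. \<forall>y y'. y < y' \<longrightarrow> y' < y + d \<longrightarrow> ?\<Psi> y' - ?\<Psi> y \<ge> - e * (y' - y)"
    proof (intro exI[of _ "d / (2 * L + 1)"] conjI allI impI)
      show "d / (2 * L + 1) > 0" using d(1) L by simp
      fix y y' assume y: "y < y'" "y' < y + d / (2 * L + 1)"
      let ?h = "y' - y"
      have "?h < d / (2 * L + 1)" using y by simp
      then have Lh: "(2 * L + 1) * ?h < d" using L by (simp add: less_divide_eq mult.commute)
      have wl: "\<bar>w t x - w t z\<bar> \<le> L * \<bar>x - z\<bar>" for x z using w_lipschitz[OF tT] by (simp add: L_def)
      have "\<exists>\<theta>\<in>{lo..hi}. \<bar>\<theta> - w t y\<bar> \<le> \<bar>w t y' - w t y\<bar> \<and> U (w t y') - U (w t y) = ?p \<theta> * (w t y' - w t y)"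
      proof (cases "w t y" "w t y'" rule: linorder_cases)
        case less
        from MVT2[OF this, of U ?p] U_DERIV obtain z where "w t y < z" "z < w t y'"
          "U (w t y') - U (w t y) = (w t y' - w t y) * ?p z" by blast
        then show ?thesis using w_range[OF t, of y] w_range[OF t, of y'] by (intro bexI[of _ z]) auto
      next
        case equal
        then show ?thesis using w_range[OF t, of y] by (intro bexI[of _ "w t y"]) auto
      next
        case greater
        from MVT2[OF this, of U ?p] U_DERIV obtain z where "w t y' < z" "z < w t y"
          "U (w t y) - U (w t y') = (w t y - w t y') * ?p z" by blast
        then show ?thesis using w_range[OF t, of y] w_range[OF t, of y']
          by (intro bexI[of _ z]) (auto simp: algebra_simps)
      qed
      then obtain \<theta> where th: "\<theta> \<in> {lo..hi}" "\<bar>\<theta> - w t y\<bar> \<le> \<bar>w t y' - w t y\<bar>"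
        "U (w t y') - U (w t y) = ?p \<theta> * (w t y' - w t y)" by blast
      from MVT2[OF y(1) dQ] obtain \<xi> where xi: "y < \<xi>" "\<xi> < y'" "?Q y' - ?Q y = ?h * - drift t \<xi>" by blast
      have dl: "(?p (w t \<xi>) * m - k1 * m\<^sup>2 * \<epsilon>) * ?h \<le> drift t \<xi> * ?h"
        using y by (intro mult_right_mono drift_lower_bound[OF t m]) auto
      have "\<bar>w t \<xi> - \<theta>\<bar> < d"
      proof -
        have "\<bar>w t \<xi> - w t y\<bar> \<le> L * ?h"
          using wl[of \<xi> y] mult_left_mono[of "\<bar>\<xi> - y\<bar>" ?h L] xi L by simp
        moreover have "\<bar>\<theta> - w t y\<bar> \<le> L * ?h" using wl[of y' y] th(2) y by simp
        ultimately have "\<bar>w t \<xi> - \<theta>\<bar> \<le> 2 * L * ?h" by linarith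
        also have "\<dots> \<le> (2 * L + 1) * ?h" using y by (simp add: algebra_simps)
        finally show ?thesis using Lh by simp
      qed
      then have pe: "?p (w t \<xi>) - ?p \<theta> \<ge> - (e / (m + 1))"
        using d(2)[OF w_range[OF t, of \<xi>] th(1)] by (simp add: abs_less_iff)
      have "m * (?p (w t \<xi>) - ?p \<theta>) \<ge> m * (- (e / (m + 1)))" using pe m(1) by (intro mult_left_mono) auto
      moreover have "m * (e / (m + 1)) \<le> e" using m(1) \<open>e > 0\<close> by (simp add: field_simps)
      ultimately have pe': "m * (?p (w t \<xi>) - ?p \<theta>) \<ge> - e" by simp
      have slope: "(P + ?p \<theta>) * (w t y' - w t y + m * ?h) \<ge> 0"
        using P(2)[OF th(1)] m(2)[OF y(1)] by (intro mult_nonneg_nonneg) auto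
      have "?\<Psi> y' - ?\<Psi> y = ?p \<theta> * (w t y' - w t y) + drift t \<xi> * ?h + P * (w t y' - w t y + m * ?h) + k1 * m\<^sup>2 * \<epsilon> * ?h"
        using th(3) xi(3) by (simp add: algebra_simps)
      also have "\<dots> \<ge> ?p \<theta> * (w t y' - w t y) + (?p (w t \<xi>) * m - k1 * m\<^sup>2 * \<epsilon>) * ?h + P * (w t y' - w t y + m * ?h) + k1 * m\<^sup>2 * \<epsilon> * ?h"
        using dl by simp
      also have "?p \<theta> * (w t y' - w t y) + (?p (w t \<xi>) * m - k1 * m\<^sup>2 * \<epsilon>) * ?h + P * (w t y' - w t y + m * ?h) + k1 * m\<^sup>2 * \<epsilon> * ?h
         = (P + ?p \<theta>) * (w t y' - w t y + m * ?h) + (m * (?p (w t \<xi>) - ?p \<theta>)) * ?h"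
        by (simp add: algebra_simps)
      also have "\<dots> \<ge> 0 + (- e) * ?h"
        using slope pe' y by (intro add_mono mult_right_mono) auto
      finally show "- e * (y' - y) \<le> ?\<Psi> y' - ?\<Psi> y" by simp
    qed
  qed
  then have "(U (w t a) - ?Q a) - (U (w t b) - ?Q b) \<le> P * (w t b - w t a + m * (b - a)) + k1 * m\<^sup>2 * \<epsilon> * (b - a)"
    by (simp add: algebra_simps)
  then have "((U (w t a) - ?Q a) - (U (w t b) - ?Q b)) / \<epsilon> \<le> (P * (w t b - w t a + m * (b - a)) + k1 * m\<^sup>2 * \<epsilon> * (b - a)) / \<epsilon>"
    using eps by (intro divide_right_mono) auto
  then show ?thesis using eps by (simp add: drift_def diff_divide_distrib add_divide_distrib)
qed

text \<open>If two characteristics met, the squared distance from then on would be zero by Gronwall.\<close>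

lemma characteristics_ordered:
  assumes s: "s < T" and
    X: "\<And>\<tau>. \<tau> \<in> {0..s} \<Longrightarrow> (X has_real_derivative V (w \<tau> (X \<tau>))) (at \<tau> within {0..s})" and
    Y: "\<And>\<tau>. \<tau> \<in> {0..s} \<Longrightarrow> (Y has_real_derivative V (w \<tau> (Y \<tau>))) (at \<tau> within {0..s})" and
    lt: "X s < Y s" and t: "t \<in> {0..s}"
  shows "X t < Y t"
proof (rule ccontr)
  assume "\<not> X t < Y t"
  let ?D = "\<lambda>\<tau>. Y \<tau> - X \<tau>"
  have cD: "continuous_on {t..s} ?D"
  proof -
    have "continuous_on {0..s} X" "continuous_on {0..s} Y"
      unfolding continuous_on_eq_continuous_within using DERIV_continuous[OF X] DERIV_continuous[OF Y] by blast+
    then have "continuous_on {0..s} ?D" by (intro continuous_on_diff)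
    then show ?thesis by (rule continuous_on_subset) (use t in auto)
  qed
  obtain c where c: "t \<le> c" "c \<le> s" "?D c = 0"
    using IVT'[of ?D t 0 s] cD \<open>\<not> X t < Y t\<close> lt t by auto
  obtain L where L: "L \<ge> 0" "\<And>t x y. t \<in> {0..T} \<Longrightarrow> \<bar>V (w t x) - V (w t y)\<bar> \<le> L * \<bar>x - y\<bar>"
    using velocity_lipschitz by blast
  let ?v = "\<lambda>\<tau>. V (w \<tau> (Y \<tau>)) - V (w \<tau> (X \<tau>))"
  let ?e' = "\<lambda>\<tau>. exp (- (2 * L) * \<tau>) * (2 * (?D \<tau> * ?v \<tau>) - 2 * L * (?D \<tau>)\<^sup>2)"
  have "(?D s)\<^sup>2 * exp (- (2 * L) * s) \<le> 0"
  proof (rule barrier_nonpos[of c s "\<lambda>\<tau>. (?D \<tau>)\<^sup>2 * exp (- (2 * L) * \<tau>)" ?e'])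
    show "c \<le> s" "(?D c)\<^sup>2 * exp (- (2 * L) * c) \<le> 0" using c by auto
    fix \<tau> assume "\<tau> \<in> {c..s}"
    then have tau: "\<tau> \<in> {0..s}" using c t by auto
    have sub: "{c..s} \<subseteq> {0..s}" using c t by auto
    have dD: "(?D has_real_derivative ?v \<tau>) (at \<tau> within {c..s})"
      using sub X[OF tau] Y[OF tau] by (intro DERIV_diff) (auto intro: has_field_derivative_subset)
    have dE: "((\<lambda>\<tau>. exp (- (2 * L) * \<tau>)) has_real_derivative exp (- (2 * L) * \<tau>) * (- (2 * L))) (at \<tau> within {c..s})"
      by (auto intro!: derivative_eq_intros)
    show "((\<lambda>\<tau>. (?D \<tau>)\<^sup>2 * exp (- (2 * L) * \<tau>)) has_real_derivative ?e' \<tau>) (at \<tau> within {c..s})"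
      unfolding power2_eq_square
      by (rule DERIV_cong[OF DERIV_mult[OF DERIV_mult[OF dD dD] dE]]) (simp add: algebra_simps)
    have tT: "\<tau> \<in> {0..T}" using tau s by auto
    have "\<bar>?v \<tau>\<bar> \<le> L * \<bar>?D \<tau>\<bar>" by (rule L(2)[OF tT])
    then have "\<bar>?D \<tau>\<bar> * \<bar>?v \<tau>\<bar> \<le> \<bar>?D \<tau>\<bar> * (L * \<bar>?D \<tau>\<bar>)" by (intro mult_left_mono) auto
    then have "\<bar>?D \<tau> * ?v \<tau>\<bar> \<le> L * (?D \<tau>)\<^sup>2" by (simp add: abs_mult power2_eq_square mult.left_commute)
    then have "2 * (?D \<tau> * ?v \<tau>) - 2 * L * (?D \<tau>)\<^sup>2 \<le> 0" by linarith
    then show "?e' \<tau> \<le> 0" by (simp add: mult_le_0_iff)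
  qed
  then show False using lt by (simp add: mult_le_0_iff)
qed

text \<open>For a pair of characteristics with quotient \<open>F = (w X - w Y) / (Y - X)\<close>, the compression
  \<open>(Y - X)' = V (w Y) - V (w X)\<close> contributes at most \<open>-k2 F\<^sup>2\<close> to \<open>F'\<close> and the drift contributes at most
  \<open>k1 m\<^sup>2 + (P / \<epsilon>) (m - F)\<close>, where \<open>m\<close> bounds all quotients at that time. Hence
  \<open>F' \<le> -\<kappa> F\<^sup>2 + A (m - F)\<close>. For \<open>z = \<tau> F - 1 / \<kappa>\<close> the Riccati term is harmless where \<open>z > 0\<close>, and
  \<open>\<tau> (m - F)\<close> is at most the supremum of \<open>z\<close> over all pairs, as Gronwall's argument requires; the
  factor \<open>\<tau>\<close> makes the initial condition trivial.\<close>

lemma one_sided_bound: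
  assumes t: "t \<in> {0<..<T}" and xy: "a < b"
  shows "w t a - w t b \<le> 1 / ((k2 - k1) * t) * (b - a)"
proof -
  define \<kappa> where "\<kappa> = k2 - k1"
  have kappa: "\<kappa> > 0" using k by (simp add: \<kappa>_def)
  define M where "M = 2 * C / \<epsilon>"
  have M: "M \<ge> 0" using C_nonneg eps by (simp add: M_def)
  obtain P where P: "P \<ge> 0" "\<And>\<xi>. \<xi> \<in> {lo..hi} \<Longrightarrow> - P \<le> V' \<xi> * \<xi>" using moment_bound by blast
  define sl where "sl = (\<lambda>\<tau> (x, y). (w \<tau> x - w \<tau> y) / (y - x))"
  define Q where "Q = {(x :: real, y). x < y}"
  have slM: "sl \<tau> q \<le> M" if tau: "\<tau> \<in> {0..T}" and qQ: "q \<in> Q" for \<tau> q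
  proof -
    obtain x y where q: "q = (x, y)" "x < y" using qQ unfolding Q_def by blast
    have "w \<tau> x - w \<tau> y \<le> M * (y - x)" using w_lipschitz[OF tau, of x y] q by (simp add: M_def)
    then show ?thesis using q by (simp add: sl_def divide_le_eq)
  qed
  define A where "A = P / \<epsilon> + 2 * k1 * M"
  have "t * sl t (a, b) - 1 / \<kappa> \<le> 0"
  proof (rule sup_gronwall[where z = "\<lambda>\<tau> q. \<tau> * sl \<tau> q - 1 / \<kappa>" and s = t and Q = Q and A = A and B = "T * M"])
    show "0 \<le> A" using P eps k M by (simp add: A_def)
    show "r * sl r q - 1 / \<kappa> \<le> T * M" if "r \<in> {0..t}" "q \<in> Q" for r q
    proof -
      have rT: "r \<in> {0..T}" using that t by auto
      have "r * sl r q \<le> r * M" using slM[OF rT that(2)] that by (intro mult_left_mono) auto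
      also have "\<dots> \<le> T * M" using rT M by (intro mult_right_mono) auto
      finally show ?thesis using kappa by (smt (verit) divide_pos_pos)
    qed
    show "0 * sl 0 q - 1 / \<kappa> \<le> 0" for q using kappa by simp
    fix r q assume r: "r \<in> {0..t}" and q: "q \<in> Q"
    obtain x y where xy: "q = (x, y)" "x < y" using q unfolding Q_def by blast
    have rT: "r \<in> {0..<T}" "r < T" using r t by auto
    obtain X where X: "X r = x"
      "\<And>\<tau>. \<tau> \<in> {0..r} \<Longrightarrow> (X has_real_derivative V (w \<tau> (X \<tau>))) (at \<tau> within {0..r})"
      "\<And>\<tau>. \<tau> \<in> {0..r} \<Longrightarrow> ((\<lambda>\<tau>. w \<tau> (X \<tau>)) has_real_derivative drift \<tau> (X \<tau>)) (at \<tau> within {0..r})"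
      using w_along[OF rT(1), of x] by blast
    obtain Y where Y: "Y r = y"
      "\<And>\<tau>. \<tau> \<in> {0..r} \<Longrightarrow> (Y has_real_derivative V (w \<tau> (Y \<tau>))) (at \<tau> within {0..r})"
      "\<And>\<tau>. \<tau> \<in> {0..r} \<Longrightarrow> ((\<lambda>\<tau>. w \<tau> (Y \<tau>)) has_real_derivative drift \<tau> (Y \<tau>)) (at \<tau> within {0..r})"
      using w_along[OF rT(1), of y] by blast
    have XY: "X \<tau> < Y \<tau>" if "\<tau> \<in> {0..r}" for \<tau>
      using characteristics_ordered[OF rT(2) X(2) Y(2) _ that] X(1) Y(1) xy(2) by auto
    let ?f = "\<lambda>\<tau>. (w \<tau> (X \<tau>) - w \<tau> (Y \<tau>)) / (Y \<tau> - X \<tau>)"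
    let ?D = "\<lambda>\<tau>. Y \<tau> - X \<tau>"
    let ?f' = "\<lambda>\<tau>. ((drift \<tau> (X \<tau>) - drift \<tau> (Y \<tau>)) * ?D \<tau> - (w \<tau> (X \<tau>) - w \<tau> (Y \<tau>)) * (V (w \<tau> (Y \<tau>)) - V (w \<tau> (X \<tau>)))) / (?D \<tau> * ?D \<tau>)"
    have df: "(?f has_real_derivative ?f' \<tau>) (at \<tau> within {0..r})" if tau: "\<tau> \<in> {0..r}" for \<tau>
      by (intro DERIV_divide DERIV_diff X(2,3) Y(2,3) tau) (use XY[OF tau] in simp)
    have dz: "((\<lambda>\<tau>. \<tau> * ?f \<tau> - 1 / \<kappa>) has_real_derivative ?f \<tau> + \<tau> * ?f' \<tau>) (at \<tau> within {0..r})" if tau: "\<tau> \<in> {0..r}" for \<tau>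
      using DERIV_diff[OF DERIV_mult[OF DERIV_ident df[OF tau]] DERIV_const, of "1 / \<kappa>"] by (simp add: add.commute mult.commute)
    have key: "?f \<tau> + \<tau> * ?f' \<tau> \<le> A * n"
      if tau: "\<tau> \<in> {0..r}" and pos: "\<tau> * ?f \<tau> - 1 / \<kappa> > 0" and n: "\<And>q. q \<in> Q \<Longrightarrow> \<tau> * sl \<tau> q - 1 / \<kappa> \<le> n" for \<tau> n
    proof -
      have tT: "\<tau> \<in> {0..<T}" "\<tau> \<in> {0..T}" using tau rT by auto
      let ?x = "X \<tau>" and ?y = "Y \<tau>"
      define F where "F = ?f \<tau>"
      have pos': "\<tau> * F - 1 / \<kappa> > 0" using pos by (simp only: F_def)
      have D: "?D \<tau> > 0" using XY[OF tau] by simp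
      have wD: "w \<tau> ?x - w \<tau> ?y = F * ?D \<tau>" using D by (simp add: F_def)
      have inQ: "(?x, ?y) \<in> Q" using D by (simp add: Q_def)
      have fsl: "sl \<tau> (?x, ?y) = F" by (simp add: sl_def F_def)
      have tau0: "\<tau> > 0" using pos tau kappa by (cases "\<tau> = 0") auto
      have "1 / \<kappa> > 0" using kappa by simp
      then have "\<tau> * F > 0" using pos' by linarith
      then have f0: "F > 0" using tau0 by (simp add: zero_less_mult_iff)
      \<comment> \<open>both a priori bounds at once: \<open>n\<close> controls \<open>\<tau> m\<close>, and \<open>M\<close> keeps the quadratic terms linear\<close>
      define m where "m = min M ((1 / \<kappa> + n) / \<tau>)"
      have msl: "sl \<tau> q \<le> m" if "q \<in> Q" for q
        using slM[OF tT(2) that] n[OF that] tau0 by (simp add: m_def le_divide_eq mult.commute)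
      have fm: "F \<le> m" using msl[OF inQ] by (simp add: fsl)
      have m0: "m \<ge> 0" using fm f0 by simp
      have mM: "m \<le> M" by (simp add: m_def)
      have ms: "w \<tau> x - w \<tau> y \<le> m * (y - x)" if "x < y" for x y
        using msl[of "(x, y)"] that by (simp add: Q_def sl_def divide_le_eq)
      have "\<tau> * m \<le> 1 / \<kappa> + n"
      proof -
        have "m \<le> (1 / \<kappa> + n) / \<tau>" by (simp add: m_def)
        then show ?thesis using tau0 by (simp add: le_divide_eq mult.commute)
      qed
      then have mn: "\<tau> * (m - F) \<le> n" using pos' unfolding right_diff_distrib by linarith
      have "drift \<tau> ?x - drift \<tau> ?y \<le> P / \<epsilon> * (w \<tau> ?y - w \<tau> ?x + m * ?D \<tau>) + k1 * m\<^sup>2 * ?D \<tau>"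
        by (rule drift_difference[OF P tT(1) m0 ms XY[OF tau]])
      also have "w \<tau> ?y - w \<tau> ?x + m * ?D \<tau> = (m - F) * ?D \<tau>"
        using wD by (simp only: left_diff_distrib)
      also have "P / \<epsilon> * ((m - F) * ?D \<tau>) + k1 * m\<^sup>2 * ?D \<tau> = (P / \<epsilon> * (m - F) + k1 * m\<^sup>2) * ?D \<tau>"
        by (simp only: distrib_right mult.assoc)
      finally have r1: "(drift \<tau> ?x - drift \<tau> ?y) / ?D \<tau> \<le> P / \<epsilon> * (m - F) + k1 * m\<^sup>2"
        using D by (subst divide_le_eq) simp
      have "w \<tau> ?y < w \<tau> ?x" using wD mult_pos_pos[OF f0 D] by linarith
      from MVT2[OF this V_DERIV] obtain \<theta> where th: "w \<tau> ?y < \<theta>" "\<theta> < w \<tau> ?x"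
        "V (w \<tau> ?x) - V (w \<tau> ?y) = (w \<tau> ?x - w \<tau> ?y) * V' \<theta>" by blast
      have "\<theta> \<in> {lo..hi}" using th(1,2) w_range[OF tT(1), of ?x] w_range[OF tT(1), of ?y] by auto
      then have Vth: "V' \<theta> \<le> - k2" by (rule V'_le)
      have "V (w \<tau> ?x) - V (w \<tau> ?y) = F * ?D \<tau> * V' \<theta>" using th(3) by (simp only: wD)
      then have dV: "V (w \<tau> ?y) - V (w \<tau> ?x) = - (F * ?D \<tau> * V' \<theta>)" by linarith
      have alg: "(R * d - (f * d) * (- (f * d * v))) / (d * d) = R / d + v * f\<^sup>2" if "d > 0" for R d f v :: real
        using that by (simp add: field_simps power2_eq_square)
      have "?f' \<tau> = (drift \<tau> ?x - drift \<tau> ?y) / ?D \<tau> + V' \<theta> * F\<^sup>2"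
        by (simp only: wD dV alg[OF D])
      also have "\<dots> \<le> (P / \<epsilon> * (m - F) + k1 * m\<^sup>2) + (- k2) * F\<^sup>2"
        using Vth by (intro add_mono r1 mult_right_mono) auto
      also have "\<dots> = - \<kappa> * F\<^sup>2 + (P / \<epsilon> + k1 * (m + F)) * (m - F)"
        by (simp add: \<kappa>_def algebra_simps power2_eq_square)
      also have "\<dots> \<le> - \<kappa> * F\<^sup>2 + A * (m - F)"
      proof -
        have "k1 * (m + F) \<le> k1 * (2 * M)" using fm mM k by (intro mult_left_mono) auto
        then show ?thesis unfolding A_def using fm by (intro add_left_mono mult_right_mono) auto
      qed
      finally have "\<tau> * ?f' \<tau> \<le> \<tau> * (- \<kappa> * F\<^sup>2 + A * (m - F))" using tau0 by (intro mult_left_mono) auto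
      also have "\<dots> = F * (1 - \<kappa> * (\<tau> * F)) + A * (\<tau> * (m - F)) - F"
        by (simp add: algebra_simps power2_eq_square)
      finally have "F + \<tau> * ?f' \<tau> \<le> F * (1 - \<kappa> * (\<tau> * F)) + A * (\<tau> * (m - F))" by linarith
      moreover have "F * (1 - \<kappa> * (\<tau> * F)) \<le> 0"
      proof -
        have "\<kappa> * (\<tau> * F) \<ge> \<kappa> * (1 / \<kappa>)" using pos' kappa by (intro mult_left_mono) auto
        then show ?thesis using f0 kappa by (intro mult_nonneg_nonpos) auto
      qed
      moreover have "A * (\<tau> * (m - F)) \<le> A * n"
        using mn P eps k M by (intro mult_left_mono) (auto simp: A_def)
      ultimately have "F + \<tau> * ?f' \<tau> \<le> A * n" by linarith
      then show ?thesis by (simp only: F_def)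
    qed
    have fs: "sl \<tau> (X \<tau>, Y \<tau>) = ?f \<tau>" for \<tau> by (simp add: sl_def)
    show "\<exists>P dz. P r = q \<and> (\<forall>\<tau>\<in>{0..r}. P \<tau> \<in> Q \<and>
       ((\<lambda>\<tau>. \<tau> * sl \<tau> (P \<tau>) - 1 / \<kappa>) has_real_derivative dz \<tau>) (at \<tau> within {0..r}) \<and>
       (\<tau> * sl \<tau> (P \<tau>) - 1 / \<kappa> > 0 \<longrightarrow> (\<forall>n. (\<forall>q\<in>Q. \<tau> * sl \<tau> q - 1 / \<kappa> \<le> n) \<longrightarrow> dz \<tau> \<le> A * n)))"
    proof (intro exI[of _ "\<lambda>\<tau>. (X \<tau>, Y \<tau>)"] exI[of _ "\<lambda>\<tau>. ?f \<tau> + \<tau> * ?f' \<tau>"] conjI ballI impI allI)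
      show "(X r, Y r) = q" using X(1) Y(1) xy by simp
      fix \<tau> assume tau: "\<tau> \<in> {0..r}"
      show "(X \<tau>, Y \<tau>) \<in> Q" using XY[OF tau] by (simp add: Q_def)
      show "((\<lambda>\<tau>. \<tau> * sl \<tau> (X \<tau>, Y \<tau>) - 1 / \<kappa>) has_real_derivative ?f \<tau> + \<tau> * ?f' \<tau>) (at \<tau> within {0..r})"
        unfolding fs by (rule dz[OF tau])
      fix n assume "\<tau> * sl \<tau> (X \<tau>, Y \<tau>) - 1 / \<kappa> > 0" "\<forall>q\<in>Q. \<tau> * sl \<tau> q - 1 / \<kappa> \<le> n"
      then show "?f \<tau> + \<tau> * ?f' \<tau> \<le> A * n" unfolding fs by (intro key[OF tau]) auto
    qed
  qed (use t xy in \<open>auto simp: Q_def\<close>)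
  then have "\<kappa> * (t * sl t (a, b)) \<le> \<kappa> * (1 / \<kappa>)" using kappa by (intro mult_left_mono) auto
  then have "sl t (a, b) * (\<kappa> * t) \<le> 1" using kappa by (simp add: mult_ac)
  then have "sl t (a, b) \<le> 1 / (\<kappa> * t)" using kappa t by (subst le_divide_eq) auto
  then have "w t a - w t b \<le> 1 / (\<kappa> * t) * (b - a)"
    using xy by (simp add: sl_def divide_le_eq)
  then show ?thesis by (simp add: \<kappa>_def)
qed

end

section \<open>The Oleinik estimate\<close>

lemma ess_range_bounds:
  assumes f: "f \<in> borel_measurable lebesgue" and b: "AE x in lebesgue. \<bar>f x\<bar> \<le> B" and nn: "AE x in lebesgue. 0 \<le> f x"
  obtains lo hi where "0 \<le> lo" "ess_range_interval f = {lo..hi}" "AE x in lebesgue. lo \<le> f x \<and> f x \<le> hi"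
proof -
  have ne: "emeasure lebesgue (space (lebesgue :: real measure)) \<noteq> 0" by simp
  have real: "\<exists>r. esssup lebesgue (\<lambda>x. ereal (g x)) = ereal r \<and> (AE x in lebesgue. g x \<le> r) \<and> r \<le> d"
    if g: "g \<in> borel_measurable lebesgue" and up: "AE x in lebesgue. g x \<le> d" and low: "AE x in lebesgue. c \<le> g x"
    for g :: "real \<Rightarrow> real" and c d
  proof -
    let ?E = "esssup lebesgue (\<lambda>x. ereal (g x))"
    have m: "(\<lambda>x. ereal (g x)) \<in> borel_measurable lebesgue" using g by simp
    have "?E \<le> ereal d" using up by (intro esssup_I m) auto
    moreover have "ereal c \<le> ?E"
    proof -
      have "esssup lebesgue (\<lambda>x :: real. ereal c) \<le> ?E" 
        by (rule esssup_AE_mono) (use low in auto)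
      then show ?thesis by (simp add: esssup_const[OF ne])
    qed
    ultimately obtain r where r: "?E = ereal r" "r \<le> d" by (cases ?E) auto
    have "AE x in lebesgue. ereal (g x) \<le> ?E" by (rule esssup_AE)
    then have "AE x in lebesgue. g x \<le> r" using r by simp
    with r show ?thesis by blast
  qed
  obtain hi where hi: "ess_sup f = ereal hi" "AE x in lebesgue. f x \<le> hi"
    using real[OF f, of B 0] b nn by (auto simp: ess_sup_def abs_le_iff)
  have "AE x in lebesgue. - f x \<le> 0" "AE x in lebesgue. - B \<le> - f x" using b nn by auto
  then obtain r where r: "esssup lebesgue (\<lambda>x. ereal (- f x)) = ereal r" "AE x in lebesgue. - f x \<le> r" "r \<le> 0"
    using real[of "\<lambda>x. - f x" 0 "- B"] f by auto
  have lo: "ess_inf f = ereal (- r)" using r by (simp add: ess_inf_def ess_sup_def)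
  show ?thesis
  proof (rule that)
    show "0 \<le> - r" using r by simp
    show "ess_range_interval f = {- r..hi}" unfolding ess_range_interval_def lo hi(1) by auto
    show "AE x in lebesgue. - r \<le> f x \<and> f x \<le> hi" using r(2) hi(2) by eventually_elim auto
  qed
qed

lemma antimono_DERIV_nonpos:
  assumes "antimono V" "(V has_real_derivative d) (at (x :: real))"
  shows "d \<le> (0 :: real)"
proof (rule ccontr)
  assume "\<not> d \<le> 0"
  then obtain e where e: "e > 0" "\<And>h. 0 < h \<Longrightarrow> h < e \<Longrightarrow> V x < V (x + h)"
    using DERIV_pos_inc_right[OF assms(2)] by auto
  from e(2)[of "e / 2"] e(1) antimonoD[OF assms(1), of x "x + e / 2"] show False by simp
qed

theorem theorem2p1:
  fixes V V' V'' \<rho>0 :: "real \<Rightarrow> real"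
    and \<rho> :: "real \<Rightarrow> real \<Rightarrow> real"
    and \<kappa>1 \<kappa>2 \<kappa> \<epsilon> :: real
  assumes "0 < \<kappa>1" and "\<kappa>1 < \<kappa>2"
    and "\<rho>0 \<in> Linf" and "AE x in lebesgue. 0 \<le> \<rho>0 x"
    and "W2inf_loc V V' V''" and "antimono V"
    and "(\<exists>\<delta>. cond_A V' \<rho>0 \<delta> \<and> \<kappa> = \<delta>) \<or> (cond_B V' V'' \<rho>0 \<kappa>1 \<kappa>2 \<and> \<kappa> = \<kappa>2 - \<kappa>1)"
    and "\<epsilon> > 0"
    and "\<forall>T>0. weak_solution V \<rho>0 \<epsilon> T \<rho>"
  shows "\<forall>t>0. \<forall>x y. x \<noteq> y \<longrightarrow>
           (W \<epsilon> \<rho> t x - W \<epsilon> \<rho> t y) / (x - y) \<ge> - (1 / (\<kappa> * t))"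
proof -
  obtain B where B: "\<rho>0 \<in> borel_measurable lebesgue" "AE x in lebesgue. \<bar>\<rho>0 x\<bar> \<le> B"
    using assms(3) by (auto simp: Linf_def)
  obtain lo hi where range: "0 \<le> lo" "ess_range_interval \<rho>0 = {lo..hi}" "AE x in lebesgue. lo \<le> \<rho>0 x \<and> \<rho>0 x \<le> hi"
    using ess_range_bounds[OF B assms(4)] by blast
  have dV: "(V has_real_derivative V' x) (at x)" for x by (rule W2inf_loc_DERIV[OF assms(5)])
  have cV': "continuous_on UNIV V'" and cV: "continuous_on UNIV V" using assms(5) by (auto simp: W2inf_loc_def)
  have V'0: "V' x \<le> 0" for x by (rule antimono_DERIV_nonpos[OF assms(6) dV])
  obtain U where dU: "\<And>x. (U has_real_derivative V' x * x) (at x)"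
    using continuous_antiderivative[OF continuous_on_mult[OF cV' continuous_on_id]] by blast
  \<comment> \<open>(A) is the case of slope bound \<open>0\<close> for \<open>\<xi> V'(\<xi>)\<close>, which is then decreasing\<close>
  obtain k1 k2 where k: "0 \<le> k1" "k1 < k2" and kappa: "\<kappa> = k2 - k1"
    and V'k: "\<And>\<xi>. \<xi> \<in> {lo..hi} \<Longrightarrow> V' \<xi> \<le> - k2"
    and slope: "\<And>x y. lo \<le> x \<Longrightarrow> x \<le> y \<Longrightarrow> y \<le> hi \<Longrightarrow> V' y * y - V' x * x \<le> k1 * (y - x)"
  proof (cases "\<exists>\<delta>. cond_A V' \<rho>0 \<delta> \<and> \<kappa> = \<delta>")
    case True
    then have "\<kappa> > 0" "\<And>\<xi>. \<xi> \<in> {lo..hi} \<Longrightarrow> V' \<xi> = - \<kappa>" by (auto simp: cond_A_def range(2))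
    then show ?thesis by (intro that[of 0 \<kappa>]) auto
  next
    case False
    then have "cond_B V' V'' \<rho>0 \<kappa>1 \<kappa>2" "\<kappa> = \<kappa>2 - \<kappa>1" using assms(7) by auto
    then have ae: "AE \<xi> in lebesgue. \<xi> \<in> {lo..hi} \<longrightarrow> V' \<xi> + V'' \<xi> * \<xi> \<le> \<kappa>1"
      and V'\<kappa>2: "\<forall>\<xi>\<in>{lo..hi}. V' \<xi> \<le> - \<kappa>2"
      unfolding cond_B_def range(2) by (auto elim: eventually_mono)
    show ?thesis using \<open>\<kappa> = \<kappa>2 - \<kappa>1\<close> assms(1,2) V'\<kappa>2 velocity_moment_slope_le[OF assms(5) ae]
      by (intro that[of \<kappa>1 \<kappa>2]) auto
  qed
  have main: "W \<epsilon> \<rho> t a - W \<epsilon> \<rho> t b \<le> 1 / (\<kappa> * t) * (b - a)" if t: "t > 0" and ab: "a < b" for t a b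
  proof -
    have ws: "weak_solution V \<rho>0 \<epsilon> (t + 1) \<rho>" using assms(9) t by simp
    then obtain C1 where C1: "\<And>s. s \<in> {0..t + 1} \<Longrightarrow> ess_bounded C1 (\<rho> s)"
      using C_L1_loc_bounded_everywhere[of \<rho> "t + 1"] t by (auto simp: weak_solution_def)
    have mono: "ess_bounded D g" if "ess_bounded D' g" "D' \<le> D" for D D' g
      using that unfolding ess_bounded_def by (auto elim!: eventually_mono)
    interpret oleinik_setting V \<rho>0 \<rho> \<epsilon> "t + 1" "max C1 B" V' U lo hi k1 k2
    proof
      show "ess_bounded (max C1 B) (\<rho> s)" if "s \<in> {0..t + 1}" for s using C1[OF that] by (rule mono) simp
      show "ess_bounded (max C1 B) \<rho>0" by (rule mono[of B]) (use B in \<open>auto simp: ess_bounded_def\<close>)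
    qed (use t assms ws cV cV' dV dU V'0 range k V'k slope in auto)
    show ?thesis using one_sided_bound[OF _ ab, of t] t by (simp add: W_eq_expavg kappa)
  qed
  show ?thesis
  proof (intro allI impI)
    fix t x y :: real assume t: "t > 0" and "x \<noteq> y"
    have "(W \<epsilon> \<rho> t x - W \<epsilon> \<rho> t y) / (x - y) \<ge> - (1 / (\<kappa> * t))" if "x < y" for x y
    proof -
      have "(W \<epsilon> \<rho> t x - W \<epsilon> \<rho> t y) / (y - x) \<le> 1 / (\<kappa> * t)"
        using main[OF t that] that by (simp add: divide_le_eq)
      moreover have "(W \<epsilon> \<rho> t x - W \<epsilon> \<rho> t y) / (x - y) = - ((W \<epsilon> \<rho> t x - W \<epsilon> \<rho> t y) / (y - x))"
        by (metis minus_diff_eq minus_divide_right)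
      ultimately show ?thesis by simp
    qed
    from this[of x y] this[of y x] \<open>x \<noteq> y\<close>
    show "(W \<epsilon> \<rho> t x - W \<epsilon> \<rho> t y) / (x - y) \<ge> - (1 / (\<kappa> * t))"
      by (metis linorder_neqE_linordered_idom minus_diff_eq minus_divide_divide)
  qed
qed

end
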